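(* Let $(L/K,v)$ be a finite separable unibranched extension of valued fields, and suppose that $v$ has rank $1$ and is nondiscrete. Let the basic setup be $(\mathcal O_K,I)$ with $I=\mathcal M_K$. Then $\mathcal O_K\rightarrow \mathcal O_L$ is almost finite étale if and only if $\Omega_{\mathcal O_L|\mathcal O_K}$ is almost zero.
   Context: For a valued field $(F,v)$, $\mathcal O_F$ denotes the valuation ring of $v$ on $F$, $\mathcal M_F$ its maximal ideal, and $vF$ the value group (a totally ordered abelian group). $(L/K,v)$ denotes a field extension $L/K$ with a valuation $v$ on $L$, whose restriction to $K$ is also denoted $v$; it is unibranched if $v|_K$ has a unique extension to $L$. "Rank $1$ and nondiscrete" means that the value group is nonzero, order-isomorphic to a subgroup of $\mathbb R$, and not isomorphic to $\mathbb Z$. $\Omega_{B|A}$ denotes the module of relative Kähler differentials. Let $R=\mathcal O_K$ and $I=\mathcal M_K$. An $R$-module $M$ is almost zero if $IM=0$. Let $A$ be an $R$-algebra and $M$ an $A$-module. $M$ is almost projective (over $A$) if $\mathrm{Ext}^1_A(M,N)$ is almost zero for all $A$-modules $N$. $M$ is almost finitely presented if for each $\epsilon\in I$ there exist a finitely presented $A$-module $M_\epsilon$ and an $A$-module homomorphism $M_\epsilon\to M$ with kernel and cokernel annihilated by $\epsilon$. A homomorphism $A\to B$ of $R$-algebras is almost finite étale if (1) $B$ is an almost finitely presented almost projective $A$-module, and (2) $B$ is an almost projective $B\otimes_AB$-module via the multiplication map $\mu_{B|A}:B\otimes_AB\to B$. *)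

theory Defs
  imports "HOL-Algebra.Algebra" "HOL-Algebra.Algebraic_Closure_Type"
begin

section \<open>Valued fields\<close>

text \<open>A valuation is recorded by its values on nonzero elements; the value at \<open>0\<close> (which is
  \<open>\<infinity>\<close> in the usual convention) is never looked at.  The type of values may be larger than the
  value group.\<close>

definition valuation :: "('k::field \<Rightarrow> 'g::linordered_ab_group_add) \<Rightarrow> bool" where
  "valuation v \<longleftrightarrow>
     (\<forall>x y. x \<noteq> 0 \<longrightarrow> y \<noteq> 0 \<longrightarrow> v (x * y) = v x + v y) \<and>
     (\<forall>x y. x \<noteq> 0 \<longrightarrow> y \<noteq> 0 \<longrightarrow> x + y \<noteq> 0 \<longrightarrow> min (v x) (v y) \<le> v (x + y))"

definition value_group :: "('k::field \<Rightarrow> 'g::linordered_ab_group_add) \<Rightarrow> 'g set" where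
  "value_group v = v ` (- {0})"

definition valuation_ring :: "('k::field \<Rightarrow> 'g::linordered_ab_group_add) \<Rightarrow> 'k set" where
  "valuation_ring v = {x. x = 0 \<or> 0 \<le> v x}"

definition maximal_ideal_of :: "('k::field \<Rightarrow> 'g::linordered_ab_group_add) \<Rightarrow> 'k set" where
  "maximal_ideal_of v = {x. x = 0 \<or> 0 < v x}"

definition ring_of_integers :: "('k::field \<Rightarrow> 'g::linordered_ab_group_add) \<Rightarrow> 'k ring" where
  "ring_of_integers v = ring_of_type_algebra\<lparr>carrier := valuation_ring v\<rparr>"

definition rank_one :: "('k::field \<Rightarrow> 'g::linordered_ab_group_add) \<Rightarrow> bool" where
  "rank_one v \<longleftrightarrow> value_group v \<noteq> {0} \<and>
     (\<exists>h :: 'g \<Rightarrow> real. strict_mono_on (value_group v) h \<and>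
        (\<forall>a\<in>value_group v. \<forall>b\<in>value_group v. h (a + b) = h a + h b))"

definition nondiscrete :: "('k::field \<Rightarrow> 'g::linordered_ab_group_add) \<Rightarrow> bool" where
  "nondiscrete v \<longleftrightarrow>
     \<not> (\<exists>h :: 'g \<Rightarrow> int. bij_betw h (value_group v) UNIV \<and>
        (\<forall>a\<in>value_group v. \<forall>b\<in>value_group v. h (a + b) = h a + h b))"

text \<open>A field extension \<open>L/K\<close> is given by the embedding \<open>i\<close> of \<open>K\<close> into \<open>L\<close>, which is
  automatically injective.\<close>

definition field_extension :: "('k::field \<Rightarrow> 'l::field) \<Rightarrow> bool" where
  "field_extension i \<longleftrightarrow> i \<in> ring_hom ring_of_type_algebra ring_of_type_algebra"

definition finite_extension :: "('k::field \<Rightarrow> 'l::field) \<Rightarrow> bool" where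
  "finite_extension i \<longleftrightarrow> (\<exists>B. finite B \<and> Modules.module.span (\<lambda>c x. i c * x) B = UNIV)"

text \<open>In the next definition \<open>p\<close> is the minimal polynomial of \<open>x\<close> over \<open>K\<close>.\<close>

definition separable_extension :: "('k::field \<Rightarrow> 'l::field) \<Rightarrow> bool" where
  "separable_extension i \<longleftrightarrow>
     (\<forall>x. \<exists>p :: 'k poly. lead_coeff p = 1 \<and> Factorial_Ring.irreducible p \<and>
        poly (map_poly i p) x = 0 \<and> coprime p (pderiv p))"

text \<open>Valuations are identified when they are equivalent, that is, when they have the same
  valuation ring (see \<open>valuation_ring_eq_iff\<close> below), and every subring of a field containing
  \<open>x\<close> or its inverse for each \<open>x\<close> is the ring of a valuation.  An extension to \<open>L\<close> of a valuation
  of \<open>K\<close> is therefore given by such a subring of \<open>L\<close>.  This makes uniqueness independent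
  of the type in which the values of another extension would live.\<close>

definition valuation_subring :: "'k::field set \<Rightarrow> bool" where
  "valuation_subring V \<longleftrightarrow>
     subring V (ring_of_type_algebra :: 'k ring) \<and> (\<forall>x. x \<in> V \<or> inverse x \<in> V)"

definition unibranched ::
  "('k::field \<Rightarrow> 'l::field) \<Rightarrow> ('l \<Rightarrow> 'g::linordered_ab_group_add) \<Rightarrow> bool" where
  "unibranched i v \<longleftrightarrow>
     (\<forall>V. valuation_subring V \<and> i -` V = valuation_ring (v \<circ> i) \<longrightarrow> V = valuation_ring v)"

lemma valuation_one: assumes "valuation v" shows "v 1 = 0"
proof -
  have "v (1 * 1) = v 1 + v 1" using assms unfolding valuation_def by (metis one_neq_zero)
  then show ?thesis by simp
qed

lemma valuation_inverse: assumes "valuation v" "x \<noteq> 0" shows "v (inverse x) = - v x"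
proof -
  have "v (x * inverse x) = v x + v (inverse x)"
    using assms unfolding valuation_def by (meson nonzero_imp_inverse_nonzero)
  then show ?thesis using assms valuation_one[OF assms(1)]
    by (simp add: eq_neg_iff_add_eq_0 add.commute)
qed

lemma valuation_minus: assumes "valuation v" shows "v (- x) = v x"
proof (cases "x = 0")
  case False
  have "v ((-1) * (-1)) = v (-1) + v (-1)"
    using assms unfolding valuation_def by (metis neg_equal_0_iff_equal one_neq_zero)
  then have "v (-1) = 0" using valuation_one[OF assms]
    by (simp add: double_zero)
  moreover have "v ((-1) * x) = v (-1) + v x"
    using assms False unfolding valuation_def by (metis neg_equal_0_iff_equal one_neq_zero)
  ultimately show ?thesis by simp
qed simp

lemma valuation_subring_valuation_ring:
  assumes "valuation v" shows "valuation_subring (valuation_ring v)"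
  unfolding valuation_subring_def
proof
  interpret R: ring "ring_of_type_algebra :: 'a ring" ..
  have neg: "\<ominus>\<^bsub>ring_of_type_algebra\<^esub> x = - x" for x :: 'a
    by (rule R.minus_equality) (auto simp: ring_of_type_algebra_def)
  have mult: "v (x * y) = v x + v y" if "x \<noteq> 0" "y \<noteq> 0" for x y
    using assms that unfolding valuation_def by blast
  have add: "min (v x) (v y) \<le> v (x + y)" if "x \<noteq> 0" "y \<noteq> 0" "x + y \<noteq> 0" for x y
    using assms that unfolding valuation_def by blast
  show "subring (valuation_ring v) (ring_of_type_algebra :: 'a ring)"
  proof (rule R.subringI)
    fix h assume "h \<in> valuation_ring v"
    then show "\<ominus>\<^bsub>ring_of_type_algebra\<^esub> h \<in> valuation_ring v"
      by (auto simp: neg valuation_ring_def valuation_minus[OF assms])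
  next
    fix x y assume "x \<in> valuation_ring v" "y \<in> valuation_ring v"
    then show "x \<otimes>\<^bsub>ring_of_type_algebra\<^esub> y \<in> valuation_ring v"
      using mult by (force simp: valuation_ring_def ring_of_type_algebra_def)
    show "x \<oplus>\<^bsub>ring_of_type_algebra\<^esub> y \<in> valuation_ring v"
      using add[of x y] \<open>x \<in> _\<close> \<open>y \<in> _\<close>
      by (force simp: valuation_ring_def ring_of_type_algebra_def min_def split: if_splits)
  qed (auto simp: ring_of_type_algebra_def valuation_ring_def valuation_one[OF assms])
  show "\<forall>x. x \<in> valuation_ring v \<or> inverse x \<in> valuation_ring v"
    using valuation_inverse[OF assms] by (auto simp: valuation_ring_def)
qed

lemma valuation_ring_eq_iff:
  assumes "valuation v" "valuation w"
  shows "valuation_ring v = valuation_ring w \<longleftrightarrow>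
           (\<forall>x y. x \<noteq> 0 \<longrightarrow> y \<noteq> 0 \<longrightarrow> (v x \<le> v y \<longleftrightarrow> w x \<le> w y))"
proof -
  have *: "u x \<le> u y \<longleftrightarrow> y * inverse x \<in> valuation_ring u"
    if "valuation u" "x \<noteq> 0" "y \<noteq> 0" for u :: "'a \<Rightarrow> 'h::linordered_ab_group_add" and x y
  proof -
    have "u (y * inverse x) = u y + u (inverse x)"
      using that unfolding valuation_def by (meson nonzero_imp_inverse_nonzero)
    then show ?thesis using that by (auto simp: valuation_ring_def valuation_inverse)
  qed
  have **: "u 1 = 0" if "valuation u" for u :: "'a \<Rightarrow> 'h::linordered_ab_group_add"
    using that by (rule valuation_one)
  show ?thesis
  proof
    assume "valuation_ring v = valuation_ring w"
    then show "\<forall>x y. x \<noteq> 0 \<longrightarrow> y \<noteq> 0 \<longrightarrow> (v x \<le> v y \<longleftrightarrow> w x \<le> w y)"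
      using *[OF assms(1)] *[OF assms(2)] by simp
  next
    assume "\<forall>x y. x \<noteq> 0 \<longrightarrow> y \<noteq> 0 \<longrightarrow> (v x \<le> v y \<longleftrightarrow> w x \<le> w y)"
    then have "v 1 \<le> v y \<longleftrightarrow> w 1 \<le> w y" if "y \<noteq> 0" for y using that by simp
    then show "valuation_ring v = valuation_ring w"
      by (auto simp: valuation_ring_def valuation_one[OF assms(1)] valuation_one[OF assms(2)])
  qed
qed


section \<open>Modules\<close>

definition submodule_generated ::
  "('a, 'c) ring_scheme \<Rightarrow> ('a, 'm) module \<Rightarrow> 'm set \<Rightarrow> 'm set" where
  "submodule_generated A M S = (\<lambda>N. submodule N A M) hull S"

text \<open>The multiplication and the unit are only meaningful if \<open>M\<close> is an algebra and \<open>S\<close> an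
  ideal.\<close>

definition quotient_module :: "('a, 'm) module \<Rightarrow> 'm set \<Rightarrow> ('a, 'm set) module" where
  "quotient_module M S =
     \<lparr>carrier = a_rcosets\<^bsub>M\<^esub> S, monoid.mult = rcoset_mult M S, one = S +>\<^bsub>M\<^esub> \<one>\<^bsub>M\<^esub>,
      ring.zero = S, ring.add = set_add M,
      module.smult = (\<lambda>a C. \<Union>x\<in>C. S +>\<^bsub>M\<^esub> (a \<odot>\<^bsub>M\<^esub> x))\<rparr>"

definition self_algebra :: "('a, 'c) ring_scheme \<Rightarrow> ('a, 'a) module" where
  "self_algebra A =
     \<lparr>carrier = carrier A, monoid.mult = monoid.mult A, one = \<one>\<^bsub>A\<^esub>, ring.zero = \<zero>\<^bsub>A\<^esub>, ring.add = ring.add A,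
      module.smult = monoid.mult A\<rparr>"

definition restrict_scalars :: "('r \<Rightarrow> 'a) \<Rightarrow> ('a, 'm) module \<Rightarrow> ('r, 'm) module" where
  "restrict_scalars f M =
     \<lparr>carrier = carrier M, monoid.mult = monoid.mult M, one = \<one>\<^bsub>M\<^esub>, ring.zero = \<zero>\<^bsub>M\<^esub>, ring.add = ring.add M,
      module.smult = (\<lambda>r x. f r \<odot>\<^bsub>M\<^esub> x)\<rparr>"

definition free_module :: "('a, 'c) ring_scheme \<Rightarrow> 'x set \<Rightarrow> ('a, 'x \<Rightarrow> 'a) module" where
  "free_module A Y =
     \<lparr>carrier = {f. range f \<subseteq> carrier A \<and> (\<forall>x. x \<notin> Y \<longrightarrow> f x = \<zero>\<^bsub>A\<^esub>) \<and>
                    finite {x. f x \<noteq> \<zero>\<^bsub>A\<^esub>}},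
      monoid.mult = undefined, one = undefined,
      ring.zero = (\<lambda>x. \<zero>\<^bsub>A\<^esub>), ring.add = (\<lambda>f g x. f x \<oplus>\<^bsub>A\<^esub> g x),
      module.smult = (\<lambda>a f x. a \<otimes>\<^bsub>A\<^esub> f x)\<rparr>"

definition free_gen :: "('a, 'c) ring_scheme \<Rightarrow> 'x \<Rightarrow> 'x \<Rightarrow> 'a" where
  "free_gen A x = (\<lambda>y. if y = x then \<one>\<^bsub>A\<^esub> else \<zero>\<^bsub>A\<^esub>)"

text \<open>The linear extension to the free module of a map \<open>\<phi>\<close> from the generators to \<open>M\<close>.\<close>

definition free_lift ::
  "('a, 'c) ring_scheme \<Rightarrow> ('a, 'm) module \<Rightarrow> ('x \<Rightarrow> 'm) \<Rightarrow> ('x \<Rightarrow> 'a) \<Rightarrow> 'm" where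
  "free_lift A M \<phi> f = (\<Oplus>\<^bsub>M\<^esub>x\<in>{x. f x \<noteq> \<zero>\<^bsub>A\<^esub>}. f x \<odot>\<^bsub>M\<^esub> \<phi> x)"

text \<open>Homomorphisms are extensional functions, so that they are determined by their values on
  the carrier.\<close>

definition module_hom ::
  "('a, 'c) ring_scheme \<Rightarrow> ('a, 'm) module \<Rightarrow> ('a, 'n) module \<Rightarrow> ('m \<Rightarrow> 'n) set" where
  "module_hom A M N =
     {h \<in> carrier M \<rightarrow>\<^sub>E carrier N.
        (\<forall>x\<in>carrier M. \<forall>y\<in>carrier M. h (x \<oplus>\<^bsub>M\<^esub> y) = h x \<oplus>\<^bsub>N\<^esub> h y) \<and>
        (\<forall>a\<in>carrier A. \<forall>x\<in>carrier M. h (a \<odot>\<^bsub>M\<^esub> x) = a \<odot>\<^bsub>N\<^esub> h x)}"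

definition hom_module ::
  "('a, 'c) ring_scheme \<Rightarrow> ('a, 'm) module \<Rightarrow> ('a, 'n) module \<Rightarrow> ('a, 'm \<Rightarrow> 'n) module" where
  "hom_module A M N =
     \<lparr>carrier = module_hom A M N, monoid.mult = undefined, one = undefined,
      ring.zero = (\<lambda>x\<in>carrier M. \<zero>\<^bsub>N\<^esub>),
      ring.add = (\<lambda>f g. \<lambda>x\<in>carrier M. f x \<oplus>\<^bsub>N\<^esub> g x),
      module.smult = (\<lambda>a f. \<lambda>x\<in>carrier M. a \<odot>\<^bsub>N\<^esub> f x)\<rparr>"

text \<open>\<open>Ext\<^sup>1\<close> is computed from the canonical presentation
  \<open>0 \<rightarrow> K \<rightarrow> F \<rightarrow> M \<rightarrow> 0\<close>, where \<open>F\<close> is free on the elements of \<open>M\<close>: it is the cokernel of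
  the restriction map \<open>Hom(F, N) \<rightarrow> Hom(K, N)\<close>.\<close>

definition free_cover :: "('a, 'c) ring_scheme \<Rightarrow> ('a, 'm) module \<Rightarrow> ('a, 'm \<Rightarrow> 'a) module" where
  "free_cover A M = free_module A (carrier M)"

definition free_cover_kernel ::
  "('a, 'c) ring_scheme \<Rightarrow> ('a, 'm) module \<Rightarrow> ('a, 'm \<Rightarrow> 'a) module" where
  "free_cover_kernel A M =
     (free_cover A M)\<lparr>carrier := a_kernel (free_cover A M) M (free_lift A M (\<lambda>x. x))\<rparr>"

definition Ext1 ::
  "('a, 'c) ring_scheme \<Rightarrow> ('a, 'm) module \<Rightarrow> ('a, 'n) module
     \<Rightarrow> ('a, (('m \<Rightarrow> 'a) \<Rightarrow> 'n) set) module" where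
  "Ext1 A M N =
     quotient_module (hom_module A (free_cover_kernel A M) N)
       ((\<lambda>h. restrict h (carrier (free_cover_kernel A M))) ` module_hom A (free_cover A M) N)"

definition finitely_presented :: "('a, 'c) ring_scheme \<Rightarrow> ('a, 'm) module \<Rightarrow> bool" where
  "finitely_presented A M \<longleftrightarrow>
     (\<exists>n::nat. \<exists>h\<in>module_hom A (free_module A {..<n}) M.
        h ` carrier (free_module A {..<n}) = carrier M \<and>
        (\<exists>S. finite S \<and> S \<subseteq> carrier (free_module A {..<n}) \<and>
           a_kernel (free_module A {..<n}) M h = submodule_generated A (free_module A {..<n}) S))"


section \<open>Tensor products of algebras and differentials\<close>

definition monoid_algebra :: "('a, 'c) ring_scheme \<Rightarrow> 'x monoid \<Rightarrow> ('a, 'x \<Rightarrow> 'a) module" where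
  "monoid_algebra A G =
     (free_module A (carrier G))
       \<lparr>monoid.mult := (\<lambda>f g z. \<Oplus>\<^bsub>A\<^esub>p\<in>{p. f (fst p) \<noteq> \<zero>\<^bsub>A\<^esub> \<and> g (snd p) \<noteq> \<zero>\<^bsub>A\<^esub> \<and>
                                    fst p \<otimes>\<^bsub>G\<^esub> snd p = z}. f (fst p) \<otimes>\<^bsub>A\<^esub> g (snd p)),
        one := free_gen A \<one>\<^bsub>G\<^esub>\<rparr>"

definition tensor_relations ::
  "('a, 'c) ring_scheme \<Rightarrow> ('a, 'b) module \<Rightarrow> ('a, 'd) module \<Rightarrow> ('b \<times> 'd \<Rightarrow> 'a) set" where
  "tensor_relations A B C =
     (let F = free_module A (carrier B \<times> carrier C); t = (\<lambda>x y. free_gen A (x, y)) in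
       {t (x \<oplus>\<^bsub>B\<^esub> x') y \<ominus>\<^bsub>F\<^esub> (t x y \<oplus>\<^bsub>F\<^esub> t x' y) | x x' y.
          x \<in> carrier B \<and> x' \<in> carrier B \<and> y \<in> carrier C} \<union>
       {t x (y \<oplus>\<^bsub>C\<^esub> y') \<ominus>\<^bsub>F\<^esub> (t x y \<oplus>\<^bsub>F\<^esub> t x y') | x y y'.
          x \<in> carrier B \<and> y \<in> carrier C \<and> y' \<in> carrier C} \<union>
       {t (a \<odot>\<^bsub>B\<^esub> x) y \<ominus>\<^bsub>F\<^esub> a \<odot>\<^bsub>F\<^esub> t x y | a x y.
          a \<in> carrier A \<and> x \<in> carrier B \<and> y \<in> carrier C} \<union>
       {t x (a \<odot>\<^bsub>C\<^esub> y) \<ominus>\<^bsub>F\<^esub> a \<odot>\<^bsub>F\<^esub> t x y | a x y.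
          a \<in> carrier A \<and> x \<in> carrier B \<and> y \<in> carrier C})"

text \<open>The quotient of the free module on \<open>B \<times> C\<close> by the bilinearity relations.  Its product,
  induced by that of the monoid algebra, satisfies
  \<open>(x \<otimes> y) (x' \<otimes> y') = x x' \<otimes> y y'\<close>.\<close>

definition tensor_algebra ::
  "('a, 'c) ring_scheme \<Rightarrow> ('a, 'b) module \<Rightarrow> ('a, 'd) module
     \<Rightarrow> ('a, ('b \<times> 'd \<Rightarrow> 'a) set) module" where
  "tensor_algebra A B C =
     quotient_module (monoid_algebra A (B \<times>\<times> C))
       (submodule_generated A (free_module A (carrier B \<times> carrier C)) (tensor_relations A B C))"

definition multiplication_map ::
  "('a, 'c) ring_scheme \<Rightarrow> ('a, 'b) module \<Rightarrow> ('b \<times> 'b \<Rightarrow> 'a) set \<Rightarrow> 'b" where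
  "multiplication_map A B C = the_elem (free_lift A B (\<lambda>p. fst p \<otimes>\<^bsub>B\<^esub> snd p) ` C)"

text \<open>Differentials of a ring homomorphism \<open>f : A \<rightarrow> B\<close>: the \<open>B\<close>-module with a
  generator for each element of \<open>B\<close>, subject to additivity, the Leibniz rule and the vanishing
  of \<open>d\<close> on the image of \<open>A\<close>.\<close>

definition kaehler_relations ::
  "('a, 'c) ring_scheme \<Rightarrow> ('b, 'e) ring_scheme \<Rightarrow> ('a \<Rightarrow> 'b) \<Rightarrow> ('b \<Rightarrow> 'b) set" where
  "kaehler_relations A B f =
     (let F = free_module B (carrier B); d = free_gen B in
       {d (x \<oplus>\<^bsub>B\<^esub> y) \<ominus>\<^bsub>F\<^esub> (d x \<oplus>\<^bsub>F\<^esub> d y) | x y. x \<in> carrier B \<and> y \<in> carrier B} \<union>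
       {d (x \<otimes>\<^bsub>B\<^esub> y) \<ominus>\<^bsub>F\<^esub> (x \<odot>\<^bsub>F\<^esub> d y \<oplus>\<^bsub>F\<^esub> y \<odot>\<^bsub>F\<^esub> d x) | x y.
          x \<in> carrier B \<and> y \<in> carrier B} \<union>
       {d (f a) | a. a \<in> carrier A})"

definition kaehler_differentials ::
  "('a, 'c) ring_scheme \<Rightarrow> ('b, 'e) ring_scheme \<Rightarrow> ('a \<Rightarrow> 'b) \<Rightarrow> ('b, ('b \<Rightarrow> 'b) set) module" where
  "kaehler_differentials A B f =
     quotient_module (free_module B (carrier B))
       (submodule_generated B (free_module B (carrier B)) (kaehler_relations A B f))"


section \<open>Almost ring theory\<close>

text \<open>Throughout, \<open>I\<close> is an ideal of the base ring \<open>R\<close>, and an \<open>R\<close>-algebra \<open>A\<close> is a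
  commutative ring together with its structure homomorphism \<open>u : R \<rightarrow> A\<close>.\<close>

definition annihilated_by :: "'a \<Rightarrow> ('a, 'm) module \<Rightarrow> bool" where
  "annihilated_by a M \<longleftrightarrow> (\<forall>x\<in>carrier M. a \<odot>\<^bsub>M\<^esub> x = \<zero>\<^bsub>M\<^esub>)"

definition almost_zero :: "'r set \<Rightarrow> ('r, 'm) module \<Rightarrow> bool" where
  "almost_zero I M \<longleftrightarrow> (\<forall>\<epsilon>\<in>I. annihilated_by \<epsilon> M)"

text \<open>The modules \<open>N\<close> range over the type that carries the kernel of the free cover of \<open>M\<close>.
  This covers modules over every type: see \<open>almost_projective_Ext1\<close> below.\<close>

definition almost_projective ::
  "'r set \<Rightarrow> ('r \<Rightarrow> 'a) \<Rightarrow> ('a, 'c) ring_scheme \<Rightarrow> ('a, 'm) module \<Rightarrow> bool" where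
  "almost_projective I u A M \<longleftrightarrow>
     (\<forall>N :: ('a, 'm \<Rightarrow> 'a) module. Module.module A N \<longrightarrow>
        almost_zero I (restrict_scalars u (Ext1 A M N)))"

text \<open>Every finitely presented module is isomorphic to one over the type used for \<open>P\<close>: see
  \<open>almost_finitely_presentedI\<close> below.\<close>

definition almost_finitely_presented ::
  "'r set \<Rightarrow> ('r \<Rightarrow> 'a) \<Rightarrow> ('a, 'c) ring_scheme \<Rightarrow> ('a, 'm) module \<Rightarrow> bool" where
  "almost_finitely_presented I u A M \<longleftrightarrow>
     (\<forall>\<epsilon>\<in>I. \<exists>(P :: ('a, (nat \<Rightarrow> 'a) set) module) h.
        Module.module A P \<and> finitely_presented A P \<and> h \<in> module_hom A P M \<and>
        annihilated_by (u \<epsilon>) (P\<lparr>carrier := a_kernel P M h\<rparr>) \<and>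
        annihilated_by (u \<epsilon>) (quotient_module M (h ` carrier P)))"

definition almost_finite_etale ::
  "'r set \<Rightarrow> ('r \<Rightarrow> 'a) \<Rightarrow> ('a, 'c) ring_scheme \<Rightarrow> ('b, 'd) ring_scheme \<Rightarrow> ('a \<Rightarrow> 'b) \<Rightarrow> bool" where
  "almost_finite_etale I u A B f \<longleftrightarrow>
     (let B\<^sub>A = restrict_scalars f (self_algebra B); T = tensor_algebra A B\<^sub>A B\<^sub>A in
        almost_finitely_presented I u A B\<^sub>A \<and>
        almost_projective I u A B\<^sub>A \<and>
        almost_projective I (\<lambda>r. u r \<odot>\<^bsub>T\<^esub> \<one>\<^bsub>T\<^esub>) T
          (restrict_scalars (multiplication_map A B\<^sub>A) (self_algebra B)))"


section \<open>Independence of the types of test modules and of finitely presented modules\<close>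

lemma free_module_module:
  assumes "cring A" shows "Module.module A (free_module A Y)"
proof -
  interpret A: cring A by fact
  have fin: "finite {x. f x \<oplus>\<^bsub>A\<^esub> g x \<noteq> \<zero>\<^bsub>A\<^esub>}"
    if "finite {x. f x \<noteq> \<zero>\<^bsub>A\<^esub>}" "finite {x. g x \<noteq> \<zero>\<^bsub>A\<^esub>}" for f g
    using finite_UnI[OF that] by (rule finite_subset[rotated]) auto
  have fin2: "finite {x. a \<otimes>\<^bsub>A\<^esub> f x \<noteq> \<zero>\<^bsub>A\<^esub>}"
    if "finite {x. f x \<noteq> \<zero>\<^bsub>A\<^esub>}" "a \<in> carrier A" for f a
    using that(1) by (rule finite_subset[rotated]) (use that in auto)
  show ?thesis
  proof (rule moduleI)
    show "abelian_group (free_module A Y)"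
    proof (rule abelian_groupI)
      fix f assume f: "f \<in> carrier (free_module A Y)"
      have "{x. \<ominus>\<^bsub>A\<^esub> f x \<noteq> \<zero>\<^bsub>A\<^esub>} \<subseteq> {x. f x \<noteq> \<zero>\<^bsub>A\<^esub>}" by auto
      then have "(\<lambda>x. \<ominus>\<^bsub>A\<^esub> f x) \<in> carrier (free_module A Y)"
        using f by (auto simp: free_module_def image_subset_iff intro: finite_subset)
      moreover have "(\<lambda>x. \<ominus>\<^bsub>A\<^esub> f x) \<oplus>\<^bsub>free_module A Y\<^esub> f = \<zero>\<^bsub>free_module A Y\<^esub>"
        using f by (auto simp: free_module_def image_subset_iff A.l_neg)
      ultimately show "\<exists>y\<in>carrier (free_module A Y). y \<oplus>\<^bsub>free_module A Y\<^esub> f = \<zero>\<^bsub>free_module A Y\<^esub>"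
        by blast
    qed (auto simp: free_module_def image_subset_iff fin A.a_ac)
  qed (auto simp: free_module_def image_subset_iff fin fin2 assms A.l_distr A.r_distr A.m_assoc)
qed

lemma module_homD:
  assumes "h \<in> module_hom A M N"
  shows "x \<in> carrier M \<Longrightarrow> h x \<in> carrier N"
    and "x \<in> carrier M \<Longrightarrow> y \<in> carrier M \<Longrightarrow> h (x \<oplus>\<^bsub>M\<^esub> y) = h x \<oplus>\<^bsub>N\<^esub> h y"
    and "a \<in> carrier A \<Longrightarrow> x \<in> carrier M \<Longrightarrow> h (a \<odot>\<^bsub>M\<^esub> x) = a \<odot>\<^bsub>N\<^esub> h x"
    and "h \<in> extensional (carrier M)"
  using assms by (auto simp: module_hom_def PiE_def)

lemma linear_zero_neg:
  assumes M: "Module.module A M" and N: "Module.module A N"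
    and cl: "\<And>x. x \<in> carrier M \<Longrightarrow> h x \<in> carrier N"
    and sm: "\<And>a x. a \<in> carrier A \<Longrightarrow> x \<in> carrier M \<Longrightarrow> h (a \<odot>\<^bsub>M\<^esub> x) = a \<odot>\<^bsub>N\<^esub> h x"
  shows "h \<zero>\<^bsub>M\<^esub> = \<zero>\<^bsub>N\<^esub>" and "x \<in> carrier M \<Longrightarrow> h (\<ominus>\<^bsub>M\<^esub> x) = \<ominus>\<^bsub>N\<^esub> h x"
proof -
  interpret M: Module.module A M by fact
  interpret N: Module.module A N by fact
  have "h (\<zero>\<^bsub>A\<^esub> \<odot>\<^bsub>M\<^esub> \<zero>\<^bsub>M\<^esub>) = \<zero>\<^bsub>A\<^esub> \<odot>\<^bsub>N\<^esub> h \<zero>\<^bsub>M\<^esub>" by (rule sm) auto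
  then show "h \<zero>\<^bsub>M\<^esub> = \<zero>\<^bsub>N\<^esub>" using cl by (simp add: N.smult_l_null)
  assume x: "x \<in> carrier M"
  have "h ((\<ominus>\<^bsub>A\<^esub> \<one>\<^bsub>A\<^esub>) \<odot>\<^bsub>M\<^esub> x) = (\<ominus>\<^bsub>A\<^esub> \<one>\<^bsub>A\<^esub>) \<odot>\<^bsub>N\<^esub> h x" using x by (intro sm) auto
  then show "h (\<ominus>\<^bsub>M\<^esub> x) = \<ominus>\<^bsub>N\<^esub> h x"
    using x cl by (simp add: M.smult_l_minus N.smult_l_minus)
qed

lemma kernel_submodule:
  assumes M: "Module.module A M" and N: "Module.module A N"
    and cl: "\<And>x. x \<in> carrier M \<Longrightarrow> h x \<in> carrier N"
    and ad: "\<And>x y. x \<in> carrier M \<Longrightarrow> y \<in> carrier M \<Longrightarrow> h (x \<oplus>\<^bsub>M\<^esub> y) = h x \<oplus>\<^bsub>N\<^esub> h y"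
    and sm: "\<And>a x. a \<in> carrier A \<Longrightarrow> x \<in> carrier M \<Longrightarrow> h (a \<odot>\<^bsub>M\<^esub> x) = a \<odot>\<^bsub>N\<^esub> h x"
  shows "submodule (a_kernel M N h) A M"
proof -
  interpret M: Module.module A M by fact
  interpret N: Module.module A N by fact
  note z = linear_zero_neg[OF M N cl sm]
  show ?thesis
    by (rule M.submoduleI) (auto simp: a_kernel_def' z ad sm)
qed

lemma quotient_module_module:
  assumes M: "Module.module A M" and S: "submodule S A M"
  shows "Module.module A (quotient_module M S)"
    and "x \<in> carrier M \<Longrightarrow> a \<in> carrier A \<Longrightarrow>
           a \<odot>\<^bsub>quotient_module M S\<^esub> (S +>\<^bsub>M\<^esub> x) = S +>\<^bsub>M\<^esub> (a \<odot>\<^bsub>M\<^esub> x)"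
    and "x \<in> carrier M \<Longrightarrow> y \<in> carrier M \<Longrightarrow>
           (S +>\<^bsub>M\<^esub> x) \<oplus>\<^bsub>quotient_module M S\<^esub> (S +>\<^bsub>M\<^esub> y) = S +>\<^bsub>M\<^esub> (x \<oplus>\<^bsub>M\<^esub> y)"
    and "carrier (quotient_module M S) = (\<lambda>x. S +>\<^bsub>M\<^esub> x) ` carrier M"
    and "x \<in> carrier M \<Longrightarrow> S +>\<^bsub>M\<^esub> x = \<zero>\<^bsub>quotient_module M S\<^esub> \<longleftrightarrow> x \<in> S"
proof -
  interpret M: Module.module A M by fact
  interpret S: abelian_subgroup S M
    by (rule abelian_subgroupI3)
       (use S in \<open>auto simp: submodule_def additive_subgroup_def M.abelian_group_axioms\<close>)
  note sub = M.submoduleE[OF S]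
  show sm: "a \<odot>\<^bsub>quotient_module M S\<^esub> (S +>\<^bsub>M\<^esub> x) = S +>\<^bsub>M\<^esub> (a \<odot>\<^bsub>M\<^esub> x)"
    if "x \<in> carrier M" "a \<in> carrier A" for a x
  proof -
    have "S +>\<^bsub>M\<^esub> (a \<odot>\<^bsub>M\<^esub> y) = S +>\<^bsub>M\<^esub> (a \<odot>\<^bsub>M\<^esub> x)" if y: "y \<in> S +>\<^bsub>M\<^esub> x" for y
    proof -
      obtain s where s: "s \<in> S" "y = s \<oplus>\<^bsub>M\<^esub> x"
        using y by (auto simp: a_r_coset_def')
      have "a \<odot>\<^bsub>M\<^esub> y = a \<odot>\<^bsub>M\<^esub> s \<oplus>\<^bsub>M\<^esub> a \<odot>\<^bsub>M\<^esub> x"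
        using s sub that \<open>x \<in> _\<close> \<open>a \<in> _\<close> by (auto simp: M.smult_r_distr)
      then have "a \<odot>\<^bsub>M\<^esub> y \<in> S +>\<^bsub>M\<^esub> (a \<odot>\<^bsub>M\<^esub> x)"
        using s sub \<open>a \<in> _\<close> by (auto simp: a_r_coset_def')
      then show ?thesis
        using S.a_repr_independence'[of "a \<odot>\<^bsub>M\<^esub> y" "a \<odot>\<^bsub>M\<^esub> x"] \<open>x \<in> _\<close> \<open>a \<in> _\<close> by simp
    qed
    moreover have "x \<in> S +>\<^bsub>M\<^esub> x" using \<open>x \<in> _\<close> by (rule S.a_rcos_self)
    ultimately have "(\<Union>y\<in>S +>\<^bsub>M\<^esub> x. S +>\<^bsub>M\<^esub> (a \<odot>\<^bsub>M\<^esub> y)) = S +>\<^bsub>M\<^esub> (a \<odot>\<^bsub>M\<^esub> x)"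
      by blast
    then show ?thesis by (simp add: quotient_module_def)
  qed
  show add: "(S +>\<^bsub>M\<^esub> x) \<oplus>\<^bsub>quotient_module M S\<^esub> (S +>\<^bsub>M\<^esub> y) = S +>\<^bsub>M\<^esub> (x \<oplus>\<^bsub>M\<^esub> y)"
    if "x \<in> carrier M" "y \<in> carrier M" for x y
    using that by (simp add: quotient_module_def S.a_rcos_sum)
  show car: "carrier (quotient_module M S) = (\<lambda>x. S +>\<^bsub>M\<^esub> x) ` carrier M"
    by (auto simp: quotient_module_def A_RCOSETS_def')
  have zero: "\<zero>\<^bsub>quotient_module M S\<^esub> = S +>\<^bsub>M\<^esub> \<zero>\<^bsub>M\<^esub>"
    by (simp add: quotient_module_def M.a_coset_add_zero[OF sub(1)])
  show "S +>\<^bsub>M\<^esub> x = \<zero>\<^bsub>quotient_module M S\<^esub> \<longleftrightarrow> x \<in> S" if "x \<in> carrier M" for x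
  proof -
    have "\<zero>\<^bsub>quotient_module M S\<^esub> = S" by (simp add: quotient_module_def)
    then show ?thesis using S.a_rcos_const[of x] S.a_rcos_self[OF that] by auto
  qed
  show "Module.module A (quotient_module M S)"
  proof (rule moduleI)
    show "abelian_group (quotient_module M S)"
    proof (rule abelian_groupI)
      fix C assume "C \<in> carrier (quotient_module M S)"
      then obtain x where x: "x \<in> carrier M" "C = S +>\<^bsub>M\<^esub> x" by (auto simp: car)
      then show "\<exists>y\<in>carrier (quotient_module M S).
           y \<oplus>\<^bsub>quotient_module M S\<^esub> C = \<zero>\<^bsub>quotient_module M S\<^esub>"
        by (intro bexI[of _ "S +>\<^bsub>M\<^esub> (\<ominus>\<^bsub>M\<^esub> x)"]) (auto simp: car add zero M.l_neg)
    qed (auto simp: car add zero M.a_ac)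
  qed (auto simp: car add sm M.smult_l_distr M.smult_r_distr M.smult_assoc1 M.R.cring_axioms)
qed

lemma annihilated_by_quotient_iff:
  assumes "Module.module A M" "submodule S A M" "a \<in> carrier A"
  shows "annihilated_by a (quotient_module M S) \<longleftrightarrow> (\<forall>x\<in>carrier M. a \<odot>\<^bsub>M\<^esub> x \<in> S)"
proof -
  interpret M: Module.module A M by fact
  show ?thesis
    unfolding annihilated_by_def
    by (auto simp: quotient_module_module[OF assms(1,2)] assms(3))
qed

lemma free_lift_linear:
  assumes M: "Module.module A M" and \<phi>: "\<And>y. y \<in> Y \<Longrightarrow> \<phi> y \<in> carrier M"
  shows "f \<in> carrier (free_module A Y) \<Longrightarrow> free_lift A M \<phi> f \<in> carrier M"
    and "f \<in> carrier (free_module A Y) \<Longrightarrow> g \<in> carrier (free_module A Y) \<Longrightarrow>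
           free_lift A M \<phi> (f \<oplus>\<^bsub>free_module A Y\<^esub> g) = free_lift A M \<phi> f \<oplus>\<^bsub>M\<^esub> free_lift A M \<phi> g"
    and "a \<in> carrier A \<Longrightarrow> f \<in> carrier (free_module A Y) \<Longrightarrow>
           free_lift A M \<phi> (a \<odot>\<^bsub>free_module A Y\<^esub> f) = a \<odot>\<^bsub>M\<^esub> free_lift A M \<phi> f"
proof -
  interpret M: Module.module A M by fact
  let ?s = "\<lambda>f. {x. f x \<noteq> \<zero>\<^bsub>A\<^esub>}"
  have memD: "finite (?s f)" "?s f \<subseteq> Y" "\<And>x. f x \<in> carrier A"
    if "f \<in> carrier (free_module A Y)" for f
    using that by (auto simp: free_module_def)
  have cl: "(\<lambda>x. f x \<odot>\<^bsub>M\<^esub> \<phi> x) \<in> Z \<rightarrow> carrier M"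
    if "f \<in> carrier (free_module A Y)" "Z \<subseteq> Y" for f Z
    using memD[OF that(1)] that(2) \<phi> by auto
  show 1: "free_lift A M \<phi> f \<in> carrier M" if "f \<in> carrier (free_module A Y)" for f
    unfolding free_lift_def by (intro M.finsum_closed cl that memD)
  have ext: "free_lift A M \<phi> f = (\<Oplus>\<^bsub>M\<^esub>x\<in>Z. f x \<odot>\<^bsub>M\<^esub> \<phi> x)"
    if f: "f \<in> carrier (free_module A Y)" and Z: "finite Z" "?s f \<subseteq> Z" "Z \<subseteq> Y" for f Z
    unfolding free_lift_def
    by (rule M.add.finprod_mono_neutral_cong_left)
       (use Z \<phi> cl[OF f Z(3)] in auto)
  show "free_lift A M \<phi> (f \<oplus>\<^bsub>free_module A Y\<^esub> g) = free_lift A M \<phi> f \<oplus>\<^bsub>M\<^esub> free_lift A M \<phi> g"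
    if f: "f \<in> carrier (free_module A Y)" and g: "g \<in> carrier (free_module A Y)" for f g
  proof -
    interpret F: Module.module A "free_module A Y" by (rule free_module_module) (rule M.R.cring_axioms)
    let ?Z = "?s f \<union> ?s g"
    have Z: "finite ?Z" "?Z \<subseteq> Y" using memD[OF f] memD[OF g] by auto
    have fg: "f \<oplus>\<^bsub>free_module A Y\<^esub> g \<in> carrier (free_module A Y)" using f g by simp
    have e: "(f \<oplus>\<^bsub>free_module A Y\<^esub> g) x = f x \<oplus>\<^bsub>A\<^esub> g x" for x by (simp add: free_module_def)
    have "free_lift A M \<phi> (f \<oplus>\<^bsub>free_module A Y\<^esub> g)
        = (\<Oplus>\<^bsub>M\<^esub>x\<in>?Z. (f \<oplus>\<^bsub>free_module A Y\<^esub> g) x \<odot>\<^bsub>M\<^esub> \<phi> x)"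
      by (rule ext[OF fg Z(1) _ Z(2)]) (auto simp: e)
    also have "\<dots> = (\<Oplus>\<^bsub>M\<^esub>x\<in>?Z. f x \<odot>\<^bsub>M\<^esub> \<phi> x \<oplus>\<^bsub>M\<^esub> g x \<odot>\<^bsub>M\<^esub> \<phi> x)"
      by (rule M.finsum_cong')
         (use Z cl[OF f Z(2)] cl[OF g Z(2)] memD[OF f] memD[OF g] \<phi> in
          \<open>auto simp: e M.smult_l_distr subset_iff\<close>)
    also have "\<dots> = (\<Oplus>\<^bsub>M\<^esub>x\<in>?Z. f x \<odot>\<^bsub>M\<^esub> \<phi> x) \<oplus>\<^bsub>M\<^esub> (\<Oplus>\<^bsub>M\<^esub>x\<in>?Z. g x \<odot>\<^bsub>M\<^esub> \<phi> x)"
      by (rule M.finsum_addf) (use cl[OF f Z(2)] cl[OF g Z(2)] in auto)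
    also have "\<dots> = free_lift A M \<phi> f \<oplus>\<^bsub>M\<^esub> free_lift A M \<phi> g"
      using ext[OF f Z(1) _ Z(2)] ext[OF g Z(1) _ Z(2)] by simp
    finally show ?thesis .
  qed
  show "free_lift A M \<phi> (a \<odot>\<^bsub>free_module A Y\<^esub> f) = a \<odot>\<^bsub>M\<^esub> free_lift A M \<phi> f"
    if a: "a \<in> carrier A" and f: "f \<in> carrier (free_module A Y)" for a f
  proof -
    interpret F: Module.module A "free_module A Y" by (rule free_module_module) (rule M.R.cring_axioms)
    have af: "a \<odot>\<^bsub>free_module A Y\<^esub> f \<in> carrier (free_module A Y)" using a f by simp
    have e: "(a \<odot>\<^bsub>free_module A Y\<^esub> f) x = a \<otimes>\<^bsub>A\<^esub> f x" for x by (simp add: free_module_def)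
    have "free_lift A M \<phi> (a \<odot>\<^bsub>free_module A Y\<^esub> f)
        = (\<Oplus>\<^bsub>M\<^esub>x\<in>?s f. (a \<odot>\<^bsub>free_module A Y\<^esub> f) x \<odot>\<^bsub>M\<^esub> \<phi> x)"
      by (rule ext[OF af]) (use memD[OF f] a in \<open>auto simp: e\<close>)
    also have "\<dots> = (\<Oplus>\<^bsub>M\<^esub>x\<in>?s f. a \<odot>\<^bsub>M\<^esub> (f x \<odot>\<^bsub>M\<^esub> \<phi> x))"
      by (rule M.finsum_cong')
         (use memD[OF f] a \<phi> in \<open>auto simp: e M.smult_assoc1 subset_iff\<close>)
    also have "\<dots> = a \<odot>\<^bsub>M\<^esub> free_lift A M \<phi> f"
      unfolding free_lift_def
      by (rule M.finsum_smult_ldistr[symmetric]) (use memD[OF f] cl[OF f] a in auto)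
    finally show ?thesis .
  qed
qed

lemma hom_module_module:
  assumes M: "Module.module A M" and N: "Module.module A N"
  shows "Module.module A (hom_module A M N)"
proof -
  interpret M: Module.module A M by fact
  interpret N: Module.module A N by fact
  have neg: "\<exists>g\<in>module_hom A M N. (\<lambda>x\<in>carrier M. g x \<oplus>\<^bsub>N\<^esub> f x) = (\<lambda>x\<in>carrier M. \<zero>\<^bsub>N\<^esub>)"
    if f: "f \<in> module_hom A M N" for f
    by (rule bexI[of _ "\<lambda>x\<in>carrier M. \<ominus>\<^bsub>N\<^esub> f x"])
       (use module_homD[OF f] in
        \<open>auto simp: module_hom_def N.l_neg N.r_neg N.minus_add N.smult_r_minus N.a_comm
              intro!: restrict_ext\<close>)
  show ?thesis
  proof (rule moduleI)
    show "abelian_group (hom_module A M N)"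
    proof (rule abelian_groupI, goal_cases)
      case (6 f) then show ?case using neg[of f] by (simp add: hom_module_def)
    qed (auto simp: hom_module_def module_hom_def PiE_iff N.a_ac N.smult_r_distr
          intro!: extensionalityI[of _ "carrier M"])
    fix a b f assume "a \<in> carrier A" "b \<in> carrier A" "f \<in> carrier (hom_module A M N)"
    then show "(a \<otimes>\<^bsub>A\<^esub> b) \<odot>\<^bsub>hom_module A M N\<^esub> f = a \<odot>\<^bsub>hom_module A M N\<^esub> (b \<odot>\<^bsub>hom_module A M N\<^esub> f)"
      by (auto simp: hom_module_def module_hom_def PiE_iff N.smult_assoc1 intro!: restrict_ext)
  next
    fix a f assume a: "a \<in> carrier A" and "f \<in> carrier (hom_module A M N)"
    then have f: "f \<in> module_hom A M N" by (simp add: hom_module_def)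
    have "b \<odot>\<^bsub>N\<^esub> (a \<odot>\<^bsub>N\<^esub> f x) = a \<odot>\<^bsub>N\<^esub> (b \<odot>\<^bsub>N\<^esub> f x)" if "b \<in> carrier A" "x \<in> carrier M" for b x
      using a module_homD(1)[OF f that(2)] that
      by (metis N.smult_assoc1 M.R.m_comm)
    then show "a \<odot>\<^bsub>hom_module A M N\<^esub> f \<in> carrier (hom_module A M N)"
      using a module_homD[OF f] by (auto simp: hom_module_def module_hom_def N.smult_r_distr)
  qed (auto simp: hom_module_def module_hom_def PiE_iff N.smult_l_distr N.smult_r_distr M.R.cring_axioms
        intro!: extensionalityI[of _ "carrier M"])
qed

lemma restriction_submodule:
  assumes F: "Module.module A F" and K: "submodule K A F" and N: "Module.module A N"
  shows "submodule ((\<lambda>h. restrict h K) ` module_hom A F N) A (hom_module A (F\<lparr>carrier := K\<rparr>) N)"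
proof -
  interpret F: Module.module A F by fact
  interpret K: Module.module A "F\<lparr>carrier := K\<rparr>"
    by (rule submodule.submodule_is_module[OF K F])
  note KF = F.submoduleE[OF K]
  have modK: "Module.module A (hom_module A (F\<lparr>carrier := K\<rparr>) N)"
    by (rule hom_module_module[OF K.module_axioms N])
  have modF: "Module.module A (hom_module A F N)" by (rule hom_module_module[OF F N])
  interpret HK: Module.module A "hom_module A (F\<lparr>carrier := K\<rparr>) N" by fact
  interpret HF: Module.module A "hom_module A F N" by fact
  let ?r = "\<lambda>h. restrict h K"
  have cl: "?r h \<in> carrier (hom_module A (F\<lparr>carrier := K\<rparr>) N)"
    if "h \<in> carrier (hom_module A F N)" for h
    using that KF by (auto simp: hom_module_def module_hom_def PiE_iff subset_iff)
  have ad: "?r (g \<oplus>\<^bsub>hom_module A F N\<^esub> h)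
      = ?r g \<oplus>\<^bsub>hom_module A (F\<lparr>carrier := K\<rparr>) N\<^esub> ?r h" for g h
    using KF(1) by (auto simp: hom_module_def fun_eq_iff subset_iff)
  have sm: "?r (a \<odot>\<^bsub>hom_module A F N\<^esub> h)
      = a \<odot>\<^bsub>hom_module A (F\<lparr>carrier := K\<rparr>) N\<^esub> ?r h" for a h
    using KF(1) by (auto simp: hom_module_def fun_eq_iff subset_iff)
  note zn = linear_zero_neg[where h = ?r, OF modF modK, OF cl sm]
  have car: "carrier (hom_module A F N) = module_hom A F N" by (simp add: hom_module_def)
  show ?thesis
    unfolding car[symmetric]
  proof (rule HK.submoduleI)
    show "\<zero>\<^bsub>hom_module A (F\<lparr>carrier := K\<rparr>) N\<^esub> \<in> ?r ` carrier (hom_module A F N)"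
      using zn(1) HF.zero_closed by (metis imageI)
  qed (auto simp: cl zn(2)[symmetric] ad[symmetric] sm[symmetric] simp del: restrict_apply)
qed

lemma module_hom_comp:
  assumes g: "g \<in> module_hom A M N" and h: "h \<in> module_hom A N P" and M: "Module.module A M"
  shows "(\<lambda>x\<in>carrier M. h (g x)) \<in> module_hom A M P"
proof -
  interpret M: Module.module A M by fact
  show ?thesis using module_homD[OF g] module_homD[OF h] by (auto simp: module_hom_def)
qed

lemma almost_projective_Ext1:
  fixes A :: "('a, 'c) ring_scheme" and M :: "('a, 'm) module" and N :: "('a, 'n) module"
  assumes M: "Module.module A M" and N: "Module.module A N" and u: "u ` I \<subseteq> carrier A"
    and proj: "almost_projective I u A M"
  shows "almost_zero I (restrict_scalars u (Ext1 A M N))"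
proof -
  interpret M: Module.module A M by fact
  let ?F = "free_cover A M" and ?p = "free_lift A M (\<lambda>x. x)"
  define K where "K = a_kernel ?F M ?p"
  have F: "Module.module A ?F"
    unfolding free_cover_def by (rule free_module_module[OF M.R.cring_axioms])
  interpret F: Module.module A ?F by fact
  have K: "submodule K A ?F"
    unfolding K_def
    by (rule kernel_submodule[OF F M])
       (use free_lift_linear[OF M, of "carrier M" "\<lambda>x. x"] in \<open>auto simp: free_cover_def\<close>)
  have fck: "free_cover_kernel A M = ?F\<lparr>carrier := K\<rparr>"
    by (simp add: free_cover_kernel_def K_def)
  have KM: "Module.module A (?F\<lparr>carrier := K\<rparr>)"
    by (rule submodule.submodule_is_module[OF K F])
  have iff: "almost_zero I (restrict_scalars u (Ext1 A M N')) \<longleftrightarrow>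
      (\<forall>\<epsilon>\<in>I. \<forall>\<phi>\<in>module_hom A (?F\<lparr>carrier := K\<rparr>) N'.
         (\<lambda>x\<in>K. u \<epsilon> \<odot>\<^bsub>N'\<^esub> \<phi> x) \<in> (\<lambda>h. restrict h K) ` module_hom A ?F N')"
    if N': "Module.module A N'" for N' :: "('a, 'z) module"
  proof -
    have r: "annihilated_by \<epsilon> (restrict_scalars u E) \<longleftrightarrow> annihilated_by (u \<epsilon>) E"
      for \<epsilon> and E :: "('a, 'q) module"
      by (simp add: annihilated_by_def restrict_scalars_def)
    have "annihilated_by (u \<epsilon>) (Ext1 A M N') \<longleftrightarrow>
       (\<forall>\<phi>\<in>module_hom A (?F\<lparr>carrier := K\<rparr>) N'.
         (\<lambda>x\<in>K. u \<epsilon> \<odot>\<^bsub>N'\<^esub> \<phi> x) \<in> (\<lambda>h. restrict h K) ` module_hom A ?F N')"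
      if "\<epsilon> \<in> I" for \<epsilon>
      unfolding Ext1_def fck
      using annihilated_by_quotient_iff[OF hom_module_module[OF KM N']
              restriction_submodule[OF F K N'], of "u \<epsilon>"] u that
      by (simp add: hom_module_def image_subset_iff)
    then show ?thesis by (simp add: almost_zero_def r)
  qed
  have "almost_zero I (restrict_scalars u (Ext1 A M (?F\<lparr>carrier := K\<rparr>)))"
    using proj KM by (simp add: almost_projective_def)
  note univ = this[unfolded iff[OF KM], rule_format]
  have id: "(\<lambda>x\<in>K. x) \<in> module_hom A (?F\<lparr>carrier := K\<rparr>) (?F\<lparr>carrier := K\<rparr>)"
    using F.submoduleE[OF K] by (auto simp: module_hom_def)
  show ?thesis
    unfolding iff[OF N]
  proof (intro ballI)
    fix \<epsilon> \<phi> assume e: "\<epsilon> \<in> I" and \<phi>: "\<phi> \<in> module_hom A (?F\<lparr>carrier := K\<rparr>) N"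
    obtain \<psi> where \<psi>: "\<psi> \<in> module_hom A ?F (?F\<lparr>carrier := K\<rparr>)"
      and eq: "(\<lambda>x\<in>K. u \<epsilon> \<odot>\<^bsub>?F\<lparr>carrier := K\<rparr>\<^esub> (\<lambda>x\<in>K. x) x) = restrict \<psi> K"
      using univ[OF e id] by blast
    have c: "(\<lambda>x\<in>carrier ?F. \<phi> (\<psi> x)) \<in> module_hom A ?F N"
      by (rule module_hom_comp[OF \<psi> \<phi> F])
    have "(\<lambda>x\<in>K. u \<epsilon> \<odot>\<^bsub>N\<^esub> \<phi> x) = restrict (\<lambda>x\<in>carrier ?F. \<phi> (\<psi> x)) K"
    proof
      fix x
      show "(\<lambda>x\<in>K. u \<epsilon> \<odot>\<^bsub>N\<^esub> \<phi> x) x = restrict (\<lambda>x\<in>carrier ?F. \<phi> (\<psi> x)) K x"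
      proof (cases "x \<in> K")
        case True
        then have "\<psi> x = u \<epsilon> \<odot>\<^bsub>?F\<^esub> x" using fun_cong[OF eq, of x] by simp
        then show ?thesis
          using True F.submoduleE(1)[OF K] module_homD(3)[OF \<phi>, of "u \<epsilon>" x] u e by auto
      qed simp
    qed
    then show "(\<lambda>x\<in>K. u \<epsilon> \<odot>\<^bsub>N\<^esub> \<phi> x) \<in> (\<lambda>h. restrict h K) ` module_hom A ?F N"
      using c by blast
  qed
qed

lemma module_hom_image_submodule:
  assumes M: "Module.module A M" and N: "Module.module A N" and h: "h \<in> module_hom A M N"
  shows "submodule (h ` carrier M) A N"
proof -
  interpret M: Module.module A M by fact
  interpret N: Module.module A N by fact
  note D = module_homD[OF h] and z = linear_zero_neg[where h = h, OF M N, OF module_homD(1,3)[OF h]]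
  show ?thesis
    by (rule N.submoduleI) (auto simp: D(1) z(2)[symmetric] D(2,3)[symmetric] intro!: image_eqI[where f = h, OF z(1)[symmetric]])
qed

lemma almost_finitely_presentedI:
  fixes A :: "('a, 'c) ring_scheme" and M :: "('a, 'm) module"
  assumes M: "Module.module A M" and u: "u ` I \<subseteq> carrier A"
    and afp: "\<And>\<epsilon>. \<epsilon> \<in> I \<Longrightarrow> \<exists>(P :: ('a, 'p) module) h.
        Module.module A P \<and> finitely_presented A P \<and> h \<in> module_hom A P M \<and>
        annihilated_by (u \<epsilon>) (P\<lparr>carrier := a_kernel P M h\<rparr>) \<and>
        annihilated_by (u \<epsilon>) (quotient_module M (h ` carrier P))"
  shows "almost_finitely_presented I u A M"
  unfolding almost_finitely_presented_def
proof
  fix \<epsilon> assume e: "\<epsilon> \<in> I"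
  interpret M: Module.module A M by fact
  obtain P :: "('a, 'p) module" and h where P: "Module.module A P" "finitely_presented A P"
    and h: "h \<in> module_hom A P M"
    and ker: "annihilated_by (u \<epsilon>) (P\<lparr>carrier := a_kernel P M h\<rparr>)"
    and coker: "annihilated_by (u \<epsilon>) (quotient_module M (h ` carrier P))"
    using afp[OF e] by blast
  interpret P: Module.module A P by fact
  obtain n :: nat and g S where g: "g \<in> module_hom A (free_module A {..<n}) P"
    and surj: "g ` carrier (free_module A {..<n}) = carrier P"
    and S: "finite S" "S \<subseteq> carrier (free_module A {..<n})"
      "a_kernel (free_module A {..<n}) P g = submodule_generated A (free_module A {..<n}) S"
    using P(2) unfolding finitely_presented_def by blast
  define F where "F = free_module A {..<n}"
  have F: "Module.module A F" unfolding F_def by (rule free_module_module[OF M.R.cring_axioms])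
  interpret F: Module.module A F by fact
  note gD = module_homD[OF g[folded F_def]] and hD = module_homD[OF h]
  define K where "K = a_kernel F P g"
  have K: "submodule K A F" unfolding K_def by (rule kernel_submodule[OF F P(1)]) (auto simp: gD)
  note Q = quotient_module_module[OF F K]
  let ?Q = "quotient_module F K" and ?c = "\<lambda>x. K +>\<^bsub>F\<^esub> x"
  interpret Q: Module.module A ?Q by (rule Q(1))
  define k where "k = (\<lambda>C\<in>carrier ?Q. the_elem ((\<lambda>x. h (g x)) ` C))"
  have k: "k (?c x) = h (g x)" if x: "x \<in> carrier F" for x
  proof -
    have "g y = g x" if "y \<in> ?c x" for y
    proof -
      note y = that
      obtain s where s: "s \<in> K" "y = s \<oplus>\<^bsub>F\<^esub> x" using y by (auto simp: a_r_coset_def')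
      then have "s \<in> carrier F" "g s = \<zero>\<^bsub>P\<^esub>" by (auto simp: K_def a_kernel_def')
      then show ?thesis using s x gD by simp
    qed
    then have "(\<lambda>x. h (g x)) ` ?c x = (\<lambda>_. h (g x)) ` ?c x" by (intro image_cong) simp_all
    moreover have "x \<in> ?c x"
      using x F.submoduleE[OF K] linear_zero_neg(1)[where h = g, OF F P(1), OF gD(1,3)]
      by (force simp: a_r_coset_def' K_def a_kernel_def' intro!: bexI[of _ "\<zero>\<^bsub>F\<^esub>"])
    ultimately have "(\<lambda>x. h (g x)) ` ?c x = {h (g x)}" by (simp only: image_constant)
    then show ?thesis using x by (simp add: k_def Q(4))
  qed
  have c: "?c \<in> carrier F \<rightarrow> carrier ?Q" by (auto simp: Q(4))
  have kh: "k \<in> module_hom A ?Q M"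
    unfolding module_hom_def
  proof (safe intro!: PiE_I)
    fix C assume "C \<in> carrier ?Q" then show "k C \<in> carrier M" using k gD hD by (auto simp: Q(4))
  next
    fix C assume "C \<notin> carrier ?Q" then show "k C = undefined" by (simp add: k_def)
  next
    fix C D assume "C \<in> carrier ?Q" "D \<in> carrier ?Q"
    then show "k (C \<oplus>\<^bsub>?Q\<^esub> D) = k C \<oplus>\<^bsub>M\<^esub> k D" using k gD hD by (auto simp: Q(3,4))
  next
    fix a C assume "a \<in> carrier A" "C \<in> carrier ?Q"
    then show "k (a \<odot>\<^bsub>?Q\<^esub> C) = a \<odot>\<^bsub>M\<^esub> k C" using k gD hD by (auto simp: Q(2,4))
  qed
  have im: "k ` carrier ?Q = h ` carrier P"
    using k by (simp add: Q(4) image_image surj[symmetric] F_def[symmetric])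
  have ann: "annihilated_by (u \<epsilon>) (?Q\<lparr>carrier := a_kernel ?Q M k\<rparr>)"
    unfolding annihilated_by_def
  proof
    fix C assume "C \<in> carrier (?Q\<lparr>carrier := a_kernel ?Q M k\<rparr>)"
    then obtain x where x: "x \<in> carrier F" "C = ?c x" "h (g x) = \<zero>\<^bsub>M\<^esub>"
      using k by (auto simp: a_kernel_def' Q(4))
    then have "g x \<in> a_kernel P M h" using gD by (auto simp: a_kernel_def')
    then have "u \<epsilon> \<odot>\<^bsub>P\<^esub> g x = \<zero>\<^bsub>P\<^esub>" using ker by (simp add: annihilated_by_def)
    moreover have ue: "u \<epsilon> \<in> carrier A" using u e by auto
    ultimately have "u \<epsilon> \<odot>\<^bsub>F\<^esub> x \<in> K" using x gD by (simp add: K_def a_kernel_def')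
    then have "u \<epsilon> \<odot>\<^bsub>?Q\<^esub> C = \<zero>\<^bsub>?Q\<^esub>" using x ue by (simp add: Q(2,5))
    then show "u \<epsilon> \<odot>\<^bsub>?Q\<lparr>carrier := a_kernel ?Q M k\<rparr>\<^esub> C = \<zero>\<^bsub>?Q\<lparr>carrier := a_kernel ?Q M k\<rparr>\<^esub>"
      by simp
  qed
  have "finitely_presented A ?Q"
    unfolding finitely_presented_def
  proof (intro exI[of _ n] bexI[of _ "restrict ?c (carrier F)"] conjI exI[of _ S], unfold F_def[symmetric])
    have "a_kernel F ?Q (restrict ?c (carrier F)) = K"
      using F.submoduleE(1)[OF K] Q(5) by (auto simp: a_kernel_def')
    then show "a_kernel F ?Q (restrict ?c (carrier F)) = submodule_generated A F S"
      using S(3) by (simp add: F_def[symmetric] K_def)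
    show "restrict ?c (carrier F) \<in> module_hom A F ?Q"
      by (auto simp: module_hom_def Q(2,3,4))
    show "restrict ?c (carrier F) ` carrier F = carrier ?Q" by (simp add: Q(4))
  qed (use S in \<open>auto simp: F_def\<close>)
  then show "\<exists>(P :: ('a, (nat \<Rightarrow> 'a) set) module) h.
        Module.module A P \<and> finitely_presented A P \<and> h \<in> module_hom A P M \<and>
        annihilated_by (u \<epsilon>) (P\<lparr>carrier := a_kernel P M h\<rparr>) \<and>
        annihilated_by (u \<epsilon>) (quotient_module M (h ` carrier P))"
    using Q(1) kh ann coker im by (intro exI[of _ ?Q] exI[of _ k]) auto
qed

end

theory Submission
  imports Defs
begin

text \<open>Write \<open>A\<close> and \<open>B\<close> for the valuation rings of \<open>K\<close> and \<open>L\<close>, and \<open>J\<close> for the kernel of the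
  multiplication map \<open>\<mu> : B \<otimes>\<^sub>A B \<rightarrow> B\<close>.  Since \<open>L/K\<close> is unibranched, \<open>B\<close> is integral over \<open>A\<close>, by
  Chevalley's extension theorem.  Separability provides an element \<open>\<Sum> u \<otimes> v\<close> of \<open>L \<otimes>\<^sub>K L\<close> that is
  annihilated by all \<open>1 \<otimes> x - x \<otimes> 1\<close> and whose image \<open>\<Sum> u v\<close> in \<open>L\<close> is not zero.  It takes the
  role of the discriminant and shows that \<open>B\<close> is contained in a finitely generated \<open>A\<close>-module.  In
  rank one such a \<open>B\<close> almost has a basis, hence is always almost finitely presented and almost
  projective over \<open>A\<close>.

  The remaining condition, that \<open>B\<close> is almost projective over \<open>B \<otimes>\<^sub>A B\<close>, means that for each
  \<open>\<epsilon> \<in> I\<close> there is an \<open>e\<close> with \<open>\<mu>(e) = \<epsilon>\<close> and \<open>J e = 0\<close>.  Applying \<open>x \<otimes> y \<mapsto> x dy\<close> to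
  \<open>(1 \<otimes> b - b \<otimes> 1) e = 0\<close> gives \<open>\<epsilon> db = 0\<close>.  Conversely, if all \<open>\<epsilon> \<in> I\<close> annihilate the module of
  differentials, which is \<open>J / J\<^sup>2\<close>, then \<open>J\<close> is almost equal to \<open>J\<^sup>2\<close> and almost finitely generated,
  and Nakayama's argument yields an element that annihilates \<open>J\<close> and is a power of \<open>\<epsilon>\<close> modulo \<open>J\<close>,
  with an exponent that depends only on the degree of \<open>L/K\<close>.  As the value group is dense, this
  suffices.\<close>

section \<open>Chevalley's extension theorem\<close>

text \<open>Over a nondiscrete valuation ring, B need not be finitely generated and need not have a
  basis. Estimates are therefore made with bounded submodules of L, and minima of values are
  replaced by infima in the reals, at the price of a factor from I. A price is harmless if its
  exponent is known before the element of I is chosen, so all exponents depend only on n, the degree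
  of L/K. The delicate point is that B is bounded. To bound the coordinates of b \<Delta>, where
  \<Delta> = \<Sum> u v, one takes a lattice stable under b and under all u. It exists by
  integrality, but it depends on b, and so does its almost basis. The loss p^n and the denominators
  of the v do not. The exponent in the Nakayama step is 2 (2^n - 1) + 1. Eliminating a generator
  squares the multiplier up to one factor, which gives 2^n - 1. The initial multiplier is
  \<epsilon>^2: one \<epsilon> makes the differentials vanish, the other rewrites products of two
  elements of J. The last \<epsilon> appears because the almost basis spans \<epsilon> B rather than
  B.\<close>

lemma sum_mem_closed:
  fixes J :: "'a::comm_monoid_add set"
  assumes "0 \<in> J" "\<And>x y. x \<in> J \<Longrightarrow> y \<in> J \<Longrightarrow> x + y \<in> J" "\<And>s. s \<in> S \<Longrightarrow> f s \<in> J"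
  shows "sum f S \<in> J"
  using assms(3) by (induction S rule: infinite_finite_induct) (auto intro: assms(1,2))

lemma valuation_subringI:
  fixes V :: "'a::field set"
  assumes "1 \<in> V" "\<And>x y. x \<in> V \<Longrightarrow> y \<in> V \<Longrightarrow> x - y \<in> V"
    "\<And>x y. x \<in> V \<Longrightarrow> y \<in> V \<Longrightarrow> x * y \<in> V" "\<And>x. x \<in> V \<or> inverse x \<in> V"
  shows "valuation_subring V"
proof -
  interpret R: ring "ring_of_type_algebra :: 'a ring" ..
  have neg: "\<ominus>\<^bsub>ring_of_type_algebra\<^esub> x = - x" for x :: 'a
    by (rule R.minus_equality) (auto simp: ring_of_type_algebra_def)
  have um: "- x \<in> V" if "x \<in> V" for x
    using assms(2)[OF assms(2)[OF that that] that] by simp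
  have "x + y \<in> V" if "x \<in> V" "y \<in> V" for x y
    using assms(2)[OF that(1) um[OF that(2)]] by simp
  then have "subring V (ring_of_type_algebra :: 'a ring)"
    by (intro R.subringI) (use assms um in \<open>auto simp: neg, auto simp: ring_of_type_algebra_def\<close>)
  then show ?thesis using assms(4) by (simp add: valuation_subring_def)
qed

text \<open>Isolating the constant term \<open>d 0\<close> and dividing by \<open>1 - d 0\<close>
  turns the relation for \<open>inverse y\<close> into an expression of \<open>y ^ Suc m\<close> by
  lower powers with coefficients in J. This eliminates the top term of the relation for
  \<open>y\<close>. Both relations have the same length, so the roles of \<open>y\<close> and
  \<open>inverse y\<close> can be exchanged.\<close>

lemma geometric_reach_descent:
  fixes J :: "'a::field set" and y :: 'a
  assumes zero: "0 \<in> J" and add: "\<And>a b. a \<in> J \<Longrightarrow> b \<in> J \<Longrightarrow> a + b \<in> J"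
    and mult: "\<And>a b. a \<in> J \<Longrightarrow> b \<in> J \<Longrightarrow> a * b \<in> J"
    and unit: "\<And>a b. a \<in> J \<Longrightarrow> b \<in> J \<Longrightarrow> b / (1 - a) \<in> J" and one: "1 \<notin> J" and y: "y \<noteq> 0"
    and c: "\<And>k. c k \<in> J" "(\<Sum>k\<le>Suc m. c k * y ^ k) = 1"
    and d: "\<And>k. d k \<in> J" "(\<Sum>k\<le>Suc m. d k * inverse y ^ k) = 1"
  shows "\<exists>c. (\<forall>k. c k \<in> J) \<and> (\<Sum>k\<le>m. c k * y ^ k) = 1"
proof -
  let ?t = "\<lambda>k. d k / (1 - d 0)"
  have d0: "1 - d 0 \<noteq> 0" using one d(1)[of 0] by auto
  have "(\<Sum>k\<le>Suc m. d k * inverse y ^ k) = d 0 + (\<Sum>k\<le>m. d (Suc k) * inverse y ^ Suc k)"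
    by (subst sum.atMost_Suc_shift) simp
  then have "(\<Sum>k\<le>m. d (Suc k) * inverse y ^ Suc k) = 1 - d 0" unfolding d(2)
    by (simp add: algebra_simps)
  then have "(\<Sum>k\<le>m. ?t (Suc k) * inverse y ^ Suc k) = 1"
    using d0 by (simp add: sum_divide_distrib[symmetric] del: power_Suc)
  then have "y ^ Suc m = (\<Sum>k\<le>m. ?t (Suc k) * inverse y ^ Suc k) * y ^ Suc m" by simp
  also have "\<dots> = (\<Sum>k\<le>m. ?t (Suc k) * y ^ (m - k))"
    unfolding sum_distrib_right
  proof (rule sum.cong)
    fix k assume "k \<in> {..m}"
    then have "y ^ Suc m = y ^ Suc k * y ^ (m - k)" by (simp flip: power_add)
    then show "?t (Suc k) * inverse y ^ Suc k * y ^ Suc m = ?t (Suc k) * y ^ (m - k)"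
      using y by (simp add: power_inverse del: power_Suc)
  qed simp
  also have "\<dots> = (\<Sum>k\<le>m. ?t (Suc (m - k)) * y ^ k)"
    by (rule sum.reindex_bij_witness[of _ "\<lambda>k. m - k" "\<lambda>k. m - k"]) auto
  finally have ym: "y ^ Suc m = (\<Sum>k\<le>m. ?t (Suc (m - k)) * y ^ k)" .
  let ?c = "\<lambda>k. c k + c (Suc m) * ?t (Suc (m - k))"
  have "(\<Sum>k\<le>m. ?c k * y ^ k) = (\<Sum>k\<le>m. c k * y ^ k) + c (Suc m) * y ^ Suc m"
    unfolding ym by (simp add: algebra_simps sum.distrib sum_distrib_left)
  then have "(\<Sum>k\<le>m. ?c k * y ^ k) = 1" using c(2) by simp
  moreover have "?c k \<in> J" for k by (intro add mult unit c d)
  ultimately show ?thesis by (intro exI[of _ ?c]) simp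
qed

text \<open>Chevalley's extension theorem.  Among the additive subgroups \<open>J \<supseteq> J0\<close> that are closed under
  multiplication and under \<open>R0\<close> and omit \<open>1\<close>, take a maximal one; its idealizer is a
  valuation ring in which the elements of \<open>J\<close> are not units.\<close>

lemma valuation_subring_dominating:
  fixes J0 R0 :: "'a::field set"
  assumes "0 \<in> J0" "\<And>x y. x \<in> J0 \<Longrightarrow> y \<in> J0 \<Longrightarrow> x - y \<in> J0"
    "\<And>x y. x \<in> J0 \<Longrightarrow> y \<in> J0 \<Longrightarrow> x * y \<in> J0"
    "\<And>r x. r \<in> R0 \<Longrightarrow> x \<in> J0 \<Longrightarrow> r * x \<in> J0" "1 \<notin> J0"
  obtains V where "valuation_subring V" "R0 \<subseteq> V" "J0 \<subseteq> V"
    "\<And>x y. x \<in> V \<Longrightarrow> y \<in> J0 \<Longrightarrow> x * y \<noteq> 1"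
proof -
  define P where "P J \<longleftrightarrow> J0 \<subseteq> J \<and> (\<forall>x\<in>J. \<forall>y\<in>J. x - y \<in> J) \<and> (\<forall>x\<in>J. \<forall>y\<in>J. x * y \<in> J) \<and>
      (\<forall>r\<in>R0. \<forall>x\<in>J. r * x \<in> J) \<and> 1 \<notin> J" for J
  have "\<exists>M\<in>Collect P. \<forall>H\<in>Collect P. M \<subseteq> H \<longrightarrow> H = M"
  proof (rule subset_Zorn_nonempty)
    have "P J0" using assms by (simp add: P_def)
    then show "Collect P \<noteq> {}" by blast
    fix C assume C: "C \<noteq> {}" "subset.chain (Collect P) C"
    have sub: "P H" if "H \<in> C" for H using C that by (auto simp: subset_chain_def)
    have pair: "\<exists>H\<in>C. x \<in> H \<and> y \<in> H" if "x \<in> \<Union>C" "y \<in> \<Union>C" for x y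
      using C that unfolding subset_chain_def by (metis UnionE subsetD)
    have "x - y \<in> \<Union>C" "x * y \<in> \<Union>C" if "x \<in> \<Union>C" "y \<in> \<Union>C" for x y
      using pair[OF that] sub unfolding P_def by (meson UnionI)+
    moreover have "J0 \<subseteq> \<Union>C" "1 \<notin> \<Union>C" using C(1) sub unfolding P_def by blast+
    moreover have "r * x \<in> \<Union>C" if "r \<in> R0" "x \<in> \<Union>C" for r x
      using that sub unfolding P_def by blast
    ultimately show "\<Union>C \<in> Collect P" unfolding P_def by blast
  qed
  then obtain J where "P J" and max: "\<And>H. P H \<Longrightarrow> J \<subseteq> H \<Longrightarrow> H = J" by auto
  then have J: "J0 \<subseteq> J" "\<And>x y. x \<in> J \<Longrightarrow> y \<in> J \<Longrightarrow> x - y \<in> J"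
    "\<And>x y. x \<in> J \<Longrightarrow> y \<in> J \<Longrightarrow> x * y \<in> J" "\<And>r x. r \<in> R0 \<Longrightarrow> x \<in> J \<Longrightarrow> r * x \<in> J" "1 \<notin> J"
    by (auto simp: P_def)
  have zero: "0 \<in> J" using J(1) assms(1) by auto
  have um: "- x \<in> J" if "x \<in> J" for x using J(2)[OF zero that] by simp
  have add: "x + y \<in> J" if "x \<in> J" "y \<in> J" for x y using J(2)[OF that(1) um[OF that(2)]] by simp
  \<comment> \<open>The values at y of polynomials with coefficients in J form a competitor of J
    that contains every \<open>y * j\<close>. Either it contains 1, or it equals J by
    maximality.\<close>
  have dichotomy: "(\<forall>j\<in>J. y * j \<in> J) \<or> (\<exists>c m. (\<forall>k. c k \<in> J) \<and> (\<Sum>k\<le>m. c k * y ^ k) = 1)" for y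
  proof (rule disjCI, rule ccontr)
    assume n: "\<nexists>c m. (\<forall>k. c k \<in> J) \<and> (\<Sum>k\<le>m. c k * y ^ k) = 1" and n': "\<not> (\<forall>j\<in>J. y * j \<in> J)"
    let ?H = "{poly p y | p. \<forall>k. coeff p k \<in> J}"
    have JX: "J \<subseteq> ?H"
    proof
      fix j assume "j \<in> J"
      then have "poly [:j:] y = j" "\<forall>k. coeff [:j:] k \<in> J" using zero
        by (auto simp: coeff_pCons split: nat.splits)
      then show "j \<in> ?H" by force
    qed
    have "P ?H"
      unfolding P_def
    proof (intro conjI ballI)
      show "J0 \<subseteq> ?H" using J(1) JX by blast
      show "1 \<notin> ?H"
      proof
        assume "1 \<in> ?H"
        then obtain p where "poly p y = 1" "\<forall>k. coeff p k \<in> J" by auto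
        then show False using n unfolding poly_altdef by blast
      qed
    next
      fix a b assume "a \<in> ?H" "b \<in> ?H"
      then obtain p q where pq: "a = poly p y" "b = poly q y" "\<forall>k. coeff p k \<in> J" "\<forall>k. coeff q k \<in> J"
        by auto
      then have "a - b = poly (p - q) y" "\<forall>k. coeff (p - q) k \<in> J" using J by auto
      then show "a - b \<in> ?H" by blast
      have "a * b = poly (p * q) y" using pq by simp
      moreover have "\<forall>k. coeff (p * q) k \<in> J"
        unfolding coeff_mult using pq J(3) zero add by (auto intro!: sum_mem_closed)
      ultimately show "a * b \<in> ?H" by blast
    next
      fix r a assume "r \<in> R0" "a \<in> ?H"
      then obtain p where p: "a = poly p y" "\<forall>k. coeff p k \<in> J" by auto
      then have "r * a = poly (smult r p) y" "\<forall>k. coeff (smult r p) k \<in> J" using J(4) \<open>r \<in> R0\<close> by auto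
      then show "r * a \<in> ?H" by blast
    qed
    then have "?H = J" using max JX by blast
    have "y * j \<in> J" if "j \<in> J" for j
    proof -
      have "poly [:0, j:] y = y * j" "\<forall>k. coeff [:0, j:] k \<in> J"
        using zero that by (auto simp: coeff_pCons split: nat.splits)
      then have "y * j \<in> ?H" by force
      then show ?thesis using \<open>?H = J\<close> by simp
    qed
    then show False using n' by blast
  qed
  \<comment> \<open>Otherwise 1 is a combination of powers of \<open>inverse (1 - a)\<close>.
    Multiplied by \<open>(1 - a) ^ m\<close>, this puts \<open>(1 - a) ^ m\<close> into J; its
    difference from 1 lies in J as well, so 1 would too.\<close>
  have unit: "b / (1 - a) \<in> J" if a: "a \<in> J" and b: "b \<in> J" for a b
  proof (rule ccontr)
    assume "b / (1 - a) \<notin> J"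
    then obtain c m where c: "\<forall>k. c k \<in> J" "(\<Sum>k\<le>m. c k * inverse (1 - a) ^ k) = 1"
      using dichotomy[of "inverse (1 - a)"] b by (auto simp: divide_inverse mult.commute)
    have a1: "1 - a \<noteq> 0" using a J(5) by auto
    have pw: "1 - (1 - a) ^ k \<in> J" for k
    proof (induction k)
      case (Suc k)
      have eq: "1 - (1 - a) ^ Suc k = (1 - (1 - a) ^ k) + (a - a * (1 - (1 - a) ^ k))"
        by (simp add: algebra_simps)
      show ?case unfolding eq by (intro add J(2,3) Suc.IH a)
    qed (simp add: zero)
    have pm: "j * (1 - a) ^ k \<in> J" if "j \<in> J" for j k
    proof -
      have "j - j * (1 - (1 - a) ^ k) \<in> J" using J that pw by simp
      then show ?thesis by (simp add: algebra_simps)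
    qed
    have "(1 - a) ^ m = (\<Sum>k\<le>m. c k * inverse (1 - a) ^ k) * (1 - a) ^ m" using c by simp
    also have "\<dots> = (\<Sum>k\<le>m. c k * (1 - a) ^ (m - k))"
      unfolding sum_distrib_right
    proof (rule sum.cong)
      fix k assume "k \<in> {..m}"
      then have "(1 - a) ^ m = (1 - a) ^ k * (1 - a) ^ (m - k)" by (simp flip: power_add)
      then show "c k * inverse (1 - a) ^ k * (1 - a) ^ m = c k * (1 - a) ^ (m - k)"
        using a1 by (simp add: power_inverse)
    qed simp
    also have "\<dots> \<in> J" by (intro sum_mem_closed zero add pm) (use c in auto)
    finally have "(1 - a) ^ m \<in> J" .
    then have "1 \<in> J" using add[OF pw[of m]] by fastforce
    then show False using J(5) by simp
  qed
  define V where "V = {y. \<forall>j\<in>J. y * j \<in> J}"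
  have "valuation_subring V"
  proof (rule valuation_subringI)
    fix x y assume "x \<in> V" "y \<in> V"
    then show "x - y \<in> V" "x * y \<in> V" using J(2) by (auto simp: V_def left_diff_distrib mult.assoc)
  next
    fix y show "y \<in> V \<or> inverse y \<in> V"
    proof (cases "y = 0")
      case False
      \<comment> \<open>Descent on the common length: each round shortens the relation for y and the
        one for its inverse, and at length 0 the relation says that 1 lies in J.\<close>
      have no: "False" if "(\<exists>c. (\<forall>k. c k \<in> J) \<and> (\<Sum>k\<le>m. c k * y ^ k) = 1)"
        "(\<exists>c. (\<forall>k. c k \<in> J) \<and> (\<Sum>k\<le>m. c k * inverse y ^ k) = 1)" for m
        using that
      proof (induction m)
        case (Suc m)
        obtain c d where c: "\<And>k. c k \<in> J" "(\<Sum>k\<le>Suc m. c k * y ^ k) = 1"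
          and d: "\<And>k. d k \<in> J" "(\<Sum>k\<le>Suc m. d k * inverse y ^ k) = 1"
          using Suc.prems by blast
        show ?case
          using geometric_reach_descent[OF zero add J(3) unit J(5) False c d]
            geometric_reach_descent[OF zero add J(3) unit J(5) _ d, of c] c False
          by (intro Suc.IH) simp_all
      qed (use J(5) in \<open>auto dest: spec[where x = 0]\<close>)
      \<comment> \<open>The descent compares relations of equal length, so the shorter one is
        extended by zero coefficients.\<close>
      have pad: "\<exists>d. (\<forall>k. d k \<in> J) \<and> (\<Sum>k\<le>max m n. d k * x ^ k) = 1"
        if c: "\<forall>k. c k \<in> J" "(\<Sum>k\<le>m. c k * x ^ k) = 1" for c m n and x :: 'a
      proof -
        let ?d = "\<lambda>k. if k \<le> m then c k else 0"
        have "(\<Sum>k\<le>max m n. ?d k * x ^ k) = (\<Sum>k\<le>m. c k * x ^ k)"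
          by (intro sum.mono_neutral_cong_right) auto
        then show ?thesis using c zero by (intro exI[of _ ?d]) auto
      qed
      show ?thesis
      proof (rule ccontr)
        assume "\<not> ?thesis"
        then obtain c d m n where "\<forall>k. c k \<in> J" "(\<Sum>k\<le>m. c k * y ^ k) = 1"
          "\<forall>k. d k \<in> J" "(\<Sum>k\<le>n. d k * inverse y ^ k) = 1"
          using dichotomy[of y] dichotomy[of "inverse y"] unfolding V_def by blast
        then show False using no[of "max m n"] pad[where c = c and m = m and n = n and x = y]
            pad[where c = d and m = n and n = m and x = "inverse y"]
          by (simp add: max.commute)
      qed
    qed (simp add: V_def zero)
  qed (simp add: V_def)
  moreover have "R0 \<subseteq> V" "J0 \<subseteq> V"
    using J(3,4) subsetD[OF J(1)] unfolding V_def by blast+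
  moreover have "x * y \<noteq> 1" if "x \<in> V" "y \<in> J0" for x y
  proof -
    have "x * y \<in> J" using that J(1) by (auto simp: V_def)
    then show ?thesis using J(5) by metis
  qed
  ultimately show thesis by (rule that)
qed

section \<open>Integrality\<close>

text \<open>Here \<open>w\<close> stands for the valuation composed with an order embedding of its
  value group into the reals, which makes infima and the Archimedean property available. The number
  \<open>w 0\<close> is arbitrary, so conditions on values treat 0 separately.\<close>

locale real_valued_extension =
  fixes i :: "'k::field \<Rightarrow> 'l::field" and w :: "'l \<Rightarrow> real"
  assumes i_add [simp]: "i (a + b) = i a + i b" and i_mult [simp]: "i (a * b) = i a * i b"
    and i_1 [simp]: "i 1 = 1"
    and w_mult: "x \<noteq> 0 \<Longrightarrow> y \<noteq> 0 \<Longrightarrow> w (x * y) = w x + w y"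
    and w_add: "x \<noteq> 0 \<Longrightarrow> y \<noteq> 0 \<Longrightarrow> x + y \<noteq> 0 \<Longrightarrow> min (w x) (w y) \<le> w (x + y)"
begin

lemma i_0 [simp]: "i 0 = 0"
  using i_add[of 0 0] by (metis add.right_neutral add_left_cancel)

lemma i_minus [simp]: "i (- x) = - i x"
  using i_add[of x "- x"] by (simp add: eq_neg_iff_add_eq_0 add.commute)

lemma i_diff [simp]: "i (x - y) = i x - i y"
  using i_add[of x "- y"] by simp

lemma i_eq_0 [simp]: "i x = 0 \<longleftrightarrow> x = 0"
proof
  assume "i x = 0"
  then have "x \<noteq> 0 \<Longrightarrow> i (x * inverse x) = 0" by (simp del: right_inverse)
  then show "x = 0" by auto
qed simp

lemma i_eq_iff [simp]: "i x = i y \<longleftrightarrow> x = y"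
  using i_eq_0[of "x - y"] by (simp del: i_eq_0)

lemma i_eq_1 [simp]: "i x = 1 \<longleftrightarrow> x = 1"
  using i_eq_iff[of x 1] by (simp del: i_eq_iff)

lemma i_inverse [simp]: "i (inverse x) = inverse (i x)"
proof (cases "x = 0")
  case False
  then have "i x * i (inverse x) = 1" by (simp flip: i_mult)
  then show ?thesis by (rule inverse_unique[symmetric])
qed simp

lemma i_divide [simp]: "i (x / y) = i x / i y"
  by (simp add: divide_inverse)

lemma i_power [simp]: "i (x ^ n) = i x ^ n"
  by (induction n) auto

lemma i_sum [simp]: "i (sum f S) = (\<Sum>s\<in>S. i (f s))"
  by (induction S rule: infinite_finite_induct) auto

lemma w_1 [simp]: "w 1 = 0"
  using w_mult[of 1 1] by simp

lemma w_inverse: "x \<noteq> 0 \<Longrightarrow> w (inverse x) = - w x"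
  using w_mult[of x "inverse x"] by simp

lemma w_divide: "x \<noteq> 0 \<Longrightarrow> y \<noteq> 0 \<Longrightarrow> w (x / y) = w x - w y"
  using w_mult[of x "inverse y"] w_inverse[of y] by (simp add: divide_inverse)

lemma w_power: "x \<noteq> 0 \<Longrightarrow> w (x ^ n) = n * w x"
  by (induction n) (auto simp: w_mult algebra_simps)

lemma w_uminus [simp]: "w (- x) = w x"
proof (cases "x = 0")
  case False
  have "w ((- 1) * (- 1)) = w (- 1) + w (- 1)" by (rule w_mult) auto
  moreover have "w ((- 1) * x) = w (- 1) + w x" by (rule w_mult) (use False in auto)
  ultimately show ?thesis by simp
qed simp

definition \<O> :: "'l set" where "\<O> = {x. x = 0 \<or> 0 \<le> w x}"

definition A :: "'k set" where "A = i -` \<O>"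

definition \<mm> :: "'k set" where "\<mm> = {a. a = 0 \<or> 0 < w (i a)}"

lemma ball_add:
  assumes "x = 0 \<or> r \<le> w x" "y = 0 \<or> r \<le> w y" shows "x + y = 0 \<or> r \<le> w (x + y)"
  using w_add[of x y] assms by (cases "x = 0"; cases "y = 0"; cases "x + y = 0") auto

lemma O_mult: "x \<in> \<O> \<Longrightarrow> y \<in> \<O> \<Longrightarrow> x * y \<in> \<O>"
  by (cases "x = 0"; cases "y = 0") (auto simp: \<O>_def w_mult)

lemma O_add: "x \<in> \<O> \<Longrightarrow> y \<in> \<O> \<Longrightarrow> x + y \<in> \<O>"
  using ball_add[of x 0 y] by (auto simp: \<O>_def)

lemma O_uminus: "x \<in> \<O> \<Longrightarrow> - x \<in> \<O>"
  by (auto simp: \<O>_def)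

lemma O_0_1 [simp]: "0 \<in> \<O>" "1 \<in> \<O>"
  by (auto simp: \<O>_def)

lemma A_iff: "a \<in> A \<longleftrightarrow> a = 0 \<or> 0 \<le> w (i a)"
  by (auto simp: A_def \<O>_def)

lemma A_0_1 [simp]: "0 \<in> A" "1 \<in> A"
  by (auto simp: A_def)

lemma A_closed: "a \<in> A \<Longrightarrow> b \<in> A \<Longrightarrow> a + b \<in> A" "a \<in> A \<Longrightarrow> b \<in> A \<Longrightarrow> a * b \<in> A"
    "a \<in> A \<Longrightarrow> - a \<in> A" "a \<in> A \<Longrightarrow> b \<in> A \<Longrightarrow> a - b \<in> A"
  using O_add[of "i a" "- i b"] by (auto simp: A_def intro: O_add O_mult O_uminus)

lemma A_power: "a \<in> A \<Longrightarrow> a ^ n \<in> A"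
  by (induction n) (auto intro: A_closed)

lemma A_sum: "(\<And>s. s \<in> S \<Longrightarrow> f s \<in> A) \<Longrightarrow> sum f S \<in> A"
  by (rule sum_mem_closed) (auto intro: A_closed)

lemma m_subset_A: "\<mm> \<subseteq> A"
  by (auto simp: \<mm>_def A_iff)

lemma m_closed: "a \<in> \<mm> \<Longrightarrow> b \<in> \<mm> \<Longrightarrow> a + b \<in> \<mm>" "a \<in> A \<Longrightarrow> b \<in> \<mm> \<Longrightarrow> a * b \<in> \<mm>"
    "a \<in> \<mm> \<Longrightarrow> - a \<in> \<mm>" "0 \<in> \<mm>"
proof -
  assume ab: "a \<in> \<mm>" "b \<in> \<mm>"
  show "a + b \<in> \<mm>"
  proof (cases "a = 0 \<or> b = 0 \<or> a + b = 0")
    case False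
    then have "min (w (i a)) (w (i b)) \<le> w (i a + i b)" by (intro w_add) (auto simp flip: i_add)
    then show ?thesis using ab False by (auto simp: \<mm>_def)
  qed (use ab in \<open>auto simp: \<mm>_def\<close>)
next
  assume "a \<in> A" "b \<in> \<mm>"
  then show "a * b \<in> \<mm>" by (cases "a = 0"; cases "b = 0") (auto simp: \<mm>_def A_iff w_mult)
qed (auto simp: \<mm>_def)

lemma unit_if_m: assumes "a \<in> \<mm>" shows "1 - a \<noteq> 0" "inverse (1 - a) \<in> A"
proof -
  show nz: "1 - a \<noteq> 0" using assms by (auto simp: \<mm>_def)
  have "w (i (1 - a)) \<le> 0"
  proof (rule ccontr)
    assume "\<not> w (i (1 - a)) \<le> 0"
    then have "1 - a \<in> \<mm>" by (auto simp: \<mm>_def)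
    then have "(1 - a) + a \<in> \<mm>" using assms by (rule m_closed)
    then show False by (simp add: \<mm>_def)
  qed
  then show "inverse (1 - a) \<in> A" using nz w_inverse[of "i (1 - a)"] by (simp add: A_iff)
qed

text \<open>The case \<open>d = 0\<close> excludes itself, since it would read 1 = 0.\<close>

definition integral_element :: "'l \<Rightarrow> bool" where
  "integral_element x \<longleftrightarrow> (\<exists>d a. (\<forall>k. a k \<in> A) \<and> x ^ d = (\<Sum>k<d. i (a k) * x ^ k))"

text \<open>If x is not integral, the ideal generated by \<mm> and 1/x in A[1/x] is proper, and
  Chevalley's theorem yields a valuation ring over A in which 1/x is not a unit. By uniqueness this
  ring is \<O>, which contains x.\<close>

lemma integral_if_unibranched:
  assumes ub: "\<And>V. valuation_subring V \<Longrightarrow> i -` V = A \<Longrightarrow> V = \<O>" and x: "x \<in> \<O>"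
  shows "integral_element x"
proof (rule ccontr)
  assume not_int: "\<not> integral_element x"
  have x0: "x \<noteq> 0"
  proof
    assume "x = 0"
    then have "x ^ 1 = (\<Sum>k<1. i ((\<lambda>_. 0) k) * x ^ k)" by simp
    then have "integral_element x" unfolding integral_element_def
      using A_0_1(1) by (intro exI[of _ 1] exI[of _ "\<lambda>_. 0"]) auto
    then show False using not_int by simp
  qed
  define z where "z = inverse x"
  define IA IM where "IA = i ` A" and "IM = i ` \<mm>"
  define J where "J = {poly p z | p. (\<forall>k. coeff p k \<in> IA) \<and> coeff p 0 \<in> IM}"
  have iA: "0 \<in> IA" "\<And>s t. s \<in> IA \<Longrightarrow> t \<in> IA \<Longrightarrow> s - t \<in> IA"
    "\<And>s t. s \<in> IA \<Longrightarrow> t \<in> IA \<Longrightarrow> s + t \<in> IA"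
    "\<And>s t. s \<in> IA \<Longrightarrow> t \<in> IA \<Longrightarrow> s * t \<in> IA"
    using A_closed by (auto simp: IA_def simp flip: i_add i_mult i_diff i_0)
  have im: "0 \<in> IM" "\<And>s t. s \<in> IM \<Longrightarrow> t \<in> IM \<Longrightarrow> s - t \<in> IM"
    "\<And>s t. s \<in> IA \<Longrightarrow> t \<in> IM \<Longrightarrow> s * t \<in> IM"
    using m_closed(1)[OF _ m_closed(3)] m_closed(2,4)
      by (force simp: IM_def IA_def simp flip: i_add i_mult i_diff i_0)+
  have JI: "y \<in> J" if "poly p z = y" "\<forall>k. coeff p k \<in> IA" "coeff p 0 \<in> IM" for p y
    using that unfolding J_def by blast
  have JE: "\<exists>p. y = poly p z \<and> (\<forall>k. coeff p k \<in> IA) \<and> coeff p 0 \<in> IM" if "y \<in> J" for y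
    using that unfolding J_def by blast
  obtain V where V: "valuation_subring V" "IA \<subseteq> V" "J \<subseteq> V"
    and nu: "\<And>a b. a \<in> V \<Longrightarrow> b \<in> J \<Longrightarrow> a * b \<noteq> 1"
  proof (rule valuation_subring_dominating[of J "IA"])
    show "0 \<in> J" by (rule JI[of 0]) (use iA im in auto)
  next
    fix a b assume a: "a \<in> J" and b: "b \<in> J"
    then obtain p q where p: "a = poly p z" "\<forall>k. coeff p k \<in> IA" "coeff p 0 \<in> IM"
      using JE[OF a] by blast
    obtain q where q: "b = poly q z" "\<forall>k. coeff q k \<in> IA" "coeff q 0 \<in> IM"
      using JE[OF b] by blast
    show "a - b \<in> J" by (rule JI[of "p - q"]) (use p q iA im in \<open>simp_all\<close>)
    show "a * b \<in> J"
    proof (rule JI[of "p * q"])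
      show "\<forall>k. coeff (p * q) k \<in> IA"
        unfolding coeff_mult by (intro allI sum_mem_closed iA) (use p q in auto)
    qed (use p q im in \<open>auto simp: coeff_mult\<close>)
  next
    fix r a assume r: "r \<in> IA" and a: "a \<in> J"
    then obtain p where p: "a = poly p z" "\<forall>k. coeff p k \<in> IA" "coeff p 0 \<in> IM"
      using JE[OF a] by blast
    show "r * a \<in> J" by (rule JI[of "smult r p"]) (use p iA im r in \<open>simp_all\<close>)
  next
    show "1 \<notin> J"
    proof
      assume one: "1 \<in> J"
      then obtain p where p: "1 = poly p z" "\<forall>k. coeff p k \<in> IA" "coeff p 0 \<in> IM"
        using JE[OF one] by blast
      define d where "d = degree p"
      obtain c where c: "\<And>k. c k \<in> A" "\<And>k. coeff p k = i (c k)"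
        using bchoice[of UNIV "\<lambda>k a. a \<in> A \<and> coeff p k = i a"] p(2) by (auto simp: IA_def)
      have c0: "c 0 \<in> \<mm>"
      proof -
        obtain m where "m \<in> \<mm>" "i (c 0) = i m" using p(3) c(2) by (auto simp: IM_def)
        then have "i (c 0 - m) = 0" by (simp del: i_eq_0)
        then show ?thesis using \<open>m \<in> \<mm>\<close> by simp
      qed
      \<comment> \<open>Multiplying 1 = p(1/x) by \<open>x ^ d\<close> leads to a relation with
        leading coefficient \<open>1 - c 0\<close>. This is a unit because \<open>c 0\<close> lies
        in \<mm>, and dividing by it makes the relation monic.\<close>
      have "x ^ d = (\<Sum>k\<le>d. i (c k) * z ^ k) * x ^ d"
        using p(1) by (simp add: poly_altdef d_def c(2))
      also have "\<dots> = (\<Sum>k\<le>d. i (c k) * x ^ (d - k))"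
        unfolding sum_distrib_right
      proof (rule sum.cong)
        fix k assume "k \<in> {..d}"
        then have "x ^ d = x ^ k * x ^ (d - k)" by (simp flip: power_add)
        then show "i (c k) * z ^ k * x ^ d = i (c k) * x ^ (d - k)"
          using x0 by (simp add: z_def power_inverse)
      qed simp
      also have "\<dots> = (\<Sum>k\<le>d. i (c (d - k)) * x ^ k)"
        by (rule sum.reindex_bij_witness[of _ "\<lambda>k. d - k" "\<lambda>k. d - k"]) auto
      also have "\<dots> = (\<Sum>k<d. i (c (d - k)) * x ^ k) + i (c 0) * x ^ d"
        by (simp flip: lessThan_Suc_atMost)
      finally have "i (1 - c 0) * x ^ d = (\<Sum>k<d. i (c (d - k)) * x ^ k)"
        by (simp add: algebra_simps)
      then have "i (inverse (1 - c 0)) * (i (1 - c 0) * x ^ d)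
          = (\<Sum>k<d. i (inverse (1 - c 0) * c (d - k)) * x ^ k)"
        by (simp add: sum_distrib_left mult.assoc del: i_inverse i_diff)
      moreover have "i (inverse (1 - c 0)) * (i (1 - c 0) * x ^ d) = x ^ d"
        using unit_if_m(1)[OF c0] by (simp flip: mult.assoc i_mult del: i_inverse i_diff)
      ultimately have "x ^ d = (\<Sum>k<d. i (inverse (1 - c 0) * c (d - k)) * x ^ k)" by simp
      moreover have "\<forall>k. inverse (1 - c 0) * c (d - k) \<in> A"
        using unit_if_m(2)[OF c0] c(1) A_closed by blast
      ultimately have "integral_element x" unfolding integral_element_def
        by (intro exI[of _ d] exI[of _ "\<lambda>k. inverse (1 - c 0) * c (d - k)"] conjI)
      then show False using not_int by simp
    qed
  qed blast
  \<comment> \<open>The image of \<mm> lies in J, hence consists of non-units of V. An element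
    outside A has its inverse in \<mm>, so its image cannot lie in V.\<close>
  have "i -` V = A"
  proof
    show "A \<subseteq> i -` V" using V by (auto simp: IA_def)
    show "i -` V \<subseteq> A"
    proof
      fix a assume a: "a \<in> i -` V"
      show "a \<in> A"
      proof (rule ccontr)
        assume "a \<notin> A"
        then have a': "a \<noteq> 0" "inverse a \<in> \<mm>" using w_inverse[of "i a"] by (auto simp: A_iff \<mm>_def)
        have "i (inverse a) \<in> J"
          by (rule JI[of "[:i (inverse a):]"])
             (use a' m_subset_A iA
               in \<open>auto simp: IA_def IM_def coeff_pCons split: nat.splits simp del: i_inverse\<close>)
        then have "i a * i (inverse a) \<noteq> 1" using a nu by blast
        then show False using a' by (simp flip: i_mult del: i_inverse)
      qed
    qed
  qed
  then have "x \<in> V" using ub[OF V(1)] x by simp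
  moreover have "z \<in> J"
    by (rule JI[of "[:0, 1:]"]) (use im iA
      in \<open>auto simp: IA_def coeff_pCons image_iff split: nat.splits intro!: bexI[of _ 1]\<close>)
  ultimately show False using nu[of x z] x0 by (simp add: z_def)
qed

subsection \<open>Lattices and almost bases\<close>

definition klinear :: "('l \<Rightarrow> 'k) \<Rightarrow> bool" where
  "klinear \<phi> \<longleftrightarrow> (\<forall>x y. \<phi> (x + y) = \<phi> x + \<phi> y) \<and> (\<forall>c x. \<phi> (i c * x) = c * \<phi> x)"

lemma klinearD:
  assumes "klinear \<phi>"
  shows "\<phi> (x + y) = \<phi> x + \<phi> y" "\<phi> (i c * x) = c * \<phi> x" "\<phi> 0 = 0" "\<phi> (- x) = - \<phi> x"
    "\<phi> (x - y) = \<phi> x - \<phi> y"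
    "\<phi> (sum f S) = (\<Sum>s\<in>S. \<phi> (f s))"
proof -
  show *: "\<phi> (x + y) = \<phi> x + \<phi> y" "\<phi> (i c * x) = c * \<phi> x" for x y c
    using assms by (auto simp: klinear_def)
  show zero: "\<phi> 0 = 0" using *(2)[of 0 0] by simp
  show minus: "\<phi> (- x) = - \<phi> x" for x using *(2)[of "- 1" x] by simp
  show "\<phi> (x - y) = \<phi> x - \<phi> y" using *(1)[of x "- y"] minus by simp
  show "\<phi> (sum f S) = (\<Sum>s\<in>S. \<phi> (f s))"
    by (induction S rule: infinite_finite_induct) (auto simp: *(1) zero)
qed

lemma klinear_mult: "klinear \<phi> \<Longrightarrow> klinear (\<lambda>x. \<phi> (y * x))"
  unfolding klinear_def by (metis distrib_left mult.left_commute)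

text \<open>The length n stays visible because later losses are powers whose exponents depend on it
  alone.\<close>

definition dual_basis :: "nat \<Rightarrow> (nat \<Rightarrow> 'l) \<Rightarrow> (nat \<Rightarrow> 'l \<Rightarrow> 'k) \<Rightarrow> bool" where
  "dual_basis n e g \<longleftrightarrow> (\<forall>k<n. klinear (g k)) \<and> (\<forall>k<n. \<forall>l<n. g k (e l) = (if k = l then 1 else 0)) \<and>
     (\<forall>x. x = (\<Sum>k<n. i (g k x) * e k))"

text \<open>A full and bounded A-submodule of L: every element of L can be scaled into it, and every
  functional has a common denominator on it. Boundedness takes the place of finite generation, which
  \<O> need not have.\<close>

definition lattice :: "'l set \<Rightarrow> bool" where
  "lattice M \<longleftrightarrow> 0 \<in> M \<and> (\<forall>x\<in>M. \<forall>y\<in>M. x + y \<in> M) \<and> (\<forall>a\<in>A. \<forall>x\<in>M. i a * x \<in> M) \<and>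
     (\<forall>x. \<exists>c. c \<noteq> 0 \<and> i c * x \<in> M) \<and> (\<forall>\<phi>. klinear \<phi> \<longrightarrow> (\<exists>c. c \<noteq> 0 \<and> (\<forall>m\<in>M. c * \<phi> m \<in> A)))"

lemma latticeD:
  assumes "lattice M"
  shows "0 \<in> M" "x \<in> M \<Longrightarrow> y \<in> M \<Longrightarrow> x + y \<in> M" "a \<in> A \<Longrightarrow> x \<in> M \<Longrightarrow> i a * x \<in> M"
    "\<exists>c. c \<noteq> 0 \<and> i c * x \<in> M" "klinear \<phi> \<Longrightarrow> \<exists>c. c \<noteq> 0 \<and> (\<forall>m\<in>M. c * \<phi> m \<in> A)"
  using assms unfolding lattice_def by blast+

text \<open>The denominator \<open>c\<close> bounds the values on Q from below. A minimum need not
  exist, but an element whose value exceeds the real infimum by less than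
  \<open>w (i \<epsilon>)\<close> divides all of Q up to \<epsilon>.\<close>

lemma almost_minimal:
  assumes "c \<noteq> 0" "\<And>q. q \<in> Q \<Longrightarrow> c * q \<in> A" "q0 \<in> Q" "q0 \<noteq> 0" "\<epsilon> \<in> \<mm>" "\<epsilon> \<noteq> 0"
  shows "\<exists>a\<in>Q. a \<noteq> 0 \<and> (\<forall>q\<in>Q. \<epsilon> * (q / a) \<in> A)"
proof -
  define S where "S = (\<lambda>q. w (i q)) ` (Q - {0})"
  have "- w (i c) \<le> w (i q)" if "q \<in> Q - {0}" for q
    using assms(1) assms(2)[of q] that by (auto simp: A_iff w_mult)
  then have S: "bdd_below S" "S \<noteq> {}" using assms(3,4) by (auto simp: S_def bdd_below_def)
  have "Inf S < Inf S + w (i \<epsilon>)" using assms(5,6) by (auto simp: \<mm>_def)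
  then obtain a where a: "a \<in> Q" "a \<noteq> 0" "w (i a) < Inf S + w (i \<epsilon>)"
    using cInf_less_iff[OF S(2,1), of "Inf S + w (i \<epsilon>)"] unfolding S_def by blast
  have "\<epsilon> * (q / a) \<in> A" if "q \<in> Q" for q
  proof (cases "q = 0")
    case False
    then have "Inf S \<le> w (i q)" using that S by (intro cInf_lower) (auto simp: S_def)
    then show ?thesis using a False assms(6) by (auto simp: A_iff w_mult w_divide)
  qed simp
  then show ?thesis using a by blast
qed

text \<open>The basis \<open>f\<close> is built along the flag \<open>U k\<close> spanned by \<open>e 0, \<dots>, e (k - 1)\<close>: the
  new vector \<open>f k\<close> is an element of \<open>M \<inter> U (k + 1)\<close> whose last coordinate has almost minimal
  value.\<close>

lemma lattice_almost_basis:
  assumes M: "lattice M" and e: "dual_basis n e g0" and \<epsilon>: "\<epsilon> \<in> \<mm>" "\<epsilon> \<noteq> 0"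
  shows "\<exists>f g. dual_basis n f g \<and> (\<forall>k<n. f k \<in> M) \<and> (\<forall>k<n. \<forall>m\<in>M. \<epsilon> ^ n * g k m \<in> A)"
proof -
  define U where "U k = {x. \<forall>j. k \<le> j \<and> j < n \<longrightarrow> g0 j x = 0}" for k
  have g0: "klinear (g0 k)" if "k < n" for k using e that by (auto simp: dual_basis_def)
  have ge: "g0 k (e l) = (if k = l then 1 else 0)" if "k < n" "l < n" for k l
    using e that by (auto simp: dual_basis_def)
  have ex: "x = (\<Sum>k<n. i (g0 k x) * e k)" for x using e by (auto simp: dual_basis_def)
  have \<epsilon>A: "\<epsilon> \<in> A" using \<epsilon> m_subset_A by auto
  \<comment> \<open>The invariant: f and g are dual bases of the member \<open>U k\<close> of the
    flag. Each extension of the flag costs one factor \<epsilon>, hence the exponent k.\<close>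
  define P where "P k f g \<longleftrightarrow> (\<forall>j<k. klinear (g j) \<and> f j \<in> M \<inter> U k) \<and>
      (\<forall>j<k. \<forall>l<k. g j (f l) = (if j = l then 1 else 0)) \<and> (\<forall>x\<in>U k. x = (\<Sum>j<k. i (g j x) * f j)) \<and>
      (\<forall>j<k. \<forall>m\<in>M \<inter> U k. \<epsilon> ^ k * g j m \<in> A)" for k f g
  have "\<exists>f g. P k f g" if "k \<le> n" for k
    using that
  proof (induction k)
    case 0
    have "x = 0" if "x \<in> U 0" for x
      by (subst ex) (use that in \<open>auto simp: U_def intro!: sum.neutral\<close>)
    then show ?case by (simp add: P_def)
  next
    case (Suc k)
    then have k: "k < n" by simp
    obtain f g where "P k f g" using Suc by auto
    then have lin: "\<And>j. j < k \<Longrightarrow> klinear (g j)" and fM: "\<And>j. j < k \<Longrightarrow> f j \<in> M \<inter> U k"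
      and gf: "\<And>j l. j < k \<Longrightarrow> l < k \<Longrightarrow> g j (f l) = (if j = l then 1 else 0)"
      and rep: "\<And>x. x \<in> U k \<Longrightarrow> x = (\<Sum>j<k. i (g j x) * f j)"
      and bd: "\<And>j m. j < k \<Longrightarrow> m \<in> M \<inter> U k \<Longrightarrow> \<epsilon> ^ k * g j m \<in> A"
      unfolding P_def by blast+
    have US: "x \<in> U k \<longleftrightarrow> x \<in> U (Suc k) \<and> g0 k x = 0" for x
      using k unfolding U_def by (auto, metis Suc_leI le_neq_implies_less)
    obtain c where c: "c \<noteq> 0" "\<And>m. m \<in> M \<Longrightarrow> c * g0 k m \<in> A"
      using latticeD(5)[OF M g0[OF k]] by blast
    obtain d where d: "d \<noteq> 0" "i d * e k \<in> M" using latticeD(4)[OF M] by blast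
    have dU: "i d * e k \<in> U (Suc k)" "g0 k (i d * e k) = d"
      using k by (auto simp: U_def klinearD(2)[OF g0] ge)
    \<comment> \<open>These coordinates are bounded because M is a lattice, and not all 0 because a
      nonzero multiple of \<open>e k\<close> lies in M.\<close>
    have "\<exists>a\<in>g0 k ` (M \<inter> U (Suc k)). a \<noteq> 0 \<and> (\<forall>q\<in>g0 k ` (M \<inter> U (Suc k)). \<epsilon> * (q / a) \<in> A)"
    proof (rule almost_minimal[OF c(1) _ _ d(1) \<epsilon>])
      show "d \<in> g0 k ` (M \<inter> U (Suc k))" using dU d(2) by (metis IntI imageI)
    qed (use c in auto)
    then obtain f' where f': "f' \<in> M" "f' \<in> U (Suc k)" "g0 k f' \<noteq> 0"
      and min: "\<And>m. m \<in> M \<inter> U (Suc k) \<Longrightarrow> \<epsilon> * (g0 k m / g0 k f') \<in> A" by auto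
    define h where "h x = g0 k x / g0 k f'" for x
    have h: "klinear h"
      using klinearD[OF g0[OF k]] by (auto simp: klinear_def h_def add_divide_distrib)
    have hf': "h f' = 1" using f' by (simp add: h_def)
    have hU: "h x = 0" if "x \<in> U k" for x using that US by (simp add: h_def)
    have sub: "x - i (h x) * f' \<in> U k" if "x \<in> U (Suc k)" for x
    proof -
      have "g0 j (x - i (h x) * f') = g0 j x - h x * g0 j f'" if "j < n" for j
        by (simp only: klinearD(2,5)[OF g0[OF that]])
      then show ?thesis using that f' k by (simp add: US) (simp add: U_def h_def)
    qed
    \<comment> \<open>The old functionals are controlled on \<open>U k\<close> only. They are
      composed with the projection of \<open>U (Suc k)\<close> onto \<open>U k\<close> along f',
      which makes them vanish at f'.\<close>
    let ?f = "f(k := f')" and ?g = "\<lambda>j x. if j = k then h x else g j (x - i (h x) * f')"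
    have "klinear (\<lambda>x. g j (x - i (h x) * f'))" if "j < k" for j
      unfolding klinear_def
    proof (intro conjI allI)
      fix x y
      have "x + y - i (h (x + y)) * f' = (x - i (h x) * f') + (y - i (h y) * f')"
        by (simp add: klinearD(1)[OF h] algebra_simps)
      then show "g j (x + y - i (h (x + y)) * f') = g j (x - i (h x) * f') + g j (y - i (h y) * f')"
        by (simp only: klinearD(1)[OF lin[OF that]])
    next
      fix c x
      have "i c * x - i (h (i c * x)) * f' = i c * (x - i (h x) * f')"
        by (simp only: klinearD(2)[OF h] i_mult) (simp add: right_diff_distrib mult.assoc)
      then show "g j (i c * x - i (h (i c * x)) * f') = c * g j (x - i (h x) * f')"
        by (simp only: klinearD(2)[OF lin[OF that]])
    qed
    then have 1: "klinear (?g j)" if "j < Suc k" for j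
      using that h by (cases "j = k") auto
    have 2: "?f j \<in> M \<inter> U (Suc k)" if "j < Suc k" for j
      using that fM[of j] f' US by (cases "j = k") auto
    have 3: "?g j (?f l) = (if j = l then 1 else 0)" if "j < Suc k" "l < Suc k" for j l
      using that gf[of j l] hf' hU[of "f l"] fM[of l] klinearD(3)[OF lin, of j]
      by (cases "j = k"; cases "l = k") auto
    have 4: "x = (\<Sum>j<Suc k. i (?g j x) * ?f j)" if "x \<in> U (Suc k)" for x
      using rep[OF sub[OF that]] by (simp add: algebra_simps)
    have 5: "\<epsilon> ^ Suc k * ?g j m \<in> A" if "j < Suc k" "m \<in> M \<inter> U (Suc k)" for j m
    proof (cases "j = k")
      case True
      have "\<epsilon> ^ k * (\<epsilon> * h m) \<in> A"
        using min[OF that(2)] by (intro A_closed(2)[OF A_power[OF \<epsilon>A]]) (simp add: h_def)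
      then show ?thesis using True by (simp add: algebra_simps)
    next
      case False
      \<comment> \<open>The projection of m need not lie in M, because \<open>h m\<close> is only
        almost in A. Its multiple by \<epsilon> does lie in M, and the bound on \<open>U k\<close>
        applies to it.\<close>
      have "- (\<epsilon> * h m) \<in> A" using min[OF that(2)] by (intro A_closed(3)) (simp add: h_def)
      then have "i \<epsilon> * m + i (- (\<epsilon> * h m)) * f' \<in> M"
        using that f' \<epsilon>A by (intro latticeD(2,3)[OF M]) auto
      then have "i \<epsilon> * (m - i (h m) * f') \<in> M" by (simp add: algebra_simps)
      moreover have "i \<epsilon> * (m - i (h m) * f') \<in> U k"
        using sub[of m] that(2) by (auto simp: U_def klinearD(2)[OF g0])
      ultimately have "\<epsilon> ^ k * g j (i \<epsilon> * (m - i (h m) * f')) \<in> A" using bd False that(1) by simp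
      moreover have "g j (i \<epsilon> * (m - i (h m) * f')) = \<epsilon> * g j (m - i (h m) * f')"
        using False that(1) by (intro klinearD(2) lin) simp
      ultimately show ?thesis using False by (simp add: mult.assoc mult.left_commute)
    qed
    have "P (Suc k) ?f ?g" unfolding P_def using 1 2 3 4 5 by blast
    then show ?case by blast
  qed
  then obtain f g where P: "P n f g" by blast
  have U: "U n = UNIV" by (auto simp: U_def)
  show ?thesis using P[unfolded P_def U Int_UNIV_right ball_UNIV] unfolding dual_basis_def by blast
qed


text \<open>Denominators in A can be multiplied without spoiling the earlier ones. They can be found
  in A because it is a valuation ring: if \<open>c1\<close> is not in A, then its inverse is, and 1
  is already a denominator.\<close>

lemma common_denominator:
  fixes f :: "nat \<Rightarrow> 'b \<Rightarrow> 'k"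
  assumes "\<And>k. k < d \<Longrightarrow> \<exists>c. c \<noteq> 0 \<and> (\<forall>m\<in>M. c * f k m \<in> A)"
  shows "\<exists>c\<in>A. c \<noteq> 0 \<and> (\<forall>k<d. \<forall>m\<in>M. c * f k m \<in> A)"
  using assms
proof (induction d)
  case (Suc d)
  have "\<exists>c\<in>A. c \<noteq> 0 \<and> (\<forall>k<d. \<forall>m\<in>M. c * f k m \<in> A)" by (rule Suc.IH) (use Suc.prems in simp)
  then obtain c where c: "c \<in> A" "c \<noteq> 0" "\<And>k m. k < d \<Longrightarrow> m \<in> M \<Longrightarrow> c * f k m \<in> A"
    by blast
  obtain c1 where c1: "c1 \<noteq> 0" "\<And>m. m \<in> M \<Longrightarrow> c1 * f d m \<in> A" using Suc.prems by blast
  obtain c2 where c2: "c2 \<in> A" "c2 \<noteq> 0" "\<And>m. m \<in> M \<Longrightarrow> c2 * f d m \<in> A"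
  proof (cases "c1 \<in> A")
    case False
    then have "inverse c1 \<in> A" using c1(1) w_inverse[of "i c1"] by (auto simp: A_iff)
    then have "inverse c1 * (c1 * f d m) \<in> A" if "m \<in> M" for m
      using c1(2)[OF that] by (rule A_closed(2))
    then show ?thesis using c1(1) by (intro that[of 1]) (simp_all add: mult.assoc[symmetric])
  qed (use c1 that in blast)
  have "c * c2 * f k m \<in> A" if "k < Suc d" "m \<in> M" for k m
  proof (cases "k = d")
    case True
    have "c * (c2 * f k m) \<in> A" using True c2(3) that by (intro A_closed(2)[OF c(1)]) auto
    then show ?thesis by (simp add: mult.assoc)
  next
    case False
    have "c2 * (c * f k m) \<in> A" using False c(3) that by (intro A_closed(2)[OF c2(1)]) auto
    then show ?thesis by (simp add: mult.assoc mult.left_commute)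
  qed
  moreover have "c * c2 \<in> A" "c * c2 \<noteq> 0" using c(1,2) c2(1,2) by (auto intro: A_closed)
  ultimately show ?case by blast
qed (rule bexI[of _ 1], simp_all)

lemma denominator: "\<exists>c. c \<noteq> 0 \<and> c * a \<in> A"
proof (cases "a = 0")
  case False
  then show ?thesis by (intro exI[of _ "inverse a"]) auto
qed (rule exI[of _ 1], simp)

text \<open>The free A-module on the \<open>e k\<close>, from which lattices stable under given
  integral elements are built.\<close>

lemma lattice_of_basis:
  assumes e: "dual_basis n e g"
  shows "lattice {x. \<forall>k<n. g k x \<in> A}"
proof -
  have g: "klinear (g k)" if "k < n" for k using e that by (auto simp: dual_basis_def)
  have ex: "x = (\<Sum>k<n. i (g k x) * e k)" for x using e by (auto simp: dual_basis_def)
  have "\<exists>c. c \<noteq> 0 \<and> (\<forall>k<n. g k (i c * x) \<in> A)" for x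
    using common_denominator[of n UNIV "\<lambda>k _. g k x"] denominator
    by (auto simp: klinearD(2)[OF g])
  moreover have "\<exists>c. c \<noteq> 0 \<and> (\<forall>m\<in>{x. \<forall>k<n. g k x \<in> A}. c * \<phi> m \<in> A)" if \<phi>: "klinear \<phi>" for \<phi>
  proof -
    obtain c where c: "c \<noteq> 0" "\<And>k. k < n \<Longrightarrow> c * \<phi> (e k) \<in> A"
      using common_denominator[of n UNIV "\<lambda>k _. \<phi> (e k)"] denominator by auto
    have "c * \<phi> m \<in> A" if m: "\<forall>k<n. g k m \<in> A" for m
    proof -
      have "c * \<phi> m = (\<Sum>k<n. g k m * (c * \<phi> (e k)))"
        by (subst ex[of m]) (simp only: klinearD(2,6)[OF \<phi>] sum_distrib_left mult.left_commute)
      also have "\<dots> \<in> A" using m c by (intro A_sum, intro A_closed(2)[where a = "g _ m"]) auto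
      finally show ?thesis .
    qed
    then show ?thesis using c by auto
  qed
  ultimately show ?thesis
    unfolding lattice_def by (auto simp: klinearD(1,2,3)[OF g] A_closed)
qed

text \<open>If x satisfies an integral equation of degree d + 1, then N = M + x M + ... + x^d M is
  stable under x. Multipliers of M remain multipliers of N, so several integral elements can be
  treated one after another.\<close>

lemma lattice_stable_integral:
  assumes M: "lattice M" and x: "integral_element x"
  shows "\<exists>N. lattice N \<and> (\<forall>m\<in>N. x * m \<in> N) \<and> (\<forall>y. (\<forall>m\<in>M. y * m \<in> M) \<longrightarrow> (\<forall>m\<in>N. y * m \<in> N))"
proof -
  obtain d' a where a: "\<And>k. a k \<in> A" "x ^ d' = (\<Sum>k<d'. i (a k) * x ^ k)"
    using x by (auto simp: integral_element_def)
  obtain d where d: "d' = Suc d" using a(2) by (cases d') auto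
  define N where "N = {\<Sum>k\<le>d. x ^ k * m k | m. \<forall>k. m k \<in> M}"
  have NI: "y \<in> N" if "y = (\<Sum>k\<le>d. x ^ k * m k)" "\<And>k. m k \<in> M" for y m
    using that unfolding N_def by blast
  have NE: "\<exists>m. y = (\<Sum>k\<le>d. x ^ k * m k) \<and> (\<forall>k. m k \<in> M)" if "y \<in> N" for y
    using that unfolding N_def by blast
  have MN: "M \<subseteq> N"
  proof
    fix m assume "m \<in> M"
    then show "m \<in> N"
      by (intro NI[of _ "\<lambda>k. if k = 0 then m else 0"])
         (auto simp: latticeD(1)[OF M] if_distrib sum.delta cong: if_cong)
  qed
  have stable: "y * z \<in> N" if y: "\<And>m. m \<in> M \<Longrightarrow> y * m \<in> M" and z: "z \<in> N" for y z
  proof -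
    obtain m where m: "z = (\<Sum>k\<le>d. x ^ k * m k)" "\<And>k. m k \<in> M" using NE[OF z] by blast
    show ?thesis
      by (rule NI[of _ "\<lambda>k. y * m k"]) (use m y in \<open>auto simp: sum_distrib_left mult.left_commute\<close>)
  qed
  have "lattice N"
    unfolding lattice_def
  proof (intro conjI ballI allI impI)
    show "0 \<in> N" using MN latticeD(1)[OF M] by blast
  next
    fix y z assume y: "y \<in> N" and z: "z \<in> N"
    obtain m where m: "y = (\<Sum>k\<le>d. x ^ k * m k)" "\<And>k. m k \<in> M" using NE[OF y] by blast
    obtain m' where m': "z = (\<Sum>k\<le>d. x ^ k * m' k)" "\<And>k. m' k \<in> M" using NE[OF z] by blast
    show "y + z \<in> N"
      by (rule NI[of _ "\<lambda>k. m k + m' k"])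
         (use m m' latticeD(2)[OF M] in \<open>auto simp: distrib_left sum.distrib\<close>)
  next
    fix c y assume "c \<in> A" "y \<in> N"
    then show "i c * y \<in> N" using latticeD(3)[OF M] by (intro stable) auto
  next
    fix y
    show "\<exists>c. c \<noteq> 0 \<and> i c * y \<in> N" using latticeD(4)[OF M, of y] MN by blast
  next
    fix \<phi> assume \<phi>: "klinear \<phi>"
    obtain c where c: "c \<noteq> 0" "\<And>k m. k < Suc d \<Longrightarrow> m \<in> M \<Longrightarrow> c * \<phi> (x ^ k * m) \<in> A"
      using common_denominator[of "Suc d" M "\<lambda>k m. \<phi> (x ^ k * m)"] latticeD(5)[OF M klinear_mult[OF \<phi>]]
      by blast
    have "c * \<phi> z \<in> A" if z: "z \<in> N" for z
    proof -
      obtain m where m: "z = (\<Sum>k\<le>d. x ^ k * m k)" "\<And>k. m k \<in> M" using NE[OF z] by blast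
      have "c * \<phi> z = (\<Sum>k\<le>d. c * \<phi> (x ^ k * m k))"
        by (simp only: m(1) klinearD(6)[OF \<phi>] sum_distrib_left)
      also have "\<dots> \<in> A" using c m by (intro A_sum) auto
      finally show ?thesis .
    qed
    then show "\<exists>c. c \<noteq> 0 \<and> (\<forall>m\<in>N. c * \<phi> m \<in> A)" using c(1) by blast
  qed
  moreover have "x * z \<in> N" if z: "z \<in> N" for z
  proof -
    obtain m where m: "z = (\<Sum>k\<le>d. x ^ k * m k)" "\<And>k. m k \<in> M" using NE[OF z] by blast
    \<comment> \<open>Multiplication by x shifts the coefficients by one, and the overflow
      \<open>x ^ Suc d * m d\<close> is redistributed by the integral equation.\<close>
    show ?thesis
    proof (rule NI[of _ "\<lambda>k. (if k = 0 then 0 else m (k - 1)) + i (a k) * m d"])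
      have "x * z = (\<Sum>k\<le>d. x ^ Suc k * m k)" by (simp add: m(1) sum_distrib_left mult.assoc)
      also have "\<dots> = (\<Sum>k<d. x ^ Suc k * m k) + x ^ d' * m d"
        unfolding d by (simp flip: lessThan_Suc_atMost)
      also have "(\<Sum>k<d. x ^ Suc k * m k) = (\<Sum>k\<le>d. x ^ k * (if k = 0 then 0 else m (k - 1)))"
        by (cases d) (simp_all add: lessThan_Suc_atMost sum.atMost_Suc_shift del: sum.atMost_Suc)
      also have "x ^ d' * m d = (\<Sum>k\<le>d. x ^ k * (i (a k) * m d))"
        using a(2) by (simp add: d lessThan_Suc_atMost sum_distrib_right mult.assoc mult.left_commute del: sum.atMost_Suc power_Suc)
      finally show "x * z = (\<Sum>k\<le>d. x ^ k * ((if k = 0 then 0 else m (k - 1)) + i (a k) * m d))"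
        by (simp add: distrib_left sum.distrib)
    qed (use m a latticeD[OF M] in auto)
  qed
  ultimately show ?thesis using stable by blast
qed

lemma lattice_stable_integral_list:
  assumes e: "dual_basis n e g" and "\<And>x. x \<in> set xs \<Longrightarrow> integral_element x"
  shows "\<exists>M. lattice M \<and> (\<forall>x\<in>set xs. \<forall>m\<in>M. x * m \<in> M)"
  using assms(2)
proof (induction xs)
  case Nil
  then show ?case using lattice_of_basis[OF e] by auto
next
  case (Cons x xs)
  then obtain M where "lattice M" "\<forall>x\<in>set xs. \<forall>m\<in>M. x * m \<in> M" by auto
  moreover obtain N where "lattice N" "\<forall>m\<in>N. x * m \<in> N"
    "\<forall>y. (\<forall>m\<in>M. y * m \<in> M) \<longrightarrow> (\<forall>m\<in>N. y * m \<in> N)"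
    using lattice_stable_integral[OF \<open>lattice M\<close>, of x] Cons.prems by auto
  ultimately show ?case by (intro exI[of _ N]) auto
qed

subsection \<open>Separability\<close>

text \<open>A list \<open>ps\<close> stands for the element \<open>\<Sum> u \<otimes> v\<close> of \<open>L \<otimes>\<^sub>K L\<close>.  The next definition says that
  multiplying its left and its right factors by \<open>x\<close> gives the same result.\<close>

definition balanced :: "('l \<times> 'l) list \<Rightarrow> 'l \<Rightarrow> bool" where
  "balanced ps x \<longleftrightarrow> (\<forall>\<phi>. klinear \<phi> \<longrightarrow>
     (\<Sum>(u, v)\<leftarrow>ps. i (\<phi> (x * u)) * v) = x * (\<Sum>(u, v)\<leftarrow>ps. i (\<phi> u) * v))"

definition tensor_times :: "('l \<times> 'l) list \<Rightarrow> ('l \<times> 'l) list \<Rightarrow> ('l \<times> 'l) list" where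
  "tensor_times ps qs = concat (map (\<lambda>(u, v). map (\<lambda>(u', v'). (u * u', v * v')) qs) ps)"

lemma sum_list_tensor_times:
  "(\<Sum>(u, v)\<leftarrow>tensor_times ps qs. F u v) = (\<Sum>(u, v)\<leftarrow>ps. \<Sum>(u', v')\<leftarrow>qs. F (u * u') (v * v'))"
  by (induction ps) (auto simp: tensor_times_def o_def case_prod_unfold)

lemma sum_list_swap:
  "(\<Sum>p\<leftarrow>ps. \<Sum>q\<leftarrow>qs. F p q) = (\<Sum>q\<leftarrow>qs. \<Sum>p\<leftarrow>ps. F p q :: 'b::comm_monoid_add)"
  by (induction ps) (auto simp: sum_list_addf)

text \<open>The elements annihilated by 1 \<otimes> x - x \<otimes> 1 form an ideal of the tensor
  square of L over K. Functionals on the left factor detect equality there, and a fixed left factor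
  u is absorbed into the functional by \<open>klinear_mult\<close>.\<close>

lemma balanced_tensor_times:
  assumes "balanced ps x \<or> balanced qs x"
  shows "balanced (tensor_times ps qs) x"
  unfolding balanced_def sum_list_tensor_times
proof (intro allI impI)
  fix \<phi> assume \<phi>: "klinear \<phi>"
  have *: "(\<Sum>(u, v)\<leftarrow>ps. \<Sum>(u', v')\<leftarrow>qs. i (\<phi> (x * (u * u'))) * (v * v'))
      = x * (\<Sum>(u, v)\<leftarrow>ps. \<Sum>(u', v')\<leftarrow>qs. i (\<phi> (u * u')) * (v * v'))" if "balanced qs x" for ps qs
  proof -
    have "(\<Sum>(u', v')\<leftarrow>qs. i (\<phi> (x * (u * u'))) * (v * v'))
        = x * (\<Sum>(u', v')\<leftarrow>qs. i (\<phi> (u * u')) * (v * v'))" for u v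
    proof -
      have "(\<Sum>(u', v')\<leftarrow>qs. i (\<phi> (u * (x * u'))) * v') = x * (\<Sum>(u', v')\<leftarrow>qs. i (\<phi> (u * u')) * v')"
        using that klinear_mult[OF \<phi>, of u] unfolding balanced_def by blast
      then have "v * (\<Sum>(u', v')\<leftarrow>qs. i (\<phi> (u * (x * u'))) * v')
        = v * (x * (\<Sum>(u', v')\<leftarrow>qs. i (\<phi> (u * u')) * v'))"
        by simp
      then show ?thesis
        by (simp add: sum_list_const_mult[symmetric] case_prod_unfold mult.left_commute)
    qed
    then show ?thesis by (simp add: sum_list_const_mult[symmetric] case_prod_unfold)
  qed
  show "(\<Sum>(u, v)\<leftarrow>ps. \<Sum>(u', v')\<leftarrow>qs. i (\<phi> (x * (u * u'))) * (v * v'))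
      = x * (\<Sum>(u, v)\<leftarrow>ps. \<Sum>(u', v')\<leftarrow>qs. i (\<phi> (u * u')) * (v * v'))"
    using assms
  proof
    assume "balanced ps x"
    have sw: "(\<Sum>(u, v)\<leftarrow>ps. \<Sum>(u', v')\<leftarrow>qs. G (u * u') (v * v'))
      = (\<Sum>(u, v)\<leftarrow>qs. \<Sum>(u', v')\<leftarrow>ps. G (u * u') (v * v'))"
      for G :: "'l \<Rightarrow> 'l \<Rightarrow> 'l"
      unfolding case_prod_unfold by (subst sum_list_swap) (simp add: mult.commute)
    show ?thesis
      using *[OF \<open>balanced ps x\<close>, of qs] sw[of "\<lambda>a b. i (\<phi> (x * a)) * b"] sw[of "\<lambda>a b. i (\<phi> a) * b"]
        by simp
  qed (rule *)
qed

text \<open>The x that balance a fixed tensor form a K-subalgebra of L, which is all of L as soon as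
  it contains a basis.\<close>

lemma balanced_closed:
  "balanced ps x \<Longrightarrow> balanced ps y \<Longrightarrow> balanced ps (x + y)"
  "balanced ps x \<Longrightarrow> balanced ps y \<Longrightarrow> balanced ps (x * y)"
  "balanced ps (i c)"
proof -
  show "balanced ps (i c)"
    by (simp add: balanced_def klinearD(2) case_prod_unfold sum_list_const_mult[symmetric] mult.assoc)
  assume x: "balanced ps x" and y: "balanced ps y"
  show "balanced ps (x + y)"
    using x y by (simp add: balanced_def klinearD(1) case_prod_unfold distrib_right sum_list_addf)
  show "balanced ps (x * y)"
    unfolding balanced_def
  proof (intro allI impI)
    fix \<phi> assume \<phi>: "klinear \<phi>"
    have "(\<Sum>(u, v)\<leftarrow>ps. i (\<phi> (y * (x * u))) * v) = x * (\<Sum>(u, v)\<leftarrow>ps. i (\<phi> (y * u)) * v)"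
      using x klinear_mult[OF \<phi>] unfolding balanced_def by blast
    moreover have "(\<Sum>(u, v)\<leftarrow>ps. i (\<phi> (y * u)) * v) = y * (\<Sum>(u, v)\<leftarrow>ps. i (\<phi> u) * v)"
      using y \<phi> unfolding balanced_def by blast
    ultimately show "(\<Sum>(u, v)\<leftarrow>ps. i (\<phi> (x * y * u)) * v) = x * y * (\<Sum>(u, v)\<leftarrow>ps. i (\<phi> u) * v)"
      by (simp add: mult.assoc mult.left_commute)
  qed
qed

text \<open>For a polynomial \<open>f = \<Sum> a k X ^ k\<close> with the root \<open>x\<close>, this is the quotient
  \<open>(f(X) - f(Y)) / (X - Y)\<close> at \<open>X = x \<otimes> 1\<close> and \<open>Y = 1 \<otimes> x\<close>.\<close>

lemma balanced_root:
  assumes root: "(\<Sum>k\<le>d. i (a k) * x ^ k) = 0"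
  defines "ps \<equiv> concat (map (\<lambda>k. map (\<lambda>l. (i (a k) * x ^ l, x ^ (k - 1 - l))) [0..<k]) [0..<Suc d])"
  shows "balanced ps x" "(\<Sum>(u, v)\<leftarrow>ps. u * v) = (\<Sum>k\<le>d. of_nat k * i (a k) * x ^ (k - 1))"
proof -
  have sum_ps: "(\<Sum>(u, v)\<leftarrow>ps. F u v) = (\<Sum>k\<le>d. \<Sum>l<k. F (i (a k) * x ^ l) (x ^ (k - 1 - l)))"
    for F :: "'l \<Rightarrow> 'l \<Rightarrow> 'l"
  proof -
    have "(\<Sum>(u, v)\<leftarrow>concat (map (\<lambda>k. map (\<lambda>l. (i (a k) * x ^ l, x ^ (k - 1 - l))) [0..<k]) ks). F u v)
        = (\<Sum>k\<leftarrow>ks. \<Sum>l<k. F (i (a k) * x ^ l) (x ^ (k - 1 - l)))" for ks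
      by (induction ks) (auto simp: o_def interv_sum_list_conv_sum_set_nat lessThan_atLeast0)
    then show ?thesis
      by (simp only: ps_def interv_sum_list_conv_sum_set_nat atLeast_upt[symmetric] atLeast0LessThan lessThan_Suc_atMost set_upt)
  qed
  show "balanced ps x"
    unfolding balanced_def sum_ps
  proof (intro allI impI)
    fix \<phi> assume \<phi>: "klinear \<phi>"
    have "(\<Sum>l<k. i (\<phi> (x * (i (a k) * x ^ l))) * x ^ (k - 1 - l)) - x * (\<Sum>l<k. i (\<phi> (i (a k) * x ^ l)) * x ^ (k - 1 - l))
        = i (a k) * (i (\<phi> (x ^ k)) - i (\<phi> 1) * x ^ k)" for k
    proof -
      \<comment> \<open>With G each summand is a difference of consecutive terms, and the inner sum
        telescopes to \<open>G k - G 0\<close>.\<close>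
      define G where "G l = i (\<phi> (x ^ l)) * x ^ (k - l)" for l
      have "i (\<phi> (x * (i (a k) * x ^ l))) * x ^ (k - 1 - l) - x * (i (\<phi> (i (a k) * x ^ l)) * x ^ (k - 1 - l))
          = i (a k) * (G (Suc l) - G l)" if "l < k" for l
      proof -
        have pw: "x ^ (k - l) = x * x ^ (k - 1 - l)" "k - Suc l = k - 1 - l"
          using that by (simp_all add: Suc_diff_Suc flip: power_Suc)
        have lin: "\<phi> (x * (i (a k) * x ^ l)) = a k * \<phi> (x ^ Suc l)"
          "\<phi> (i (a k) * x ^ l) = a k * \<phi> (x ^ l)"
          using klinearD(2)[OF \<phi>, of "a k" "x ^ Suc l"] klinearD(2)[OF \<phi>]
            by (simp_all add: mult.left_commute)
        show ?thesis unfolding lin G_def pw by (simp add: algebra_simps)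
      qed
      then have "(\<Sum>l<k. i (\<phi> (x * (i (a k) * x ^ l))) * x ^ (k - 1 - l) - x * (i (\<phi> (i (a k) * x ^ l)) * x ^ (k - 1 - l)))
          = (\<Sum>l<k. i (a k) * (G (Suc l) - G l))" by (intro sum.cong) auto
      also have "\<dots> = i (a k) * (G k - G 0)" by (simp flip: sum_distrib_left add: sum_lessThan_telescope)
      finally show ?thesis by (simp add: sum_subtractf sum_distrib_left G_def)
    qed
    then have "(\<Sum>k\<le>d. \<Sum>l<k. i (\<phi> (x * (i (a k) * x ^ l))) * x ^ (k - 1 - l))
          - x * (\<Sum>k\<le>d. \<Sum>l<k. i (\<phi> (i (a k) * x ^ l)) * x ^ (k - 1 - l))
        = (\<Sum>k\<le>d. i (a k) * (i (\<phi> (x ^ k)) - i (\<phi> 1) * x ^ k))"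
      by (simp add: sum_distrib_left[of x "\<lambda>k. \<Sum>l<k. F k l" for F] flip: sum_subtractf)
    \<comment> \<open>Summed over k, the telescoped terms assemble to f(x), once inside \<phi> and
      once as a factor; both vanish because x is a root.\<close>
    also have "\<dots> = i (\<phi> (\<Sum>k\<le>d. i (a k) * x ^ k)) - i (\<phi> 1) * (\<Sum>k\<le>d. i (a k) * x ^ k)"
      by (simp add: klinearD(2,6)[OF \<phi>] right_diff_distrib sum_subtractf sum_distrib_left mult.left_commute)
    finally show "(\<Sum>k\<le>d. \<Sum>l<k. i (\<phi> (x * (i (a k) * x ^ l))) * x ^ (k - 1 - l))
          = x * (\<Sum>k\<le>d. \<Sum>l<k. i (\<phi> (i (a k) * x ^ l)) * x ^ (k - 1 - l))"
      by (simp add: root klinearD(3)[OF \<phi>])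
  qed
  have "(\<Sum>l<k. i (a k) * x ^ l * x ^ (k - 1 - l)) = of_nat k * i (a k) * x ^ (k - 1)" for k
  proof -
    have "(\<Sum>l<k. i (a k) * x ^ l * x ^ (k - 1 - l)) = (\<Sum>l<k. i (a k) * x ^ (k - 1))"
      by (intro sum.cong) (auto simp: mult.assoc simp flip: power_add)
    then show ?thesis by simp
  qed
  then show "(\<Sum>(u, v)\<leftarrow>ps. u * v) = (\<Sum>k\<le>d. of_nat k * i (a k) * x ^ (k - 1))"
    by (simp add: sum_ps)
qed

text \<open>This says that x is a simple root of a polynomial over K. For k = 0 the truncated
  exponent is harmless, because the factor \<open>of_nat k\<close> is 0.\<close>

definition separable_element :: "'l \<Rightarrow> bool" where
  "separable_element x \<longleftrightarrow> (\<exists>d a. (\<Sum>k\<le>d. i (a k) * x ^ k) = 0 \<and>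
    (\<Sum>k\<le>d. of_nat k * i (a k) * x ^ (k - 1)) \<noteq> 0)"

text \<open>Multiply the difference quotients of \<open>balanced_root\<close> over all basis
  elements. The product is balanced by each of them, and its image in L is the product of the
  derivatives, which is nonzero because L is a field.\<close>

lemma separability_tensor:
  assumes e: "dual_basis n e g" and sep: "\<And>x. separable_element x"
  shows "\<exists>ps. (\<forall>x. balanced ps x) \<and> (\<Sum>(u, v)\<leftarrow>ps. u * v) \<noteq> 0"
proof -
  have "\<exists>ps. (\<forall>j<k. balanced ps (e j)) \<and> (\<Sum>(u, v)\<leftarrow>ps. u * v) \<noteq> 0" for k
  proof (induction k)
    case 0
    then show ?case by (intro exI[of _ "[(1, 1)]"]) simp
  next
    case (Suc k)
    then obtain ps where ps: "\<forall>j<k. balanced ps (e j)" "(\<Sum>(u, v)\<leftarrow>ps. u * v) \<noteq> 0" by auto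
    obtain d a where root: "(\<Sum>l\<le>d. i (a l) * e k ^ l)
      = 0" and der: "(\<Sum>l\<le>d. of_nat l * i (a l) * e k ^ (l - 1)) \<noteq> 0"
      using sep[of "e k"] unfolding separable_element_def by blast
    obtain qs where qs: "balanced qs (e k)" "(\<Sum>(u, v)\<leftarrow>qs. u * v) \<noteq> 0"
      using that[OF balanced_root(1)[OF root]] balanced_root(2)[OF root] der by simp
    have "(\<Sum>(u, v)\<leftarrow>tensor_times ps qs. u * v) = (\<Sum>(u, v)\<leftarrow>ps. u * v) * (\<Sum>(u, v)\<leftarrow>qs. u * v)"
    proof -
      have "(\<Sum>(u, v)\<leftarrow>tensor_times ps qs. u * v) = (\<Sum>(u, v)\<leftarrow>ps. u * v * (\<Sum>(u', v')\<leftarrow>qs. u' * v'))"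
        unfolding sum_list_tensor_times
          by (simp add: sum_list_const_mult[symmetric] case_prod_unfold mult_ac)
      then show ?thesis by (simp add: sum_list_mult_const case_prod_unfold)
    qed
    then show ?case using ps qs balanced_tensor_times
      by (intro exI[of _ "tensor_times ps qs"]) (auto simp: less_Suc_eq)
  qed
  then obtain ps where ps: "\<And>j. j < n \<Longrightarrow> balanced ps (e j)" "(\<Sum>(u, v)\<leftarrow>ps. u * v) \<noteq> 0" by blast
  have "balanced ps x" for x
  proof -
    have "balanced ps (\<Sum>j<k. i (g j x) * e j)" if "k \<le> n" for k
      using that
    proof (induction k)
      case 0
      show ?case using balanced_closed(3)[of ps 0] by simp
    qed (simp add: balanced_closed ps)
    from this[OF order_refl] show ?thesis using e unfolding dual_basis_def by metis
  qed
  then show ?thesis using ps by blast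
qed


text \<open>The analogue of bounding an integral closure by a discriminant. For a basis f with dual
  basis h, balance gives b \<Delta> = \<Sum> h_j(b f_j u) v, summed over j and over the tensor. If f
  is an almost basis of a lattice stable under b and all u, then b u f_j lies in the lattice, and
  its coordinates have the denominator \<open>p ^ n\<close>, whatever b is.\<close>

lemma lattice_O:
  assumes e: "dual_basis n e g" and sep: "\<And>x. separable_element x"
    and int: "\<And>x. x \<in> \<O> \<Longrightarrow> integral_element x"
    and scale: "\<And>x. \<exists>c. c \<noteq> 0 \<and> i c * x \<in> \<O>" and p: "p \<in> \<mm>" "p \<noteq> 0"
  shows "lattice \<O>"
proof -
  obtain qs where qs: "\<And>x. balanced qs x" "(\<Sum>(u, v)\<leftarrow>qs. u * v) \<noteq> 0"
    using separability_tensor[OF e sep] by blast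
  have "\<exists>c\<in>A. c \<noteq> 0 \<and> (\<forall>x\<in>set xs. i c * x \<in> \<O>)" for xs :: "'l list"
  proof (induction xs)
    case Nil
    show ?case by (rule bexI[of _ 1]) simp_all
  next
    case (Cons x xs)
    then obtain c where c: "c \<in> A" "c \<noteq> 0" "\<forall>x\<in>set xs. i c * x \<in> \<O>" by auto
    obtain c1 where c1: "c1 \<noteq> 0" "i c1 * x \<in> \<O>" using scale by blast
    obtain c' where c': "c' \<in> A" "c' \<noteq> 0" "i c' * x \<in> \<O>"
    proof (cases "c1 \<in> A")
      case False
      then have "i (inverse c1) \<in> \<O>" using c1(1) w_inverse[of "i c1"] by (auto simp: A_iff \<O>_def)
      then have "i (inverse c1) * (i c1 * x) \<in> \<O>" using c1(2) by (rule O_mult)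
      then have "x \<in> \<O>" using c1(1) by (simp add: mult.assoc[symmetric])
      then show ?thesis by (intro that[of 1]) simp_all
    qed (use c1 that in blast)
    have "i (c * c') * y \<in> \<O>" if "y \<in> set (x # xs)" for y
    proof (cases "y = x")
      case True
      then show ?thesis using O_mult[of "i c" "i c' * x"] c(1) c'(3) by (simp add: A_def mult.assoc)
    next
      case False
      then show ?thesis using O_mult[of "i c'" "i c * y"] c(3) c'(1) that
        by (simp add: A_def mult.assoc mult.left_commute)
    qed
    then show ?case using c c' by (intro bexI[of _ "c * c'"]) (auto intro: A_closed)
  qed
  from this[of "map fst qs"] obtain c where c: "c \<noteq> 0" "\<And>u v. (u, v) \<in> set qs \<Longrightarrow> i c * u \<in> \<O>" by force
  define ps where "ps = map (\<lambda>(u, v). (i c * u, v)) qs"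
  have ps: "balanced ps x" for x
    unfolding balanced_def
  proof (intro allI impI)
    fix \<phi> assume "klinear \<phi>"
    then have "(\<Sum>(u, v)\<leftarrow>qs. i (\<phi> (i c * (x * u))) * v) = x * (\<Sum>(u, v)\<leftarrow>qs. i (\<phi> (i c * u)) * v)"
      using qs(1)[of x] klinear_mult[of \<phi> "i c"] unfolding balanced_def by blast
    then show "(\<Sum>(u, v)\<leftarrow>ps. i (\<phi> (x * u)) * v) = x * (\<Sum>(u, v)\<leftarrow>ps. i (\<phi> u) * v)"
      by (simp only: ps_def map_map o_def case_prod_unfold fst_conv snd_conv mult.left_commute)
  qed
  define \<Delta> where "\<Delta> = (\<Sum>(u, v)\<leftarrow>ps. u * v)"
  have "\<Delta> = i c * (\<Sum>(u, v)\<leftarrow>qs. u * v)"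
    by (simp add: \<Delta>_def ps_def o_def case_prod_unfold sum_list_const_mult[symmetric] mult.assoc)
  then have \<Delta>: "\<Delta> \<noteq> 0" using qs(2) c(1) by simp
  have psO: "u \<in> \<O>" if "(u, v) \<in> set ps" for u v using that c(2) by (auto simp: ps_def)
  have bounded: "\<exists>d. d \<noteq> 0 \<and> (\<forall>b\<in>\<O>. d * \<phi> (b * \<Delta>) \<in> A)" if \<phi>: "klinear \<phi>" for \<phi>
  proof -
    have "\<exists>d\<in>A. d \<noteq> 0 \<and> (\<forall>k<length ps. \<forall>m\<in>UNIV::unit set. d * \<phi> (snd (ps ! k)) \<in> A)"
      by (rule common_denominator) (simp add: denominator)
    then obtain d where d: "d \<noteq> 0" "\<And>u v. (u, v) \<in> set ps \<Longrightarrow> d * \<phi> v \<in> A"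
      by (metis UNIV_I in_set_conv_nth snd_conv)
    have "p ^ n * d * \<phi> (b * \<Delta>) \<in> A" if b: "b \<in> \<O>" for b
    proof -
      \<comment> \<open>M depends on b, and so do f and h below. The bound \<open>p ^ n * d\<close>
        does not.\<close>
      obtain M where M: "lattice M" "\<And>x m. x \<in> set (b # map fst ps) \<Longrightarrow> m \<in> M \<Longrightarrow> x * m \<in> M"
        using lattice_stable_integral_list[OF e, of "b # map fst ps"] int b psO by force
      obtain f h where fh: "dual_basis n f h" "\<And>k. k < n \<Longrightarrow> f k \<in> M"
        "\<And>k m. k < n \<Longrightarrow> m \<in> M \<Longrightarrow> p ^ n * h k m \<in> A"
        using lattice_almost_basis[OF M(1) e p] by blast
      have h: "klinear (h j)" if "j < n" for j using fh that by (auto simp: dual_basis_def)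
      have fx: "x = (\<Sum>j<n. i (h j x) * f j)" for x using fh(1) unfolding dual_basis_def by blast
      have "b * \<Delta> = (\<Sum>(u, v)\<leftarrow>ps. b * (\<Sum>j<n. i (h j u) * f j) * v)"
        unfolding \<Delta>_def
          by (simp only: fx[symmetric]) (simp add: case_prod_unfold sum_list_const_mult[symmetric] mult.assoc)
      also have "\<dots> = (\<Sum>(u, v)\<leftarrow>ps. \<Sum>j<n. b * f j * (i (h j u) * v))"
        by (simp add: case_prod_unfold sum_distrib_left sum_distrib_right mult_ac)
      also have "\<dots> = (\<Sum>j<n. \<Sum>(u, v)\<leftarrow>ps. b * f j * (i (h j u) * v))"
        by (induction ps) (auto simp: sum.distrib)
      also have "\<dots> = (\<Sum>j<n. b * f j * (\<Sum>(u, v)\<leftarrow>ps. i (h j u) * v))"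
        by (simp add: case_prod_unfold sum_list_const_mult)
      \<comment> \<open>Balance, tested with the functional \<open>h j\<close>, moves
        \<open>b * f j\<close> onto the left factor u.\<close>
      also have "\<dots> = (\<Sum>j<n. \<Sum>(u, v)\<leftarrow>ps. i (h j (b * f j * u)) * v)"
        using ps h by (intro sum.cong) (auto simp: balanced_def)
      finally have eq: "b * \<Delta> = (\<Sum>j<n. \<Sum>(u, v)\<leftarrow>ps. i (h j (b * f j * u)) * v)" .
      have \<phi>_list: "\<phi> (\<Sum>(u, v)\<leftarrow>qs. i (F u) * v) = (\<Sum>(u, v)\<leftarrow>qs. F u * \<phi> v)" for qs F
        by (induction qs) (auto simp: klinearD[OF \<phi>])
      have "p ^ n * d * \<phi> (b * \<Delta>) = (\<Sum>j<n. \<Sum>(u, v)\<leftarrow>ps. p ^ n * h j (b * f j * u) * (d * \<phi> v))"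
        unfolding eq klinearD(6)[OF \<phi>] \<phi>_list
        by (simp add: sum_distrib_left case_prod_unfold sum_list_const_mult[symmetric] mult_ac)
      also have "\<dots> \<in> A"
      proof (rule A_sum)
        fix j assume "j \<in> {..<n}"
        then have j: "j < n" by simp
        have mem: "p ^ n * h j (b * f j * u) * (d * \<phi> v) \<in> A" if uv: "(u, v) \<in> set ps" for u v
        proof -
          have "u \<in> set (b # map fst ps)" using uv by force
          then have "b * (u * f j) \<in> M" by (intro M(2) fh(2) j) auto
          then have "p ^ n * h j (b * f j * u) \<in> A" using fh(3)[OF j]
            by (simp add: mult.assoc mult.left_commute mult.commute)
          then show ?thesis using d(2)[OF uv] by (rule A_closed(2))
        qed
        have sum: "(\<Sum>(u, v)\<leftarrow>qs. F u v) \<in> A" if "\<And>u v. (u, v) \<in> set qs \<Longrightarrow> F u v \<in> A"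
          for qs and F :: "'l \<Rightarrow> 'l \<Rightarrow> 'k"
          using that by (induction qs) (auto intro!: A_closed(1))
        show "(\<Sum>(u, v)\<leftarrow>ps. p ^ n * h j (b * f j * u) * (d * \<phi> v)) \<in> A" by (rule sum) (rule mem)
      qed
      finally show ?thesis .
    qed
    then show ?thesis using d(1) p(2) by (intro exI[of _ "p ^ n * d"]) simp
  qed
  show ?thesis
    unfolding lattice_def
  proof (intro conjI ballI allI impI)
    \<comment> \<open>The bound concerns multiples of \<Delta>, so it is applied to the functional
      that divides by \<Delta> before applying \<phi>.\<close>
    fix \<phi> assume "klinear \<phi>"
    then show "\<exists>c. c \<noteq> 0 \<and> (\<forall>m\<in>\<O>. c * \<phi> m \<in> A)"
      using bounded[OF klinear_mult[of \<phi> "inverse \<Delta>"]] \<Delta> by (simp add: mult.left_commute)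
  qed (use scale in \<open>auto intro: O_add O_mult simp: A_def\<close>)
qed

section \<open>Ultrametric sums, algebraic relations and the values of the base field\<close>

text \<open>The unique term of least value cannot be cancelled, because the ultrametric inequality
  gives the sum of the others a larger value.\<close>

lemma sum_nonzero_if_distinct_values:
  assumes "finite S" "S \<noteq> {}" "\<And>s. s \<in> S \<Longrightarrow> t s \<noteq> 0" "inj_on (\<lambda>s. w (t s)) S"
  shows "sum t S \<noteq> 0"
proof
  assume zero: "sum t S = 0"
  obtain s where s: "s \<in> S" "\<And>r. r \<in> S \<Longrightarrow> w (t s) \<le> w (t r)"
    using that[OF arg_min_if_finite(1)[OF assms(1,2)] arg_min_least[OF assms(1,2)]] .
  have "w (t s) < w (t r)" if "r \<in> S - {s}" for r
  proof -
    have "w (t s) \<noteq> w (t r)" using inj_onD[OF assms(4), of s r] s(1) that by auto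
    then show ?thesis using s(2)[of r] that by simp
  qed
  then have "sum t (S - {s}) \<in> {x. x = 0 \<or> w (t s) < w x}"
  proof (intro sum_mem_closed)
    fix x y assume "x \<in> {x. x = 0 \<or> w (t s) < w x}" "y \<in> {x. x = 0 \<or> w (t s) < w x}"
    then show "x + y \<in> {x. x = 0 \<or> w (t s) < w x}"
      using w_add[of x y] by (cases "x = 0"; cases "y = 0"; cases "x + y = 0") auto
  qed auto
  moreover have "sum t (S - {s}) = - t s"
    using zero sum.remove[OF assms(1) s(1), of t] by (simp add: eq_neg_iff_add_eq_0 add.commute)
  ultimately show False using assms(3)[OF s(1)] by auto
qed

lemma vector_space_extension: "vector_space (\<lambda>c x. i c * x)"
  by unfold_locales (auto simp: algebra_simps)

lemma algebraic_relation:
  assumes "finite E" "module.span (\<lambda>c x. i c * x) E = UNIV"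
  shows "\<exists>c. (\<exists>k\<le>card E. c k \<noteq> 0) \<and> (\<Sum>k\<le>card E. i (c k) * y ^ k) = 0"
proof -
  interpret V: vector_space "\<lambda>c x. i c * x" by (rule vector_space_extension)
  let ?n = "card E"
  show ?thesis
  proof (cases "inj_on (\<lambda>k. y ^ k) {..?n}")
    case True
    have "V.dependent ((\<lambda>k. y ^ k) ` {..?n})"
      using V.independent_span_bound[of E "(\<lambda>k. y ^ k) ` {..?n}"] assms card_image[OF True] by auto
    then obtain u where u: "\<exists>v\<in>(\<lambda>k. y ^ k) ` {..?n}. u v \<noteq> 0"
      "(\<Sum>v\<in>(\<lambda>k. y ^ k) ` {..?n}. i (u v) * v) = 0"
      using V.dependent_finite[of "(\<lambda>k. y ^ k) ` {..?n}"] by auto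
    then show ?thesis by (intro exI[of _ "\<lambda>k. u (y ^ k)"]) (auto simp: sum.reindex[OF True])
  next
    case False
    then obtain j k where jk: "j \<le> ?n" "k \<le> ?n" "j \<noteq> k" "y ^ j = y ^ k" by (auto simp: inj_on_def)
    \<comment> \<open>If two powers coincide, the set of powers is too small for the dimension
      count, but their difference is itself a relation.\<close>
    let ?c = "\<lambda>l. if l = j then 1 else if l = k then - 1 else 0 :: 'k"
    have "(\<Sum>l\<le>?n. i (?c l) * y ^ l) = (\<Sum>l\<in>{j, k}. i (?c l) * y ^ l)"
      using jk by (intro sum.mono_neutral_right) auto
    then show ?thesis using jk by (intro exI[of _ ?c]) auto
  qed
qed

text \<open>The values of \<open>K\<close> are dense if those of \<open>L\<close> are: in an algebraic relation of degree
  \<open>n\<close> for \<open>y\<close> two terms have the same value, so that \<open>m w(y)\<close> is a value of \<open>K\<close> for some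
  positive \<open>m \<le> n\<close>.\<close>

lemma dense_base_values:
  assumes E: "finite E" "module.span (\<lambda>c x. i c * x) E = UNIV"
    and dense: "\<And>r. r > 0 \<Longrightarrow> \<exists>y. y \<noteq> 0 \<and> 0 < w y \<and> w y < r" and r: "r > 0"
  shows "\<exists>a. a \<noteq> 0 \<and> 0 < w (i a) \<and> w (i a) < r"
proof -
  let ?n = "card E"
  \<comment> \<open>The difference of exponents found below is at most n, so the corresponding
    multiple of \<open>w y\<close> stays below r. The summand 1 keeps the divisor positive.\<close>
  obtain y where y: "y \<noteq> 0" "0 < w y" "w y < r / (real ?n + 1)" using dense[of "r / (real ?n + 1)"] r
    by auto
  obtain c where c: "\<exists>k\<le>?n. c k \<noteq> 0" "(\<Sum>k\<le>?n. i (c k) * y ^ k) = 0"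
    using algebraic_relation[OF E, of y] by blast
  define S where "S = {k. k \<le> ?n \<and> c k \<noteq> 0}"
  have "(\<Sum>k\<in>S. i (c k) * y ^ k) = (\<Sum>k\<le>?n. i (c k) * y ^ k)"
    by (intro sum.mono_neutral_left) (auto simp: S_def)
  then have "\<not> inj_on (\<lambda>k. w (i (c k) * y ^ k)) S"
    using sum_nonzero_if_distinct_values[of S "\<lambda>k. i (c k) * y ^ k"] c y by (auto simp: S_def)
  then obtain j k where jk: "j \<in> S" "k \<in> S" "j < k" "w (i (c j) * y ^ j) = w (i (c k) * y ^ k)"
    unfolding inj_on_def by (metis linorder_neqE_nat)
  then have "w (i (c j)) + j * w y = w (i (c k)) + k * w y" using y(1)
    by (simp add: S_def w_mult w_power)
  then have eq: "w (i (c j / c k)) = real (k - j) * w y"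
    using jk by (simp add: S_def w_divide of_nat_diff algebra_simps)
  have "real (k - j) * w y \<le> (real ?n + 1) * w y" using jk y(2)
    by (intro mult_right_mono) (auto simp: S_def)
  also have "\<dots> < r" using y(3) by (simp add: field_simps)
  finally show ?thesis using eq jk y(2) by (intro exI[of _ "c j / c k"]) (auto simp: S_def)
qed

lemma dual_basis_exists:
  assumes "finite E" "module.span (\<lambda>c x. i c * x) E = UNIV"
  shows "\<exists>n e g. dual_basis n e g"
proof -
  interpret V: vector_space "\<lambda>c x. i c * x" by (rule vector_space_extension)
  obtain B where B: "B \<subseteq> E" "V.independent B" "E \<subseteq> V.span B" using V.maximal_independent_subset by blast
  have fB: "finite B" using B(1) assms(1) finite_subset by blast
  have sB: "V.span B = UNIV" using V.span_mono[OF B(3)] assms(2)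
    by (simp add: V.span_span top.extremum_unique)
  obtain e where e: "bij_betw e {..<card B} B" using ex_bij_betw_nat_finite[OF fB]
    by (auto simp: atLeast0LessThan)
  have "dual_basis (card B) e (\<lambda>k x. V.representation B x (e k))"
    unfolding dual_basis_def klinear_def
  proof (intro conjI allI impI)
    fix k l assume "k < card B" "l < card B"
    then have "e l \<in> B" "e k = e l \<longleftrightarrow> k = l" using e by (auto simp: bij_betw_def inj_on_def)
    then show "V.representation B (e l) (e k) = (if k = l then 1 else 0)"
      by (simp add: V.representation_basis[OF B(2)])
  next
    fix x
    have "(\<Sum>k<card B. i (V.representation B x (e k)) * e k) = (\<Sum>b\<in>B. i (V.representation B x b) * b)"
      by (rule sum.reindex_bij_betw[OF e])
    then show "x = (\<Sum>k<card B. i (V.representation B x (e k)) * e k)"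
      using V.sum_representation_eq[OF B(2) _ fB order_refl, of x] sB by simp
  qed (use sB B(2) in \<open>auto simp: V.representation_add V.representation_scale\<close>)
  then show ?thesis by blast
qed


lemma i_of_nat [simp]: "i (of_nat n) = of_nat n"
  by (induction n) auto

lemma map_poly_hom:
  "map_poly i (p + q) = map_poly i p + map_poly i q"
  "map_poly i (p * q) = map_poly i p * map_poly i q"
  "map_poly i (pderiv p) = pderiv (map_poly i p)"
  by (auto intro!: poly_eqI simp: coeff_map_poly coeff_mult coeff_pderiv simp del: of_nat_Suc)

text \<open>If the derivative of p also vanished at x, a nonzero polynomial of least degree
  vanishing at x would divide both p and its derivative. It would then be a nonzero constant, which
  has no roots.\<close>

lemma separable_elementI:
  assumes p: "poly (map_poly i p) x = 0" and cop: "coprime p (pderiv p)"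
  shows "separable_element x"
proof -
  let ?ev = "\<lambda>q. poly (map_poly i q) x"
  have p0: "p \<noteq> 0"
  proof
    assume "p = 0"
    then have "is_unit (0 :: 'k poly)" using cop by simp
    then show False by simp
  qed
  obtain m where m: "m \<noteq> 0" "?ev m = 0" and min: "\<And>q. q \<noteq> 0 \<Longrightarrow> ?ev q = 0 \<Longrightarrow> degree m \<le> degree q"
    using arg_min_nat_lemma[of "\<lambda>q. q \<noteq> 0 \<and> ?ev q = 0" p degree] p p0 by blast
  have dvd: "m dvd q" if "?ev q = 0" for q
  proof -
    have "q = q div m * m + q mod m" by simp
    then have "?ev q = ?ev (q div m) * ?ev m + ?ev (q mod m)"
      by (metis map_poly_hom(1,2) poly_add poly_mult)
    then have "?ev (q mod m) = 0" using that m(2) by simp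
    then have "q mod m = 0" using min[of "q mod m"] degree_mod_less[OF m(1), of q] by force
    then show ?thesis by (simp add: mod_eq_0_iff_dvd)
  qed
  have "?ev (pderiv p) \<noteq> 0"
  proof
    assume "?ev (pderiv p) = 0"
    then have "is_unit m" using dvd p cop by (meson coprime_common_divisor)
    then obtain c where c: "m = [:c:]" by (auto simp: is_unit_poly_iff)
    then have "c \<noteq> 0" using m(1) by auto
    have "map_poly i m = [:i c:]"
      by (auto intro!: poly_eqI simp: c coeff_map_poly coeff_pCons split: nat.splits)
    then show False using m(2) \<open>c \<noteq> 0\<close> by simp
  qed
  moreover have "?ev (pderiv p) = (\<Sum>k\<le>degree p. of_nat k * i (coeff p k) * x ^ (k - 1))"
  proof -
    have "degree (map_poly i (pderiv p)) \<le> degree p"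
      by (intro degree_le) (simp add: coeff_map_poly coeff_pderiv coeff_eq_0)
    then have "?ev (pderiv p) = (\<Sum>k\<le>degree p. coeff (map_poly i (pderiv p)) k * x ^ k)"
      unfolding poly_altdef by (intro sum.mono_neutral_left) (auto simp: coeff_eq_0)
    also have "\<dots> = (\<Sum>k\<le>degree p. of_nat (Suc k) * i (coeff p (Suc k)) * x ^ k)"
      by (simp add: coeff_map_poly coeff_pderiv del: of_nat_Suc)
    also have "\<dots> = (\<Sum>k\<le>Suc (degree p). of_nat k * i (coeff p k) * x ^ (k - 1))"
      by (subst sum.atMost_Suc_shift) simp
    also have "\<dots> = (\<Sum>k\<le>degree p. of_nat k * i (coeff p k) * x ^ (k - 1))"
      by (simp add: coeff_eq_0)
    finally show ?thesis .
  qed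
  moreover have "?ev p = (\<Sum>k\<le>degree p. i (coeff p k) * x ^ k)"
  proof -
    have "degree (map_poly i p) \<le> degree p" by (intro degree_le) (simp add: coeff_map_poly coeff_eq_0)
    then have "?ev p = (\<Sum>k\<le>degree p. coeff (map_poly i p) k * x ^ k)"
      unfolding poly_altdef by (intro sum.mono_neutral_left) (auto simp: coeff_eq_0)
    then show ?thesis by (simp add: coeff_map_poly)
  qed
  ultimately show ?thesis using p unfolding separable_element_def
    by (intro exI[of _ "degree p"] exI[of _ "coeff p"]) simp
qed

section \<open>Divisibility by high powers and almost bases of the valuation ring\<close>

text \<open>A substitute for an N-th root: density provides an \<eta> of value below
  \<open>w (i \<epsilon>) / N\<close>, so that \<open>\<eta> ^ N\<close> divides \<epsilon>. This
  absorbs every loss whose exponent is fixed in advance.\<close>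

lemma almost_root:
  assumes dense: "\<And>r. r > 0 \<Longrightarrow> \<exists>a. a \<noteq> 0 \<and> 0 < w (i a) \<and> w (i a) < r"
    and \<epsilon>: "\<epsilon> \<in> \<mm>" and N: "0 < (N::nat)"
  shows "\<exists>\<eta>\<in>\<mm>. \<exists>c\<in>A. \<epsilon> = c * \<eta> ^ N \<and> (\<epsilon> \<noteq> 0 \<longrightarrow> \<eta> \<noteq> 0)"
proof (cases "\<epsilon> = 0")
  case True
  then show ?thesis using \<epsilon> by (intro bexI[of _ 0]) auto
next
  case False
  then have pos: "0 < w (i \<epsilon>) / N" using \<epsilon> N by (auto simp: \<mm>_def)
  obtain \<eta> where \<eta>: "\<eta> \<noteq> 0" "0 < w (i \<eta>)" "w (i \<eta>) < w (i \<epsilon>) / N" using dense[OF pos] by blast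
  have "N * w (i \<eta>) \<le> w (i \<epsilon>)" using \<eta>(3) N by (simp add: field_simps)
  then have "\<epsilon> / \<eta> ^ N \<in> A" using False \<eta>(1) by (simp add: A_iff w_divide w_power)
  then show ?thesis using \<eta> by (intro bexI[of _ \<eta>] bexI[of _ "\<epsilon> / \<eta> ^ N"]) (auto simp: \<mm>_def)
qed

lemma scale_into_O:
  assumes p: "p \<in> \<mm>" "p \<noteq> 0"
  shows "\<exists>c. c \<noteq> 0 \<and> i c * x \<in> \<O>"
proof (cases "x = 0")
  case False
  have pos: "0 < w (i p)" using p by (auto simp: \<mm>_def)
  obtain k :: nat where k: "- w x < k * w (i p)" using reals_Archimedean3[OF pos] by blast
  then have "i (p ^ k) * x \<in> \<O>" using False p by (auto simp: \<O>_def w_mult w_power)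
  then show ?thesis using p by (intro exI[of _ "p ^ k"]) auto
qed (auto intro: exI[of _ 1])

lemma almost_dual_basis:
  assumes dense: "\<And>r. r > 0 \<Longrightarrow> \<exists>a. a \<noteq> 0 \<and> 0 < w (i a) \<and> w (i a) < r"
    and e: "dual_basis n e g0" and lat: "lattice \<O>" and \<epsilon>: "\<epsilon> \<in> \<mm>"
  shows "\<exists>f g. dual_basis n f g \<and> (\<forall>k<n. f k \<in> \<O>) \<and> (\<forall>k<n. \<forall>b\<in>\<O>. \<epsilon> * g k b \<in> A)"
proof -
  \<comment> \<open>The power \<open>p ^ n\<close> pays for \<open>lattice_almost_basis\<close>. The
    exponent \<open>Suc n\<close> is positive also for n = 0 and leaves a spare p in the
    coefficient. For \<epsilon> = 0, a nonzero p in \<mm> is taken with c = 0.\<close>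
  obtain p c where p: "p \<in> \<mm>" "p \<noteq> 0" and c: "c \<in> A" "\<epsilon> = c * p ^ Suc n"
  proof (cases "\<epsilon> = 0")
    case True
    obtain a where "a \<noteq> 0" "0 < w (i a)" using dense[of 1] by auto
    then show ?thesis using that[of a 0] True by (auto simp: \<mm>_def)
  next
    case False
    then show ?thesis using almost_root[OF dense \<epsilon>, of "Suc n"] that by blast
  qed
  obtain f g where fg: "dual_basis n f g" "\<forall>k<n. f k \<in> \<O>" "\<And>k m. k < n \<Longrightarrow> m \<in> \<O> \<Longrightarrow> p ^ n * g k m \<in> A"
    using lattice_almost_basis[OF lat e p] by blast
  have "\<epsilon> * g k b \<in> A" if "k < n" "b \<in> \<O>" for k b
  proof -
    have "(c * p) * (p ^ n * g k b) \<in> A"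
      using c(1) p(1) m_subset_A by (intro A_closed(2)[OF A_closed(2)] fg(3) that) auto
    then show ?thesis by (simp add: c(2) mult_ac)
  qed
  then show ?thesis using fg(1,2) by blast
qed

end

text \<open>A subgroup of the reals without arbitrarily small positive elements is generated by its least
  positive element.\<close>

lemma dense_values:
  assumes v: "valuation v" and nt: "value_group v \<noteq> {0}" and nd: "nondiscrete v"
    and mono: "strict_mono_on (value_group v) h"
    and hom: "\<And>a b. a \<in> value_group v \<Longrightarrow> b \<in> value_group v \<Longrightarrow> h (a + b)
      = h a + h b" and r: "(r::real) > 0"
  shows "\<exists>y. y \<noteq> 0 \<and> 0 < h (v y) \<and> h (v y) < r"
proof (rule ccontr)
  assume no: "\<not> ?thesis"
  let ?V = "value_group v"
  have vm: "v (x * y) = v x + v y" if "x \<noteq> 0" "y \<noteq> 0" for x y using v that unfolding valuation_def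
    by blast
  have mem: "v x \<in> ?V" if "x \<noteq> 0" for x using that by (auto simp: value_group_def)
  have zero: "0 \<in> ?V" using mem[of 1] valuation_one[OF v] by simp
  have h0: "h 0 = 0" using hom[OF zero zero] by simp
  have add: "a + b \<in> ?V" if ab: "a \<in> ?V" "b \<in> ?V" for a b
  proof -
    obtain x y where "x \<noteq> 0" "y \<noteq> 0" "a = v x" "b = v y" using ab by (auto simp: value_group_def)
    then show ?thesis using mem[of "x * y"] vm[of x y] by simp
  qed
  have neg: "- a \<in> ?V" if a: "a \<in> ?V" for a
  proof -
    obtain x where "x \<noteq> 0" "a = v x" using a by (auto simp: value_group_def)
    then show ?thesis using mem[of "inverse x"] valuation_inverse[OF v, of x] by simp
  qed
  have hneg: "h (- a) = - h a" if "a \<in> ?V" for a using hom[OF that neg[OF that]] h0 by simp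
  have inj: "a = b" if "a \<in> ?V" "b \<in> ?V" "h a = h b" for a b
    using strict_mono_on_imp_inj_on[OF mono] that by (auto simp: inj_on_def)
  define P where "P = h ` ?V \<inter> {0<..}"
  have P_ge: "r \<le> s" if "s \<in> P" for s
    using that no by (fastforce simp: P_def value_group_def)
  obtain a where a: "a \<in> ?V" "a \<noteq> 0" using nt zero by auto
  then have "h a \<noteq> 0" using inj[OF a(1) zero] h0 by auto
  then have "P \<noteq> {}" using a neg hneg by (cases "h a > 0") (force simp: P_def image_iff)+
  have bdd: "bdd_below P" using P_ge by (auto simp: bdd_below_def)
  obtain g where g: "g \<in> P" "g < Inf P + r"
    using cInf_lessD[OF \<open>P \<noteq> {}\<close>, of "Inf P + r"] r by auto
  have diff: "s - t \<in> h ` ?V" if st: "s \<in> h ` ?V" "t \<in> h ` ?V" for s t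
  proof -
    obtain a b where ab: "a \<in> ?V" "b \<in> ?V" "s = h a" "t = h b" using st by auto
    then have "s - t = h (a + - b)" using hom[OF ab(1) neg[OF ab(2)]] hneg by simp
    then show ?thesis using add[OF ab(1) neg[OF ab(2)]] by blast
  qed
  \<comment> \<open>As g lies within r of the infimum, a smaller positive value s would yield the
    positive value g - s below r.\<close>
  have g_min: "g \<le> s" if s: "s \<in> P" for s
  proof (rule ccontr)
    assume "\<not> g \<le> s"
    then have "g - s \<in> P" using diff[of g s] g(1) s by (auto simp: P_def)
    then have "r \<le> g - s" by (rule P_ge)
    moreover have "Inf P \<le> s" using s bdd by (rule cInf_lower)
    ultimately show False using g(2) by simp
  qed
  have g0: "g > 0" using g(1) by (auto simp: P_def)
  have multiple: "of_int k * g \<in> h ` ?V" for k :: int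
  proof -
    have n: "real n * g \<in> h ` ?V" for n :: nat
    proof (induction n)
      case 0
      then show ?case using zero h0 by force
    next
      case (Suc n)
      have "real n * g - (0 - g) \<in> h ` ?V" using Suc g(1) zero h0 by (intro diff) (force simp: P_def)+
      then show ?case by (simp add: algebra_simps)
    qed
    show ?thesis
    proof (cases "k \<ge> 0")
      case True
      then show ?thesis using n[of "nat k"] by simp
    next
      case False
      have "0 - real (nat (- k)) * g \<in> h ` ?V" using n zero h0 by (intro diff) force+
      then show ?thesis using False by simp
    qed
  qed
  \<comment> \<open>The remainder of \<open>h a\<close> modulo g is again a value and lies between 0
    and g, so it is 0 by minimality. The quotient then identifies the value group with the
    integers.\<close>
  define H where "H a = \<lfloor>h a / g\<rfloor>" for a
  have H: "h a = of_int (H a) * g" if "a \<in> ?V" for a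
  proof (rule ccontr)
    assume ne: "h a \<noteq> of_int (H a) * g"
    have "of_int (H a) \<le> h a / g" "h a / g < of_int (H a) + 1" unfolding H_def by linarith+
    then have bounds: "of_int (H a) * g \<le> h a" "h a < of_int (H a) * g + g"
      using g0 by (simp_all add: field_simps)
    have "h a - of_int (H a) * g \<in> h ` ?V" using that multiple by (intro diff) auto
    then have "h a - of_int (H a) * g \<in> P" using ne bounds by (simp add: P_def)
    then show False using g_min bounds by fastforce
  qed
  have "bij_betw H ?V UNIV"
  proof (rule bij_betwI')
    fix a b assume ab: "a \<in> ?V" "b \<in> ?V"
    show "H a = H b \<longleftrightarrow> a = b"
    proof
      assume "H a = H b"
      then show "a = b" using ab by (intro inj) (simp_all add: H)
    qed simp
  next
    fix k :: int
    obtain a where "a \<in> ?V" "of_int k * g = h a" using multiple[of k] by auto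
    then show "\<exists>a\<in>?V. k = H a" using H[of a] g0 by auto
  qed simp
  moreover have "H (a + b) = H a + H b" if "a \<in> ?V" "b \<in> ?V" for a b
  proof -
    have "of_int (H (a + b)) * g = of_int (H a + H b) * g"
      using H[OF that(1)] H[OF that(2)] H[OF add[OF that]] hom[OF that] by (simp add: distrib_right)
    then show ?thesis using g0 by (simp del: of_int_add)
  qed
  ultimately show False using nd unfolding nondiscrete_def by blast
qed

section \<open>Almost projective modules\<close>

text \<open>Unlike in \<open>module_hom\<close>, values outside the carrier are free, so composites
  and explicit formulas need no restriction.\<close>

definition module_linear ::
  "('a, 'c) ring_scheme \<Rightarrow> ('a, 'm) module \<Rightarrow> ('a, 'n) module \<Rightarrow> ('m \<Rightarrow> 'n) \<Rightarrow> bool" where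
  "module_linear A M N h \<longleftrightarrow> (\<forall>x\<in>carrier M. h x \<in> carrier N) \<and>
     (\<forall>x\<in>carrier M. \<forall>y\<in>carrier M. h (x \<oplus>\<^bsub>M\<^esub> y) = h x \<oplus>\<^bsub>N\<^esub> h y) \<and>
     (\<forall>a\<in>carrier A. \<forall>x\<in>carrier M. h (a \<odot>\<^bsub>M\<^esub> x) = a \<odot>\<^bsub>N\<^esub> h x)"

lemma module_linearD:
  assumes "module_linear A M N h"
  shows "x \<in> carrier M \<Longrightarrow> h x \<in> carrier N"
    and "x \<in> carrier M \<Longrightarrow> y \<in> carrier M \<Longrightarrow> h (x \<oplus>\<^bsub>M\<^esub> y) = h x \<oplus>\<^bsub>N\<^esub> h y"
    and "a \<in> carrier A \<Longrightarrow> x \<in> carrier M \<Longrightarrow> h (a \<odot>\<^bsub>M\<^esub> x) = a \<odot>\<^bsub>N\<^esub> h x"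
  using assms by (auto simp: module_linear_def)

lemma module_linearD':
  assumes "Module.module A M" "Module.module A N" "module_linear A M N h"
  shows "h \<zero>\<^bsub>M\<^esub> = \<zero>\<^bsub>N\<^esub>" and "x \<in> carrier M \<Longrightarrow> h (\<ominus>\<^bsub>M\<^esub> x) = \<ominus>\<^bsub>N\<^esub> h x"
    and "x \<in> carrier M \<Longrightarrow> y \<in> carrier M \<Longrightarrow> h (x \<ominus>\<^bsub>M\<^esub> y) = h x \<ominus>\<^bsub>N\<^esub> h y"
proof -
  interpret M: Module.module A M by fact
  note D = module_linearD[OF assms(3)]
  show "h \<zero>\<^bsub>M\<^esub> = \<zero>\<^bsub>N\<^esub>"
    by (rule linear_zero_neg(1)[where A = A, OF assms(1,2)]) (use D in auto)
  show n: "h (\<ominus>\<^bsub>M\<^esub> x) = \<ominus>\<^bsub>N\<^esub> h x" if "x \<in> carrier M" for x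
    by (rule linear_zero_neg(2)[where A = A, OF assms(1,2)]) (use D that in auto)
  show "h (x \<ominus>\<^bsub>M\<^esub> y) = h x \<ominus>\<^bsub>N\<^esub> h y" if "x \<in> carrier M" "y \<in> carrier M"
    using that by (simp add: a_minus_def n module_linearD(2)[OF assms(3)])
qed

lemma module_hom_linear: "h \<in> module_hom A M N \<Longrightarrow> module_linear A M N h"
  by (auto simp: module_hom_def module_linear_def)

lemma restrict_module_hom:
  assumes "Module.module A M" "module_linear A M N h"
  shows "restrict h (carrier M) \<in> module_hom A M N"
proof -
  interpret M: Module.module A M by fact
  show ?thesis using module_linearD[OF assms(2)] by (auto simp: module_hom_def)
qed

lemma module_linear_comp:
  assumes "module_linear A M N h" "module_linear A N P k"
  shows "module_linear A M P (\<lambda>x. k (h x))"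
  using assms by (auto simp: module_linear_def)

lemma kernel_submodule_linear:
  assumes "Module.module A M" "Module.module A N" "module_linear A M N h"
  shows "submodule (a_kernel M N h) A M"
  by (rule kernel_submodule[OF assms(1,2) module_linearD[OF assms(3)]])

lemma (in abelian_group) eq_if_minus_eq_zero:
  assumes "x \<ominus> y = \<zero>" "x \<in> carrier G" "y \<in> carrier G"
  shows "x = y"
proof -
  have "x = (x \<ominus> y) \<oplus> y" using assms(2,3) by (simp add: a_minus_def a_assoc l_neg)
  then show ?thesis using assms by simp
qed

section \<open>Restriction of scalars and free modules\<close>

lemma self_algebra_module: assumes "cring A" shows "Module.module A (self_algebra A)"
proof -
  interpret A: cring A by fact
  have neg: "\<exists>y\<in>carrier A. y \<oplus>\<^bsub>A\<^esub> x = \<zero>\<^bsub>A\<^esub>" if "x \<in> carrier A" for x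
    using A.l_neg[OF that] A.a_inv_closed[OF that] by blast
  show ?thesis
  proof (rule moduleI)
    show "abelian_group (self_algebra A)"
      by (rule abelian_groupI) (auto simp: self_algebra_def A.a_ac neg)
  qed (auto simp: self_algebra_def assms A.l_distr A.r_distr A.m_assoc)
qed

lemma restrict_scalars_module:
  assumes "ring_hom_cring A B f" "Module.module B M"
  shows "Module.module A (restrict_scalars f M)"
proof -
  interpret f: ring_hom_cring A B f by fact
  interpret M: Module.module B M by fact
  have neg: "\<exists>y\<in>carrier M. y \<oplus>\<^bsub>M\<^esub> x = \<zero>\<^bsub>M\<^esub>" if "x \<in> carrier M" for x
    using M.l_neg[OF that] M.a_inv_closed[OF that] by blast
  show ?thesis
  proof (rule moduleI)
    show "abelian_group (restrict_scalars f M)"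
      by (rule abelian_groupI) (auto simp: restrict_scalars_def M.a_ac neg)
  qed (auto simp: restrict_scalars_def f.R.cring_axioms M.smult_l_distr M.smult_r_distr M.smult_assoc1)
qed

lemma free_module_simps:
  "f \<in> carrier (free_module A Y) \<longleftrightarrow>
     range f \<subseteq> carrier A \<and> (\<forall>x. x \<notin> Y \<longrightarrow> f x = \<zero>\<^bsub>A\<^esub>) \<and> finite {x. f x \<noteq> \<zero>\<^bsub>A\<^esub>}"
  "\<zero>\<^bsub>free_module A Y\<^esub> = (\<lambda>x. \<zero>\<^bsub>A\<^esub>)"
  "f \<oplus>\<^bsub>free_module A Y\<^esub> g = (\<lambda>x. f x \<oplus>\<^bsub>A\<^esub> g x)"
  "a \<odot>\<^bsub>free_module A Y\<^esub> f = (\<lambda>x. a \<otimes>\<^bsub>A\<^esub> f x)"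
  by (auto simp: free_module_def)

lemma free_gen_closed:
  assumes "cring A" "y \<in> Y" shows "free_gen A y \<in> carrier (free_module A Y)"
proof -
  interpret A: cring A by fact
  have "{x. free_gen A y x \<noteq> \<zero>\<^bsub>A\<^esub>} \<subseteq> {y}" by (auto simp: free_gen_def)
  then have "finite {x. free_gen A y x \<noteq> \<zero>\<^bsub>A\<^esub>}" by (rule finite_subset) simp
  then show ?thesis using assms(2) by (auto simp: free_module_simps free_gen_def)
qed

lemma free_module_induct [consumes 2, case_names zero add gen]:
  assumes A: "cring A" and f: "f \<in> carrier (free_module A Y)"
    and zero: "P \<zero>\<^bsub>free_module A Y\<^esub>"
    and add: "\<And>f g. f \<in> carrier (free_module A Y) \<Longrightarrow> g \<in> carrier (free_module A Y) \<Longrightarrow>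
      P f \<Longrightarrow> P g \<Longrightarrow> P (f \<oplus>\<^bsub>free_module A Y\<^esub> g)"
    and gen: "\<And>a y. a \<in> carrier A \<Longrightarrow> y \<in> Y \<Longrightarrow> P (a \<odot>\<^bsub>free_module A Y\<^esub> free_gen A y)"
  shows "P f"
proof -
  interpret A: cring A by fact
  interpret F: Module.module A "free_module A Y" by (rule free_module_module[OF A])
  have "P f" if "finite S" "f \<in> carrier (free_module A Y)" "{x. f x \<noteq> \<zero>\<^bsub>A\<^esub>} \<subseteq> S" for S f
    using that
  proof (induction S arbitrary: f rule: finite_induct)
    case empty
    then have "f = \<zero>\<^bsub>free_module A Y\<^esub>" by (auto simp: free_module_simps)
    then show ?case using zero by simp
  next
    case (insert y S)
    have fA: "f x \<in> carrier A" for x using insert.prems by (auto simp: free_module_simps)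
    show ?case
    proof (cases "y \<in> Y")
      case False
      then have "f y = \<zero>\<^bsub>A\<^esub>" using insert.prems by (auto simp: free_module_simps)
      then show ?thesis using insert.prems by (intro insert.IH) auto
    next
      case True
      let ?g = "f(y := \<zero>\<^bsub>A\<^esub>)"
      have "{x. ?g x \<noteq> \<zero>\<^bsub>A\<^esub>} \<subseteq> {x. f x \<noteq> \<zero>\<^bsub>A\<^esub>}" by auto
      then have g: "?g \<in> carrier (free_module A Y)"
        using insert.prems fA by (auto simp: free_module_simps intro: finite_subset)
      then have "P ?g" using insert.prems(2) by (intro insert.IH[OF g]) auto
      moreover have "f = ?g \<oplus>\<^bsub>free_module A Y\<^esub> (f y \<odot>\<^bsub>free_module A Y\<^esub> free_gen A y)"
        using fA by (auto simp: free_module_simps free_gen_def)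
      ultimately show ?thesis
        using add[OF g _ _ gen[OF fA True], of y] fA free_gen_closed[OF A True] by simp
    qed
  qed
  then show ?thesis using f by (auto simp: free_module_simps)
qed

lemma free_lift_free_gen:
  assumes "Module.module A M" "\<phi> y \<in> carrier M"
  shows "free_lift A M \<phi> (free_gen A y) = \<phi> y"
proof -
  interpret M: Module.module A M by fact
  show ?thesis
  proof (cases "\<one>\<^bsub>A\<^esub> = \<zero>\<^bsub>A\<^esub>")
    case True
    \<comment> \<open>Over the zero ring a generator has empty support, so its lift is the empty
      sum; every element of M is zero.\<close>
    then have "\<phi> y = \<zero>\<^bsub>M\<^esub>" using M.smult_one[OF assms(2)] M.smult_l_null[OF assms(2)] by simp
    moreover have "{x. free_gen A y x \<noteq> \<zero>\<^bsub>A\<^esub>} = {}" using True by (auto simp: free_gen_def)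
    ultimately show ?thesis by (simp add: free_lift_def)
  next
    case False
    then have "{x. free_gen A y x \<noteq> \<zero>\<^bsub>A\<^esub>} = {y}" by (auto simp: free_gen_def)
    then show ?thesis using assms(2) by (simp add: free_lift_def) (simp add: free_gen_def)
  qed
qed

lemma free_lift_module_linear:
  assumes "Module.module A M" "\<And>y. y \<in> Y \<Longrightarrow> \<phi> y \<in> carrier M"
  shows "module_linear A (free_module A Y) M (free_lift A M \<phi>)"
  using free_lift_linear[OF assms, where Y = Y] by (simp add: module_linear_def)

lemma linear_free_ext:
  assumes N: "Module.module A N"
    and g: "module_linear A (free_module A Y) N g" and h: "module_linear A (free_module A Y) N h"
    and eq: "\<And>y. y \<in> Y \<Longrightarrow> g (free_gen A y) = h (free_gen A y)" and f: "f \<in> carrier (free_module A Y)"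
  shows "g f = h f"
proof -
  interpret N: Module.module A N by fact
  note A = N.R.cring_axioms
  note F = free_module_module[OF A, of Y]
  from A f show ?thesis
  proof (induction rule: free_module_induct)
    case zero
    then show ?case using module_linearD'(1)[OF F N] g h by metis
  next
    case (add f1 f2)
    then show ?case using module_linearD(2)[OF g] module_linearD(2)[OF h] by simp
  next
    case (gen a y)
    have c: "free_gen A y \<in> carrier (free_module A Y)" by (rule free_gen_closed[OF A gen(2)])
    show ?case
      using module_linearD(3)[OF g gen(1) c] module_linearD(3)[OF h gen(1) c] eq[OF gen(2)] by simp
  qed
qed

text \<open>Since \<open>free_cover A M\<close> is free, \<open>M\<close> is almost projective if and only if multiplication by each
  \<open>\<epsilon>\<close> lifts to the free cover.\<close>

lemma almost_projective_iff:
  fixes A :: "('a, 'c) ring_scheme" and M :: "('a, 'm) module"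
  assumes M: "Module.module A M" and u: "u ` I \<subseteq> carrier A"
  shows "almost_projective I u A M \<longleftrightarrow>
    (\<forall>\<epsilon>\<in>I. \<exists>s. module_linear A M (free_cover A M) s \<and>
      (\<forall>x\<in>carrier M. free_lift A M (\<lambda>x. x) (s x) = u \<epsilon> \<odot>\<^bsub>M\<^esub> x))" (is "_ \<longleftrightarrow> ?R")
proof -
  interpret M: Module.module A M by fact
  let ?F = "free_cover A M" and ?p = "free_lift A M (\<lambda>x. x)"
  define K where "K = a_kernel ?F M ?p"
  have F: "Module.module A ?F" unfolding free_cover_def
    by (rule free_module_module[OF M.R.cring_axioms])
  interpret F: Module.module A ?F by fact
  have p: "module_linear A ?F M ?p" unfolding free_cover_def by (rule free_lift_module_linear[OF M])
  have K: "submodule K A ?F" unfolding K_def by (rule kernel_submodule_linear[OF F M p])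
  have fck: "free_cover_kernel A M = ?F\<lparr>carrier := K\<rparr>" by (simp add: free_cover_kernel_def K_def)
  have KM: "Module.module A (?F\<lparr>carrier := K\<rparr>)" by (rule submodule.submodule_is_module[OF K F])
  have KF: "x \<in> K \<longleftrightarrow> x \<in> carrier ?F \<and> ?p x = \<zero>\<^bsub>M\<^esub>" for x by (auto simp: K_def a_kernel_def')
  have gen: "free_gen A x \<in> carrier ?F" "?p (free_gen A x) = x" if "x \<in> carrier M" for x
    using that free_gen_closed[OF M.R.cring_axioms]
      by (auto simp: free_cover_def free_lift_free_gen[OF M])
  have iff: "almost_zero I (restrict_scalars u (Ext1 A M N)) \<longleftrightarrow>
      (\<forall>\<epsilon>\<in>I. \<forall>\<phi>\<in>module_hom A (?F\<lparr>carrier := K\<rparr>) N.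
         (\<lambda>x\<in>K. u \<epsilon> \<odot>\<^bsub>N\<^esub> \<phi> x) \<in> (\<lambda>h. restrict h K) ` module_hom A ?F N)"
    if N: "Module.module A N" for N :: "('a, 'm \<Rightarrow> 'a) module"
  proof -
    have r: "annihilated_by \<epsilon> (restrict_scalars u E) \<longleftrightarrow> annihilated_by (u \<epsilon>) E"
      for \<epsilon> and E :: "('a, 'q) module"
      by (simp add: annihilated_by_def restrict_scalars_def)
    have "annihilated_by (u \<epsilon>) (Ext1 A M N) \<longleftrightarrow>
       (\<forall>\<phi>\<in>module_hom A (?F\<lparr>carrier := K\<rparr>) N.
         (\<lambda>x\<in>K. u \<epsilon> \<odot>\<^bsub>N\<^esub> \<phi> x) \<in> (\<lambda>h. restrict h K) ` module_hom A ?F N)"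
      if "\<epsilon> \<in> I" for \<epsilon>
      unfolding Ext1_def fck
      using annihilated_by_quotient_iff[OF hom_module_module[OF KM N]
              restriction_submodule[OF F K N], of "u \<epsilon>"] u that
      by (simp add: hom_module_def image_subset_iff)
    then show ?thesis by (simp add: almost_zero_def r)
  qed
  show ?thesis
  proof
    assume "almost_projective I u A M"
    then have "almost_zero I (restrict_scalars u (Ext1 A M (?F\<lparr>carrier := K\<rparr>)))"
      using KM by (simp add: almost_projective_def)
    note univ = this[unfolded iff[OF KM], rule_format]
    \<comment> \<open>The universal class: the test module is the kernel K itself and the
      homomorphism is the identity. Its multiple by \<epsilon> then extends to a map \<psi> on the
      free cover.\<close>
    have id: "(\<lambda>x\<in>K. x) \<in> module_hom A (?F\<lparr>carrier := K\<rparr>) (?F\<lparr>carrier := K\<rparr>)"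
      using F.submoduleE[OF K] by (auto simp: module_hom_def)
    show ?R
    proof
      fix \<epsilon> assume e: "\<epsilon> \<in> I"
      then have ue: "u \<epsilon> \<in> carrier A" using u by auto
      obtain \<psi> where \<psi>: "\<psi> \<in> module_hom A ?F (?F\<lparr>carrier := K\<rparr>)"
        and eq: "(\<lambda>x\<in>K. u \<epsilon> \<odot>\<^bsub>?F\<lparr>carrier := K\<rparr>\<^esub> (\<lambda>x\<in>K. x) x) = restrict \<psi> K"
        using univ[OF e id] by blast
      note \<psi>D = module_homD[OF \<psi>, simplified]
      have \<psi>K: "\<psi> x = u \<epsilon> \<odot>\<^bsub>?F\<^esub> x" if "x \<in> K" for x using fun_cong[OF eq, of x] that by simp
      have \<psi>F: "\<psi> x \<in> carrier ?F" if "x \<in> carrier ?F" for x using \<psi>D(1)[OF that] KF by simp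
      \<comment> \<open>On K the map \<psi> is multiplication by \<epsilon>, so q vanishes there and
        depends only on the image in M. Hence \<open>q (free_gen A x)\<close> is linear in x
        although \<open>free_gen A x\<close> is not.\<close>
      define q where "q x = u \<epsilon> \<odot>\<^bsub>?F\<^esub> x \<ominus>\<^bsub>?F\<^esub> \<psi> x" for x
      have q: "module_linear A ?F ?F q"
        unfolding module_linear_def
      proof (intro conjI ballI)
        fix x y assume x: "x \<in> carrier ?F" and y: "y \<in> carrier ?F"
        then show "q (x \<oplus>\<^bsub>?F\<^esub> y) = q x \<oplus>\<^bsub>?F\<^esub> q y"
          using \<psi>F ue by (simp add: q_def \<psi>D F.smult_r_distr a_minus_def F.minus_add F.a_ac)
      next
        fix a x assume a: "a \<in> carrier A" and x: "x \<in> carrier ?F"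
        have "u \<epsilon> \<odot>\<^bsub>?F\<^esub> (a \<odot>\<^bsub>?F\<^esub> x) = a \<odot>\<^bsub>?F\<^esub> (u \<epsilon> \<odot>\<^bsub>?F\<^esub> x)"
          using a x ue by (simp flip: F.smult_assoc1 add: M.R.m_comm)
        then show "q (a \<odot>\<^bsub>?F\<^esub> x) = a \<odot>\<^bsub>?F\<^esub> q x"
          using a x \<psi>F ue by (simp add: q_def \<psi>D F.smult_r_distr F.smult_r_minus a_minus_def)
      qed (use \<psi>F ue in \<open>simp add: q_def\<close>)
      have qK: "q x = \<zero>\<^bsub>?F\<^esub>" if "x \<in> K" for x
        using that ue KF by (simp add: q_def \<psi>K a_minus_def F.r_neg)
      have q_eq: "q x = q y" if "x \<in> carrier ?F" "y \<in> carrier ?F" "?p x = ?p y" for x y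
      proof -
        have xy: "x \<ominus>\<^bsub>?F\<^esub> y \<in> K"
          unfolding KF module_linearD'(3)[OF F M p that(1,2)]
          using that by (simp add: module_linearD(1)[OF p] a_minus_def M.r_neg)
        have "q x \<ominus>\<^bsub>?F\<^esub> q y = \<zero>\<^bsub>?F\<^esub>"
          using qK[OF xy] by (simp only: module_linearD'(3)[OF F F q that(1,2)])
        then show ?thesis by (rule F.eq_if_minus_eq_zero) (use that
          in \<open>auto intro: module_linearD(1)[OF q]\<close>)
      qed
      show "\<exists>s. module_linear A M ?F s \<and> (\<forall>x\<in>carrier M. ?p (s x) = u \<epsilon> \<odot>\<^bsub>M\<^esub> x)"
      proof (intro exI[of _ "\<lambda>x. q (free_gen A x)"] conjI ballI)
        show "module_linear A M ?F (\<lambda>x. q (free_gen A x))"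
          unfolding module_linear_def
        proof (intro conjI ballI)
          fix x y assume xy: "x \<in> carrier M" "y \<in> carrier M"
          have "q (free_gen A (x \<oplus>\<^bsub>M\<^esub> y)) = q (free_gen A x \<oplus>\<^bsub>?F\<^esub> free_gen A y)"
            using xy gen by (intro q_eq) (simp_all add: module_linearD(2)[OF p])
          then show "q (free_gen A (x \<oplus>\<^bsub>M\<^esub> y)) = q (free_gen A x) \<oplus>\<^bsub>?F\<^esub> q (free_gen A y)"
            using xy gen by (simp add: module_linearD(2)[OF q])
        next
          fix a x assume ax: "a \<in> carrier A" "x \<in> carrier M"
          have "q (free_gen A (a \<odot>\<^bsub>M\<^esub> x)) = q (a \<odot>\<^bsub>?F\<^esub> free_gen A x)"
            using ax gen by (intro q_eq) (simp_all add: module_linearD(3)[OF p])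
          then show "q (free_gen A (a \<odot>\<^bsub>M\<^esub> x)) = a \<odot>\<^bsub>?F\<^esub> q (free_gen A x)"
            using ax gen by (simp add: module_linearD(3)[OF q])
        qed (use gen module_linearD(1)[OF q] in simp)
        fix x assume x: "x \<in> carrier M"
        have "?p (\<psi> (free_gen A x)) = \<zero>\<^bsub>M\<^esub>" using \<psi>D(1)[OF gen(1)[OF x]] KF by simp
        moreover have "?p (q (free_gen A x)) = ?p (u \<epsilon> \<odot>\<^bsub>?F\<^esub> free_gen A x) \<ominus>\<^bsub>M\<^esub> ?p (\<psi> (free_gen A x))"
          unfolding q_def by (rule module_linearD'(3)[OF F M p]) (use x gen ue \<psi>F in auto)
        ultimately show "?p (q (free_gen A x)) = u \<epsilon> \<odot>\<^bsub>M\<^esub> x"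
          using x gen ue by (simp add: module_linearD(3)[OF p] a_minus_def)
      qed
    qed
  next
    assume R: ?R
    show "almost_projective I u A M"
      unfolding almost_projective_def
    proof (intro allI impI)
      fix N :: "('a, 'm \<Rightarrow> 'a) module" assume N: "Module.module A N"
      interpret N: Module.module A N by fact
      show "almost_zero I (restrict_scalars u (Ext1 A M N))"
        unfolding iff[OF N]
      proof (intro ballI)
        fix \<epsilon> \<phi> assume e: "\<epsilon> \<in> I" and \<phi>: "\<phi> \<in> module_hom A (?F\<lparr>carrier := K\<rparr>) N"
        have ue: "u \<epsilon> \<in> carrier A" using u e by auto
        obtain s where s: "module_linear A M ?F s" "\<And>x. x \<in> carrier M \<Longrightarrow> ?p (s x) = u \<epsilon> \<odot>\<^bsub>M\<^esub> x"
          using R e by blast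
        note \<phi>D = module_homD[OF \<phi>, simplified]
        have sp: "module_linear A ?F ?F (\<lambda>f. s (?p f))" by (rule module_linear_comp[OF p s(1)])
        \<comment> \<open>Since s lifts multiplication by \<epsilon>, q takes values in K. On K it
          is multiplication by \<epsilon>, because the projection vanishes there. So \<phi> composed
          with q extends \<epsilon> \<phi>.\<close>
        define q where "q f = u \<epsilon> \<odot>\<^bsub>?F\<^esub> f \<ominus>\<^bsub>?F\<^esub> s (?p f)" for f
        have spF: "s (?p f) \<in> carrier ?F" if "f \<in> carrier ?F" for f
          using module_linearD(1)[OF sp that] .
        have q: "module_linear A ?F (?F\<lparr>carrier := K\<rparr>) q"
          unfolding module_linear_def
        proof (intro conjI ballI)
          fix x y assume x: "x \<in> carrier ?F" and y: "y \<in> carrier ?F"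
          then show "q (x \<oplus>\<^bsub>?F\<^esub> y) = q x \<oplus>\<^bsub>?F\<lparr>carrier := K\<rparr>\<^esub> q y"
            using spF ue
              by (simp add: q_def module_linearD(2)[OF sp] F.smult_r_distr a_minus_def F.minus_add F.a_ac)
        next
          fix a x assume a: "a \<in> carrier A" and x: "x \<in> carrier ?F"
          have "u \<epsilon> \<odot>\<^bsub>?F\<^esub> (a \<odot>\<^bsub>?F\<^esub> x) = a \<odot>\<^bsub>?F\<^esub> (u \<epsilon> \<odot>\<^bsub>?F\<^esub> x)"
            using a x ue by (simp flip: F.smult_assoc1 add: M.R.m_comm)
          then show "q (a \<odot>\<^bsub>?F\<^esub> x) = a \<odot>\<^bsub>?F\<lparr>carrier := K\<rparr>\<^esub> q x"
            using a x spF ue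
              by (simp add: q_def module_linearD(3)[OF sp] F.smult_r_distr F.smult_r_minus a_minus_def)
        next
          fix x assume x: "x \<in> carrier ?F"
          have "?p (q x) = ?p (u \<epsilon> \<odot>\<^bsub>?F\<^esub> x) \<ominus>\<^bsub>M\<^esub> ?p (s (?p x))"
            unfolding q_def by (rule module_linearD'(3)[OF F M p]) (use x ue spF in auto)
          then have "?p (q x) = \<zero>\<^bsub>M\<^esub>"
            using x ue module_linearD(1)[OF p x]
              by (simp add: module_linearD(3)[OF p] s(2) a_minus_def M.r_neg)
          then show "q x \<in> carrier (?F\<lparr>carrier := K\<rparr>)" using x spF ue
            by (simp add: KF) (simp add: q_def)
        qed
        let ?h = "restrict (\<lambda>f. \<phi> (q f)) (carrier ?F)"
        have h: "?h \<in> module_hom A ?F N"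
          by (rule restrict_module_hom[OF F module_linear_comp[OF q module_hom_linear[OF \<phi>]]])
        have "(\<lambda>x\<in>K. u \<epsilon> \<odot>\<^bsub>N\<^esub> \<phi> x) = restrict ?h K"
        proof
          fix x
          show "(\<lambda>x\<in>K. u \<epsilon> \<odot>\<^bsub>N\<^esub> \<phi> x) x = restrict ?h K x"
          proof (cases "x \<in> K")
            case True
            then have "q x = u \<epsilon> \<odot>\<^bsub>?F\<^esub> x"
              using ue module_linearD'(1)[OF M F s(1)] by (simp add: q_def KF a_minus_def)
            then show ?thesis using True ue by (simp add: KF \<phi>D(3))
          qed simp
        qed
        then show "(\<lambda>x\<in>K. u \<epsilon> \<odot>\<^bsub>N\<^esub> \<phi> x) \<in> (\<lambda>h. restrict h K) ` module_hom A ?F N"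
          using h by blast
      qed
    qed
  qed
qed

text \<open>The data form a dual basis up to \<epsilon>: sending x to the combination of the
  generators \<open>free_gen A (y j)\<close> with coefficients \<open>h j x\<close> lifts
  multiplication by \<epsilon> to the free cover.\<close>

lemma almost_projectiveI:
  assumes M: "Module.module A M" and u: "u ` I \<subseteq> carrier A"
    and dual: "\<And>\<epsilon>. \<epsilon> \<in> I \<Longrightarrow> \<exists>(n::nat) y h. (\<forall>j<n. y j \<in> carrier M \<and>
      module_linear A M (self_algebra A) (h j)) \<and>
        (\<forall>x\<in>carrier M. (\<Oplus>\<^bsub>M\<^esub>j\<in>{..<n}. h j x \<odot>\<^bsub>M\<^esub> y j) = u \<epsilon> \<odot>\<^bsub>M\<^esub> x)"
  shows "almost_projective I u A M"
  unfolding almost_projective_iff[OF M u]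
proof
  fix \<epsilon> assume "\<epsilon> \<in> I"
  from dual[OF this] obtain n :: nat and y h where y: "\<And>j. j < n \<Longrightarrow> y j \<in> carrier M"
    and h: "\<And>j. j < n \<Longrightarrow> module_linear A M (self_algebra A) (h j)"
    and sum: "\<And>x. x \<in> carrier M \<Longrightarrow> (\<Oplus>\<^bsub>M\<^esub>j\<in>{..<n}. h j x \<odot>\<^bsub>M\<^esub> y j) = u \<epsilon> \<odot>\<^bsub>M\<^esub> x"
    by blast
  interpret M: Module.module A M by fact
  let ?F = "free_cover A M" and ?p = "free_lift A M (\<lambda>x. x)"
  have F: "Module.module A ?F" unfolding free_cover_def
    by (rule free_module_module[OF M.R.cring_axioms])
  interpret F: Module.module A ?F by fact
  have p: "module_linear A ?F M ?p" unfolding free_cover_def by (rule free_lift_module_linear[OF M])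
  have gen: "free_gen A x \<in> carrier ?F" "?p (free_gen A x) = x" if "x \<in> carrier M" for x
    using that free_gen_closed[OF M.R.cring_axioms]
      by (auto simp: free_cover_def free_lift_free_gen[OF M])
  have hD: "h j x \<in> carrier A" if "j < n" "x \<in> carrier M" for j x
    using module_linearD(1)[OF h] that by (simp add: self_algebra_def)
  have h_add: "h j (x \<oplus>\<^bsub>M\<^esub> x') = h j x \<oplus>\<^bsub>A\<^esub> h j x'" if "j < n" "x \<in> carrier M" "x' \<in> carrier M" for j x x'
    using module_linearD(2)[OF h] that by (simp add: self_algebra_def)
  have h_smult: "h j (a \<odot>\<^bsub>M\<^esub> x) = a \<otimes>\<^bsub>A\<^esub> h j x" if "j < n" "x \<in> carrier M" "a \<in> carrier A" for j x a
    using module_linearD(3)[OF h] that by (simp add: self_algebra_def)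
  define s where "s k x = (\<Oplus>\<^bsub>?F\<^esub>j\<in>{..<k}. h j x \<odot>\<^bsub>?F\<^esub> free_gen A (y j))" for k x
  have cl: "h j x \<odot>\<^bsub>?F\<^esub> free_gen A (y j) \<in> carrier ?F" if "j < n" "x \<in> carrier M" for j x
    using that gen y hD by simp
  have s_closed: "s k x \<in> carrier ?F" if "k \<le> n" "x \<in> carrier M" for k x
    unfolding s_def using cl that by (intro F.finsum_closed) auto
  have "module_linear A M ?F (s n)"
    unfolding module_linear_def
  proof (intro conjI ballI)
    fix x x' assume x: "x \<in> carrier M" and x': "x' \<in> carrier M"
    have "s n (x \<oplus>\<^bsub>M\<^esub> x') = (\<Oplus>\<^bsub>?F\<^esub>j\<in>{..<n}. h j x \<odot>\<^bsub>?F\<^esub> free_gen A (y j) \<oplus>\<^bsub>?F\<^esub> h j x' \<odot>\<^bsub>?F\<^esub> free_gen A (y j))"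
      unfolding s_def
      by (intro F.finsum_cong')
         (use x x' cl y gen h_add hD in \<open>auto simp: F.smult_l_distr\<close>)
    also have "\<dots> = s n x \<oplus>\<^bsub>?F\<^esub> s n x'"
      unfolding s_def by (rule F.finsum_addf) (use x x' cl in auto)
    finally show "s n (x \<oplus>\<^bsub>M\<^esub> x') = s n x \<oplus>\<^bsub>?F\<^esub> s n x'" .
  next
    fix a x assume a: "a \<in> carrier A" and x: "x \<in> carrier M"
    have "s n (a \<odot>\<^bsub>M\<^esub> x) = (\<Oplus>\<^bsub>?F\<^esub>j\<in>{..<n}. a \<odot>\<^bsub>?F\<^esub> (h j x \<odot>\<^bsub>?F\<^esub> free_gen A (y j)))"
      unfolding s_def
      by (intro F.finsum_cong')
         (use a x cl y gen h_smult hD in \<open>auto simp: F.smult_assoc1\<close>)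
    also have "\<dots> = a \<odot>\<^bsub>?F\<^esub> s n x"
      unfolding s_def by (rule F.finsum_smult_ldistr[symmetric]) (use x a cl in auto)
    finally show "s n (a \<odot>\<^bsub>M\<^esub> x) = a \<odot>\<^bsub>?F\<^esub> s n x" .
  qed (simp add: s_closed)
  moreover have "?p (s k x) = (\<Oplus>\<^bsub>M\<^esub>j\<in>{..<k}. h j x \<odot>\<^bsub>M\<^esub> y j)" if "k \<le> n" "x \<in> carrier M" for k x
    using that
  proof (induction k)
    case 0
    then show ?case using module_linearD'(1)[OF F M p] by (simp add: s_def)
  next
    case (Suc k)
    have c: "h k x \<in> carrier A" "y k \<in> carrier M" "h k x \<odot>\<^bsub>?F\<^esub> free_gen A (y k) \<in> carrier ?F"
      using hD y cl Suc.prems by auto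
    have "s (Suc k) x = h k x \<odot>\<^bsub>?F\<^esub> free_gen A (y k) \<oplus>\<^bsub>?F\<^esub> s k x"
      unfolding s_def lessThan_Suc by (rule F.finsum_insert) (use cl Suc.prems in auto)
    then have "?p (s (Suc k) x) = h k x \<odot>\<^bsub>M\<^esub> y k \<oplus>\<^bsub>M\<^esub> ?p (s k x)"
      using c gen Suc.prems s_closed[of k x] by (simp add: module_linearD(2,3)[OF p])
    also have "\<dots> = (\<Oplus>\<^bsub>M\<^esub>j\<in>{..<Suc k}. h j x \<odot>\<^bsub>M\<^esub> y j)"
      unfolding Suc.IH[OF Suc_leD[OF Suc.prems(1)] Suc.prems(2)] lessThan_Suc
      by (rule M.finsum_insert[symmetric]) (use c y hD Suc.prems in auto)
    finally show ?case .
  qed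
  ultimately show "\<exists>s. module_linear A M ?F s \<and> (\<forall>x\<in>carrier M. ?p (s x) = u \<epsilon> \<odot>\<^bsub>M\<^esub> x)"
    using sum by (intro exI[of _ "s n"]) auto
qed

section \<open>Monoid algebras\<close>

lemma monoid_algebra_simps:
  "carrier (monoid_algebra A G) = carrier (free_module A (carrier G))"
  "\<zero>\<^bsub>monoid_algebra A G\<^esub> = \<zero>\<^bsub>free_module A (carrier G)\<^esub>"
  "ring.add (monoid_algebra A G) = ring.add (free_module A (carrier G))"
  "module.smult (monoid_algebra A G) = module.smult (free_module A (carrier G))"
  "\<one>\<^bsub>monoid_algebra A G\<^esub> = free_gen A \<one>\<^bsub>G\<^esub>"
  by (simp_all add: monoid_algebra_def)

lemma monoid_algebra_module:
  assumes "cring A" shows "Module.module A (monoid_algebra A G)"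
proof -
  interpret F: Module.module A "free_module A (carrier G)" by (rule free_module_module[OF assms])
  have neg: "\<exists>y\<in>carrier (free_module A (carrier G)). y \<oplus>\<^bsub>free_module A (carrier G)\<^esub> x
    = \<zero>\<^bsub>free_module A (carrier G)\<^esub>"
    if "x \<in> carrier (free_module A (carrier G))" for x
    using F.l_neg[OF that] F.a_inv_closed[OF that] by blast
  show ?thesis
  proof (rule moduleI)
    show "abelian_group (monoid_algebra A G)"
      by (rule abelian_groupI) (auto simp: monoid_algebra_simps F.a_ac neg)
  qed (auto simp: monoid_algebra_simps assms F.smult_l_distr F.smult_r_distr F.smult_assoc1)
qed

text \<open>In \<open>tensor_algebra\<close> the relations are generated in the free module, but the
  quotient is one of the monoid algebra. The two differ only in product and unit.\<close>

lemma submodule_monoid_algebra: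
  "submodule N A (monoid_algebra A G) \<longleftrightarrow> submodule N A (free_module A (carrier G))"
  by (simp add: submodule_def submodule_axioms_def subgroup_def monoid_algebra_simps m_inv_def)

text \<open>The product of a tensor product of algebras is induced from the algebra of a product
  monoid. The ring laws are proved here for an arbitrary commutative monoid and later pass to the
  quotient.\<close>

locale monoid_algebra_ring =
  fixes A :: "('a, 'c) ring_scheme" and G :: "'x monoid"
  assumes cring: "cring A" and comm: "Group.comm_monoid G"
begin

sublocale A: cring A by (rule cring)
sublocale G: Group.comm_monoid G by (rule comm)

abbreviation "F \<equiv> free_module A (carrier G)"
abbreviation "H \<equiv> monoid_algebra A G"

sublocale F: Module.module A F by (rule free_module_module[OF cring])

definition supp :: "('x \<Rightarrow> 'a) \<Rightarrow> 'x set" where "supp f = {x. f x \<noteq> \<zero>\<^bsub>A\<^esub>}"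

lemma FD:
  assumes "f \<in> carrier F"
  shows "f x \<in> carrier A" "finite (supp f)" "supp f \<subseteq> carrier G"
  using assms by (auto simp: free_module_simps supp_def)

text \<open>The rectangle \<open>S \<times> T\<close>, unlike the set of pairs with product z, is
  independent of z and can be shared by several functions. Convolutions can then be added and
  reindexed termwise.\<close>

lemma mult_eq:
  assumes f: "f \<in> carrier F" and g: "g \<in> carrier F"
    and S: "finite S" "supp f \<subseteq> S" and T: "finite T" "supp g \<subseteq> T"
  shows "(f \<otimes>\<^bsub>H\<^esub> g) z = (\<Oplus>\<^bsub>A\<^esub>p\<in>S \<times> T. if fst p \<otimes>\<^bsub>G\<^esub> snd p = z then f (fst p) \<otimes>\<^bsub>A\<^esub> g (snd p) else \<zero>\<^bsub>A\<^esub>)"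
proof -
  have "(f \<otimes>\<^bsub>H\<^esub> g) z = (\<Oplus>\<^bsub>A\<^esub>p\<in>{p. f (fst p) \<noteq> \<zero>\<^bsub>A\<^esub> \<and> g (snd p) \<noteq> \<zero>\<^bsub>A\<^esub> \<and> fst p \<otimes>\<^bsub>G\<^esub> snd p = z}.
      f (fst p) \<otimes>\<^bsub>A\<^esub> g (snd p))" by (simp add: monoid_algebra_def)
  also have "\<dots> = (\<Oplus>\<^bsub>A\<^esub>p\<in>S \<times> T. if fst p \<otimes>\<^bsub>G\<^esub> snd p = z then f (fst p) \<otimes>\<^bsub>A\<^esub> g (snd p) else \<zero>\<^bsub>A\<^esub>)"
    by (rule A.add.finprod_mono_neutral_cong_left)
       (use S T FD(1)[OF f] FD(1)[OF g] in \<open>auto simp: supp_def\<close>)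
  finally show ?thesis .
qed

lemma mult_closed:
  assumes f: "f \<in> carrier F" and g: "g \<in> carrier F"
  shows "f \<otimes>\<^bsub>H\<^esub> g \<in> carrier F"
proof -
  note eq = mult_eq[OF f g FD(2)[OF f] order_refl FD(2)[OF g] order_refl]
  have cl: "(f \<otimes>\<^bsub>H\<^esub> g) z \<in> carrier A" for z
    unfolding eq using FD(1)[OF f] FD(1)[OF g] by (intro A.finsum_closed) auto
  have "(f \<otimes>\<^bsub>H\<^esub> g) z = \<zero>\<^bsub>A\<^esub>" if "z \<notin> (\<lambda>p. fst p \<otimes>\<^bsub>G\<^esub> snd p) ` (supp f \<times> supp g)" for z
    unfolding eq by (rule A.add.finprod_one_eqI) (use that in auto)
  then have sub: "{z. (f \<otimes>\<^bsub>H\<^esub> g) z \<noteq> \<zero>\<^bsub>A\<^esub>} \<subseteq> (\<lambda>p. fst p \<otimes>\<^bsub>G\<^esub> snd p) ` (supp f \<times> supp g)" by blast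
  also have "\<dots> \<subseteq> carrier G" using FD(3)[OF f] FD(3)[OF g] by (auto simp: subset_iff)
  finally have "{z. (f \<otimes>\<^bsub>H\<^esub> g) z \<noteq> \<zero>\<^bsub>A\<^esub>} \<subseteq> carrier G" .
  moreover have "finite {z. (f \<otimes>\<^bsub>H\<^esub> g) z \<noteq> \<zero>\<^bsub>A\<^esub>}"
    using FD(2)[OF f] FD(2)[OF g] by (intro finite_subset[OF sub]) auto
  ultimately show ?thesis using cl by (auto simp: free_module_simps)
qed

lemma mult_comm:
  assumes f: "f \<in> carrier F" and g: "g \<in> carrier F"
  shows "f \<otimes>\<^bsub>H\<^esub> g = g \<otimes>\<^bsub>H\<^esub> f"
proof
  fix z
  let ?S = "supp f" and ?T = "supp g"
  let ?h = "\<lambda>p. if fst p \<otimes>\<^bsub>G\<^esub> snd p = z then f (fst p) \<otimes>\<^bsub>A\<^esub> g (snd p) else \<zero>\<^bsub>A\<^esub>"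
  have "(\<Oplus>\<^bsub>A\<^esub>p\<in>prod.swap ` (?T \<times> ?S). ?h p) = (\<Oplus>\<^bsub>A\<^esub>p\<in>?T \<times> ?S. ?h (prod.swap p))"
    by (rule A.add.finprod_reindex) (use FD(1)[OF f] FD(1)[OF g] in auto)
  also have "\<dots> = (\<Oplus>\<^bsub>A\<^esub>p\<in>?T \<times> ?S. if fst p \<otimes>\<^bsub>G\<^esub> snd p = z then g (fst p) \<otimes>\<^bsub>A\<^esub> f (snd p) else \<zero>\<^bsub>A\<^esub>)"
    by (rule A.finsum_cong')
       (use FD(1)[OF f] FD(1)[OF g] FD(3)[OF f] FD(3)[OF g]
         in \<open>auto simp: A.m_comm G.m_comm subset_iff\<close>)
  finally show "(f \<otimes>\<^bsub>H\<^esub> g) z = (g \<otimes>\<^bsub>H\<^esub> f) z"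
    using mult_eq[OF f g FD(2)[OF f] order_refl FD(2)[OF g] order_refl]
      mult_eq[OF g f FD(2)[OF g] order_refl FD(2)[OF f] order_refl] by (simp add: product_swap)
qed

lemma mult_linear_left:
  assumes g: "g \<in> carrier F"
  shows "module_linear A F F (\<lambda>f. f \<otimes>\<^bsub>H\<^esub> g)"
  unfolding module_linear_def
proof (intro conjI ballI)
  fix f f' assume f: "f \<in> carrier F" and f': "f' \<in> carrier F"
  let ?S = "supp f \<union> supp f'" and ?T = "supp g"
  have S: "finite ?S" using FD(2) f f' by simp
  have sub: "supp (f \<oplus>\<^bsub>F\<^esub> f') \<subseteq> ?S" by (auto simp: supp_def free_module_simps)
  show "(f \<oplus>\<^bsub>F\<^esub> f') \<otimes>\<^bsub>H\<^esub> g = f \<otimes>\<^bsub>H\<^esub> g \<oplus>\<^bsub>F\<^esub> f' \<otimes>\<^bsub>H\<^esub> g"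
  proof
    fix z
    let ?h = "\<lambda>f p. if fst p \<otimes>\<^bsub>G\<^esub> snd p = z then f (fst p) \<otimes>\<^bsub>A\<^esub> g (snd p) else \<zero>\<^bsub>A\<^esub>"
    have "((f \<oplus>\<^bsub>F\<^esub> f') \<otimes>\<^bsub>H\<^esub> g) z = (\<Oplus>\<^bsub>A\<^esub>p\<in>?S \<times> ?T. ?h (f \<oplus>\<^bsub>F\<^esub> f') p)"
      by (rule mult_eq[OF _ g S sub FD(2)[OF g] order_refl]) (use f f' in simp)
    also have "\<dots> = (\<Oplus>\<^bsub>A\<^esub>p\<in>?S \<times> ?T. ?h f p \<oplus>\<^bsub>A\<^esub> ?h f' p)"
      by (rule A.finsum_cong') (use FD(1)[OF f] FD(1)[OF f'] FD(1)[OF g]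
        in \<open>auto simp: free_module_simps A.l_distr\<close>)
    also have "\<dots> = (\<Oplus>\<^bsub>A\<^esub>p\<in>?S \<times> ?T. ?h f p) \<oplus>\<^bsub>A\<^esub> (\<Oplus>\<^bsub>A\<^esub>p\<in>?S \<times> ?T. ?h f' p)"
      by (rule A.finsum_addf) (use FD(1)[OF f] FD(1)[OF f'] FD(1)[OF g] in auto)
    also have "\<dots> = (f \<otimes>\<^bsub>H\<^esub> g \<oplus>\<^bsub>F\<^esub> f' \<otimes>\<^bsub>H\<^esub> g) z"
      using mult_eq[OF f g S _ FD(2)[OF g] order_refl] mult_eq[OF f' g S _ FD(2)[OF g] order_refl]
      by (simp add: free_module_simps)
    finally show "((f \<oplus>\<^bsub>F\<^esub> f') \<otimes>\<^bsub>H\<^esub> g) z = (f \<otimes>\<^bsub>H\<^esub> g \<oplus>\<^bsub>F\<^esub> f' \<otimes>\<^bsub>H\<^esub> g) z" .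
  qed
next
  fix a f assume a: "a \<in> carrier A" and f: "f \<in> carrier F"
  let ?S = "supp f" and ?T = "supp g"
  have sub: "supp (a \<odot>\<^bsub>F\<^esub> f) \<subseteq> ?S" using a by (auto simp: supp_def free_module_simps)
  show "(a \<odot>\<^bsub>F\<^esub> f) \<otimes>\<^bsub>H\<^esub> g = a \<odot>\<^bsub>F\<^esub> (f \<otimes>\<^bsub>H\<^esub> g)"
  proof
    fix z
    let ?h = "\<lambda>f p. if fst p \<otimes>\<^bsub>G\<^esub> snd p = z then f (fst p) \<otimes>\<^bsub>A\<^esub> g (snd p) else \<zero>\<^bsub>A\<^esub>"
    have "((a \<odot>\<^bsub>F\<^esub> f) \<otimes>\<^bsub>H\<^esub> g) z = (\<Oplus>\<^bsub>A\<^esub>p\<in>?S \<times> ?T. ?h (a \<odot>\<^bsub>F\<^esub> f) p)"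
      by (rule mult_eq[OF _ g FD(2)[OF f] sub FD(2)[OF g] order_refl]) (use a f in simp)
    also have "\<dots> = (\<Oplus>\<^bsub>A\<^esub>p\<in>?S \<times> ?T. a \<otimes>\<^bsub>A\<^esub> ?h f p)"
      by (rule A.finsum_cong') (use a FD(1)[OF f] FD(1)[OF g]
        in \<open>auto simp: free_module_simps A.m_assoc\<close>)
    also have "\<dots> = a \<otimes>\<^bsub>A\<^esub> (\<Oplus>\<^bsub>A\<^esub>p\<in>?S \<times> ?T. ?h f p)"
      by (rule A.finsum_rdistr[symmetric]) (use a FD(1,2)[OF f] FD(1,2)[OF g] in auto)
    also have "\<dots> = (a \<odot>\<^bsub>F\<^esub> (f \<otimes>\<^bsub>H\<^esub> g)) z"
      using mult_eq[OF f g FD(2)[OF f] order_refl FD(2)[OF g] order_refl]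
        by (simp add: free_module_simps)
    finally show "((a \<odot>\<^bsub>F\<^esub> f) \<otimes>\<^bsub>H\<^esub> g) z = (a \<odot>\<^bsub>F\<^esub> (f \<otimes>\<^bsub>H\<^esub> g)) z" .
  qed
qed (simp add: mult_closed g)

lemma module_linear_cong:
  assumes "module_linear A F N h" "\<And>x. x \<in> carrier F \<Longrightarrow> h x = k x"
  shows "module_linear A F N k"
  using assms unfolding module_linear_def by simp

lemma mult_linear_right:
  assumes g: "g \<in> carrier F"
  shows "module_linear A F F (\<lambda>f. g \<otimes>\<^bsub>H\<^esub> f)"
  by (rule module_linear_cong[OF mult_linear_left[OF g]]) (rule mult_comm[OF _ g])

lemma gen_closed: "x \<in> carrier G \<Longrightarrow> free_gen A x \<in> carrier F"
  by (rule free_gen_closed[OF cring])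

lemma mult_gen:
  assumes x: "x \<in> carrier G" and y: "y \<in> carrier G"
  shows "free_gen A x \<otimes>\<^bsub>H\<^esub> free_gen A y = free_gen A (x \<otimes>\<^bsub>G\<^esub> y)"
proof
  fix z
  have "(free_gen A x \<otimes>\<^bsub>H\<^esub> free_gen A y) z = (\<Oplus>\<^bsub>A\<^esub>p\<in>{x} \<times> {y}.
      if fst p \<otimes>\<^bsub>G\<^esub> snd p = z then free_gen A x (fst p) \<otimes>\<^bsub>A\<^esub> free_gen A y (snd p) else \<zero>\<^bsub>A\<^esub>)"
    by (rule mult_eq[OF gen_closed[OF x] gen_closed[OF y]]) (auto simp: supp_def free_gen_def)
  then show "(free_gen A x \<otimes>\<^bsub>H\<^esub> free_gen A y) z = free_gen A (x \<otimes>\<^bsub>G\<^esub> y) z"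
    by (simp add: free_gen_def)
qed

text \<open>Both sides are linear in each argument, so they are compared on generators, one argument
  after the other; there the law is that of the monoid.\<close>

lemma mult_assoc:
  assumes f: "f \<in> carrier F" and g: "g \<in> carrier F" and h: "h \<in> carrier F"
  shows "f \<otimes>\<^bsub>H\<^esub> g \<otimes>\<^bsub>H\<^esub> h = f \<otimes>\<^bsub>H\<^esub> (g \<otimes>\<^bsub>H\<^esub> h)"
proof -
  have gens: "free_gen A x \<otimes>\<^bsub>H\<^esub> free_gen A y \<otimes>\<^bsub>H\<^esub> h = free_gen A x \<otimes>\<^bsub>H\<^esub> (free_gen A y \<otimes>\<^bsub>H\<^esub> h)"
    if x: "x \<in> carrier G" and y: "y \<in> carrier G" for x y
  proof (rule linear_free_ext[OF F.module_axioms _ _ _ h])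
    show "module_linear A F F (\<lambda>h. free_gen A x \<otimes>\<^bsub>H\<^esub> free_gen A y \<otimes>\<^bsub>H\<^esub> h)"
      by (intro mult_linear_right mult_closed gen_closed x y)
    show "module_linear A F F (\<lambda>h. free_gen A x \<otimes>\<^bsub>H\<^esub> (free_gen A y \<otimes>\<^bsub>H\<^esub> h))"
      by (intro module_linear_comp[OF mult_linear_right mult_linear_right] gen_closed x y)
  qed (simp add: mult_gen x y G.m_assoc)
  have gen: "free_gen A x \<otimes>\<^bsub>H\<^esub> g \<otimes>\<^bsub>H\<^esub> h = free_gen A x \<otimes>\<^bsub>H\<^esub> (g \<otimes>\<^bsub>H\<^esub> h)" if x: "x \<in> carrier G" for x
  proof (rule linear_free_ext[OF F.module_axioms _ _ _ g])
    show "module_linear A F F (\<lambda>g. free_gen A x \<otimes>\<^bsub>H\<^esub> g \<otimes>\<^bsub>H\<^esub> h)"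
      by (intro module_linear_comp[OF mult_linear_right mult_linear_left] gen_closed x h)
    show "module_linear A F F (\<lambda>g. free_gen A x \<otimes>\<^bsub>H\<^esub> (g \<otimes>\<^bsub>H\<^esub> h))"
      by (intro module_linear_comp[OF mult_linear_left mult_linear_right] gen_closed x h)
  qed (rule gens[OF x])
  show ?thesis
  proof (rule linear_free_ext[OF F.module_axioms _ _ _ f])
    show "module_linear A F F (\<lambda>f. f \<otimes>\<^bsub>H\<^esub> g \<otimes>\<^bsub>H\<^esub> h)"
      by (intro module_linear_comp[OF mult_linear_left mult_linear_left] g h)
    show "module_linear A F F (\<lambda>f. f \<otimes>\<^bsub>H\<^esub> (g \<otimes>\<^bsub>H\<^esub> h))"
      by (intro mult_linear_left mult_closed g h)
  qed (rule gen)
qed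

lemma mult_one:
  assumes f: "f \<in> carrier F"
  shows "\<one>\<^bsub>H\<^esub> \<otimes>\<^bsub>H\<^esub> f = f"
proof (rule linear_free_ext[OF F.module_axioms _ _ _ f])
  show "module_linear A F F (\<lambda>f. \<one>\<^bsub>H\<^esub> \<otimes>\<^bsub>H\<^esub> f)"
    unfolding monoid_algebra_simps by (intro mult_linear_right gen_closed) simp
  show "module_linear A F F (\<lambda>f. f)" by (simp add: module_linear_def)
qed (simp add: monoid_algebra_simps mult_gen)

lemma cring_monoid_algebra: "cring H"
proof (rule cringI)
  interpret H: Module.module A H by (rule monoid_algebra_module[OF cring])
  show "abelian_group H" by (rule H.abelian_group_axioms)
  show "Group.comm_monoid H"
  proof (rule comm_monoidI)
    fix f g assume "f \<in> carrier H" "g \<in> carrier H"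
    then show "f \<otimes>\<^bsub>H\<^esub> g = g \<otimes>\<^bsub>H\<^esub> f" by (intro mult_comm) (simp_all add: monoid_algebra_simps(1))
  next
    show "\<one>\<^bsub>H\<^esub> \<in> carrier H" by (simp add: monoid_algebra_simps gen_closed)
  qed (simp_all add: monoid_algebra_simps(1) mult_closed mult_assoc mult_one)
  fix f g h assume "f \<in> carrier H" "g \<in> carrier H" "h \<in> carrier H"
  then show "(f \<oplus>\<^bsub>H\<^esub> g) \<otimes>\<^bsub>H\<^esub> h = f \<otimes>\<^bsub>H\<^esub> h \<oplus>\<^bsub>H\<^esub> g \<otimes>\<^bsub>H\<^esub> h"
    using module_linearD(2)[OF mult_linear_left] by (simp add: monoid_algebra_simps)
qed

end

section \<open>Tensor products of algebras\<close>

lemma submodule_generated_submodule: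
  assumes M: "Module.module A M" and S: "S \<subseteq> carrier M"
  shows "submodule (submodule_generated A M S) A M"
proof -
  interpret M: Module.module A M by fact
  have "submodule (carrier M) A M" by (rule M.submoduleI) auto
  then have ne: "{N. submodule N A M \<and> S \<subseteq> N} \<noteq> {}" using S by auto
  show ?thesis
    unfolding submodule_generated_def hull_def
  proof (rule M.submoduleI)
    show "\<Inter> {N. submodule N A M \<and> S \<subseteq> N} \<subseteq> carrier M" using ne M.submoduleE(1) by blast
    fix a x assume "a \<in> carrier A" "x \<in> \<Inter> {N. submodule N A M \<and> S \<subseteq> N}"
    then show "a \<odot>\<^bsub>M\<^esub> x \<in> \<Inter> {N. submodule N A M \<and> S \<subseteq> N}" using M.submoduleE(4) by blast
  next
    fix x y assume "x \<in> \<Inter> {N. submodule N A M \<and> S \<subseteq> N}" "y \<in> \<Inter> {N. submodule N A M \<and> S \<subseteq> N}"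
    then show "x \<oplus>\<^bsub>M\<^esub> y \<in> \<Inter> {N. submodule N A M \<and> S \<subseteq> N}" using M.submoduleE(5) by blast
  next
    fix x assume "x \<in> \<Inter> {N. submodule N A M \<and> S \<subseteq> N}"
    then show "\<ominus>\<^bsub>M\<^esub> x \<in> \<Inter> {N. submodule N A M \<and> S \<subseteq> N}" using M.submoduleE(3) by blast
  next
    have "\<zero>\<^bsub>M\<^esub> \<in> N" if "submodule N A M" for N
    proof -
      interpret N: subgroup N "add_monoid M" using that by (simp add: submodule_def)
      show ?thesis using N.one_closed by simp
    qed
    then show "\<zero>\<^bsub>M\<^esub> \<in> \<Inter> {N. submodule N A M \<and> S \<subseteq> N}" by blast
  qed
qed

lemma submodule_zero: assumes "submodule N A M" shows "\<zero>\<^bsub>M\<^esub> \<in> N"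
proof -
  interpret N: subgroup N "add_monoid M" using assms by (simp add: submodule_def)
  show ?thesis using N.one_closed by simp
qed

lemma submodule_generated_superset: "S \<subseteq> submodule_generated A M S"
  unfolding submodule_generated_def by (rule hull_subset)

lemma submodule_generated_least:
  "submodule N A M \<Longrightarrow> S \<subseteq> N \<Longrightarrow> submodule_generated A M S \<subseteq> N"
  unfolding submodule_generated_def by (rule hull_minimal)

locale algebra_tensor =
  fixes A :: "('a, 'c) ring_scheme" and C :: "('a, 'b) module"
  assumes cringA: "cring A" and moduleC: "Module.module A C" and cringC: "cring C"
    and smult_mult: "a \<in> carrier A \<Longrightarrow> x \<in> carrier C \<Longrightarrow> y \<in> carrier C \<Longrightarrow>
      (a \<odot>\<^bsub>C\<^esub> x) \<otimes>\<^bsub>C\<^esub> y = a \<odot>\<^bsub>C\<^esub> (x \<otimes>\<^bsub>C\<^esub> y)"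
begin

sublocale A: cring A by (rule cringA)
sublocale C: cring C by (rule cringC)
sublocale CM: Module.module A C by (rule moduleC)

lemma mult_smult: "a \<in> carrier A \<Longrightarrow> x \<in> carrier C \<Longrightarrow> y \<in> carrier C \<Longrightarrow>
    x \<otimes>\<^bsub>C\<^esub> (a \<odot>\<^bsub>C\<^esub> y) = a \<odot>\<^bsub>C\<^esub> (x \<otimes>\<^bsub>C\<^esub> y)"
  using smult_mult[of a y x] by (simp add: C.m_comm)

lemma comm_monoid_DirProd: "Group.comm_monoid (C \<times>\<times> C)"
  by (rule comm_monoidI) (auto simp: DirProd_def C.m_ac)

sublocale MA: monoid_algebra_ring A "C \<times>\<times> C"
  by (rule monoid_algebra_ring.intro[OF cringA comm_monoid_DirProd])

lemma carrier_DirProd: "carrier (C \<times>\<times> C) = carrier C \<times> carrier C"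
  by (simp add: DirProd_def)

abbreviation "F \<equiv> free_module A (carrier C \<times> carrier C)"
abbreviation "H \<equiv> monoid_algebra A (C \<times>\<times> C)"

lemmas H_mult_closed = MA.mult_closed[unfolded carrier_DirProd]
  and H_mult_comm = MA.mult_comm[unfolded carrier_DirProd]
  and H_mult_linear = MA.mult_linear_right[unfolded carrier_DirProd]
  and H_mult_linear_left = MA.mult_linear_left[unfolded carrier_DirProd]
  and H_simps = monoid_algebra_simps[of A "C \<times>\<times> C", unfolded carrier_DirProd]

lemma moduleF: "Module.module A F" by (rule free_module_module[OF cringA])

sublocale F: Module.module A F by (rule moduleF)
sublocale H: cring H by (rule MA.cring_monoid_algebra)

lemma moduleH: "Module.module A H" by (rule monoid_algebra_module[OF cringA])

abbreviation "t x y \<equiv> free_gen A (x, y)"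

lemma t_closed: "x \<in> carrier C \<Longrightarrow> y \<in> carrier C \<Longrightarrow> t x y \<in> carrier F"
  by (rule free_gen_closed[OF cringA]) simp

lemma t_mult:
  assumes "x \<in> carrier C" "y \<in> carrier C" "x' \<in> carrier C" "y' \<in> carrier C"
  shows "t x y \<otimes>\<^bsub>H\<^esub> t x' y' = t (x \<otimes>\<^bsub>C\<^esub> x') (y \<otimes>\<^bsub>C\<^esub> y')"
  using MA.mult_gen[of "(x, y)" "(x', y')"] assms by (simp add: DirProd_def)

abbreviation "rels \<equiv> tensor_relations A C C"

lemma rels_induct:
  assumes "r \<in> rels"
    and "\<And>x x' y. x \<in> carrier C \<Longrightarrow> x' \<in> carrier C \<Longrightarrow> y \<in> carrier C \<Longrightarrow>
      P (t (x \<oplus>\<^bsub>C\<^esub> x') y \<ominus>\<^bsub>F\<^esub> (t x y \<oplus>\<^bsub>F\<^esub> t x' y))"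
    and "\<And>x y y'. x \<in> carrier C \<Longrightarrow> y \<in> carrier C \<Longrightarrow> y' \<in> carrier C \<Longrightarrow>
      P (t x (y \<oplus>\<^bsub>C\<^esub> y') \<ominus>\<^bsub>F\<^esub> (t x y \<oplus>\<^bsub>F\<^esub> t x y'))"
    and "\<And>a x y. a \<in> carrier A \<Longrightarrow> x \<in> carrier C \<Longrightarrow> y \<in> carrier C \<Longrightarrow>
      P (t (a \<odot>\<^bsub>C\<^esub> x) y \<ominus>\<^bsub>F\<^esub> a \<odot>\<^bsub>F\<^esub> t x y)"
    and "\<And>a x y. a \<in> carrier A \<Longrightarrow> x \<in> carrier C \<Longrightarrow> y \<in> carrier C \<Longrightarrow>
      P (t x (a \<odot>\<^bsub>C\<^esub> y) \<ominus>\<^bsub>F\<^esub> a \<odot>\<^bsub>F\<^esub> t x y)"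
  shows "P r"
  using assms(1) unfolding tensor_relations_def Let_def by (auto intro: assms(2-))

lemma rels_intros:
  "x \<in> carrier C \<Longrightarrow> x' \<in> carrier C \<Longrightarrow> y \<in> carrier C \<Longrightarrow>
      t (x \<oplus>\<^bsub>C\<^esub> x') y \<ominus>\<^bsub>F\<^esub> (t x y \<oplus>\<^bsub>F\<^esub> t x' y) \<in> rels"
  "x \<in> carrier C \<Longrightarrow> y \<in> carrier C \<Longrightarrow> y' \<in> carrier C \<Longrightarrow>
      t x (y \<oplus>\<^bsub>C\<^esub> y') \<ominus>\<^bsub>F\<^esub> (t x y \<oplus>\<^bsub>F\<^esub> t x y') \<in> rels"
  "a \<in> carrier A \<Longrightarrow> x \<in> carrier C \<Longrightarrow> y \<in> carrier C \<Longrightarrow>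
      t (a \<odot>\<^bsub>C\<^esub> x) y \<ominus>\<^bsub>F\<^esub> a \<odot>\<^bsub>F\<^esub> t x y \<in> rels"
  "a \<in> carrier A \<Longrightarrow> x \<in> carrier C \<Longrightarrow> y \<in> carrier C \<Longrightarrow>
      t x (a \<odot>\<^bsub>C\<^esub> y) \<ominus>\<^bsub>F\<^esub> a \<odot>\<^bsub>F\<^esub> t x y \<in> rels"
  unfolding tensor_relations_def Let_def by blast+

lemma rels_closed: "rels \<subseteq> carrier F"
proof
  fix r assume "r \<in> rels"
  then show "r \<in> carrier F"
    by (rule rels_induct) (intro F.minus_closed F.add.m_closed F.smult_closed t_closed C.add.m_closed CM.smult_closed; assumption)+
qed

definition S where "S = submodule_generated A F rels"

lemma submoduleS: "submodule S A F"
  unfolding S_def by (rule submodule_generated_submodule[OF moduleF rels_closed])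

lemma S_least: "submodule N A F \<Longrightarrow> rels \<subseteq> N \<Longrightarrow> S \<subseteq> N"
  unfolding S_def by (rule submodule_generated_least)

lemma submoduleSH: "submodule S A H"
  using submoduleS by (simp add: submodule_monoid_algebra carrier_DirProd)

lemmas S_closed = F.submoduleE(1,3,4,5)[OF submoduleS]

text \<open>A generator times a bilinearity relation is a relation of the same kind. This is what
  makes the submodule S an ideal.\<close>

lemma gen_mult_rels:
  assumes p: "p \<in> carrier C" and q: "q \<in> carrier C" and r: "r \<in> rels"
  shows "t p q \<otimes>\<^bsub>H\<^esub> r \<in> rels"
proof -
  have lin: "module_linear A F F (\<lambda>f. t p q \<otimes>\<^bsub>H\<^esub> f)" by (rule H_mult_linear[OF t_closed[OF p q]])
  note D = module_linearD'(3)[OF moduleF moduleF lin] module_linearD(2,3)[OF lin]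
  note simps = D t_closed C.add.m_closed CM.smult_closed F.add.m_closed F.smult_closed t_mult p q
    C.r_distr mult_smult
  from r show ?thesis
  proof (rule rels_induct)
    fix x x' y assume "x \<in> carrier C" "x' \<in> carrier C" "y \<in> carrier C"
    then show "t p q \<otimes>\<^bsub>H\<^esub> (t (x \<oplus>\<^bsub>C\<^esub> x') y \<ominus>\<^bsub>F\<^esub> (t x y \<oplus>\<^bsub>F\<^esub> t x' y)) \<in> rels"
      using rels_intros(1)[of "p \<otimes>\<^bsub>C\<^esub> x" "p \<otimes>\<^bsub>C\<^esub> x'" "q \<otimes>\<^bsub>C\<^esub> y"] by (simp add: simps)
  next
    fix x y y' assume "x \<in> carrier C" "y \<in> carrier C" "y' \<in> carrier C"
    then show "t p q \<otimes>\<^bsub>H\<^esub> (t x (y \<oplus>\<^bsub>C\<^esub> y') \<ominus>\<^bsub>F\<^esub> (t x y \<oplus>\<^bsub>F\<^esub> t x y')) \<in> rels"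
      using rels_intros(2)[of "p \<otimes>\<^bsub>C\<^esub> x" "q \<otimes>\<^bsub>C\<^esub> y" "q \<otimes>\<^bsub>C\<^esub> y'"] by (simp add: simps)
  next
    fix a x y assume "a \<in> carrier A" "x \<in> carrier C" "y \<in> carrier C"
    then show "t p q \<otimes>\<^bsub>H\<^esub> (t (a \<odot>\<^bsub>C\<^esub> x) y \<ominus>\<^bsub>F\<^esub> a \<odot>\<^bsub>F\<^esub> t x y) \<in> rels"
      using rels_intros(3)[of a "p \<otimes>\<^bsub>C\<^esub> x" "q \<otimes>\<^bsub>C\<^esub> y"] by (simp add: simps)
  next
    fix a x y assume "a \<in> carrier A" "x \<in> carrier C" "y \<in> carrier C"
    then show "t p q \<otimes>\<^bsub>H\<^esub> (t x (a \<odot>\<^bsub>C\<^esub> y) \<ominus>\<^bsub>F\<^esub> a \<odot>\<^bsub>F\<^esub> t x y) \<in> rels"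
      using rels_intros(4)[of a "p \<otimes>\<^bsub>C\<^esub> x" "q \<otimes>\<^bsub>C\<^esub> y"] by (simp add: simps)
  qed
qed

text \<open>Linear extension in two stages: over f for a single relation, then over s, because the s
  that satisfy the claim for all f form a submodule.\<close>

lemma mult_S:
  assumes f: "f \<in> carrier F" and s: "s \<in> S"
  shows "f \<otimes>\<^bsub>H\<^esub> s \<in> S"
proof -
  let ?N = "{s \<in> carrier F. \<forall>f\<in>carrier F. f \<otimes>\<^bsub>H\<^esub> s \<in> S}"
  have rel: "f \<otimes>\<^bsub>H\<^esub> r \<in> S" if r: "r \<in> rels" and f: "f \<in> carrier F" for r f
  proof -
    have rF: "r \<in> carrier F" using r rels_closed by auto
    have lin: "module_linear A F F (\<lambda>f. f \<otimes>\<^bsub>H\<^esub> r)" by (rule H_mult_linear_left[OF rF])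
    show ?thesis
      using cringA f
    proof (induction rule: free_module_induct)
      case zero
      then show ?case
        by (simp only: module_linearD'(1)[OF moduleF moduleF lin] submodule_zero[OF submoduleS])
    next
      case (add f g)
      then show ?case by (simp add: module_linearD(2)[OF lin] S_closed(4))
    next
      case (gen a y)
      then obtain p q where pq: "y = (p, q)" "p \<in> carrier C" "q \<in> carrier C" by auto
      then have "t p q \<otimes>\<^bsub>H\<^esub> r \<in> S"
        unfolding S_def by (intro subsetD[OF submodule_generated_superset] gen_mult_rels[OF pq(2,3) r])
      then show ?case using gen pq by (simp add: module_linearD(3)[OF lin] t_closed S_closed(3))
    qed
  qed
  have "submodule ?N A F"
  proof (rule F.submoduleI)
    note D = module_linearD[OF H_mult_linear] module_linearD'[OF moduleF moduleF H_mult_linear]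
    show "\<zero>\<^bsub>F\<^esub> \<in> ?N" by (simp add: D submodule_zero[OF submoduleS])
    show "\<ominus>\<^bsub>F\<^esub> a \<in> ?N" if "a \<in> ?N" for a using that by (auto simp: D S_closed(2))
    show "a \<oplus>\<^bsub>F\<^esub> b \<in> ?N" if "a \<in> ?N" "b \<in> ?N" for a b using that by (auto simp: D S_closed(4))
    show "a \<odot>\<^bsub>F\<^esub> x \<in> ?N" if "a \<in> carrier A" "x \<in> ?N" for a x using that by (auto simp: D S_closed(3))
  qed auto
  moreover have "rels \<subseteq> ?N" using rel rels_closed by auto
  ultimately have "S \<subseteq> ?N" by (rule S_least)
  then show ?thesis using f s by auto
qed

lemma idealS: "ideal S H"
proof (rule idealI)
  show "subgroup S (add_monoid H)" using submoduleSH by (simp add: submodule_def)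
  fix s f assume "s \<in> S" "f \<in> carrier H"
  then show "f \<otimes>\<^bsub>H\<^esub> s \<in> S" "s \<otimes>\<^bsub>H\<^esub> f \<in> S"
    using mult_S S_closed(1) H_mult_comm[of s f] by (auto simp: H_simps)
qed (rule H.ring_axioms)

definition T where "T = tensor_algebra A C C"

lemma T_def': "T = quotient_module H S"
  by (simp add: T_def tensor_algebra_def S_def)

definition \<pi> where "\<pi> f = S +>\<^bsub>H\<^esub> f"

lemma \<pi>_simps:
  "carrier T = \<pi> ` carrier F" "\<zero>\<^bsub>T\<^esub> = \<pi> \<zero>\<^bsub>F\<^esub>" "\<one>\<^bsub>T\<^esub> = \<pi> \<one>\<^bsub>H\<^esub>"
  "f \<in> carrier F \<Longrightarrow> g \<in> carrier F \<Longrightarrow> \<pi> f \<oplus>\<^bsub>T\<^esub> \<pi> g = \<pi> (f \<oplus>\<^bsub>F\<^esub> g)"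
  "f \<in> carrier F \<Longrightarrow> g \<in> carrier F \<Longrightarrow> \<pi> f \<otimes>\<^bsub>T\<^esub> \<pi> g = \<pi> (f \<otimes>\<^bsub>H\<^esub> g)"
  "f \<in> carrier F \<Longrightarrow> a \<in> carrier A \<Longrightarrow> a \<odot>\<^bsub>T\<^esub> \<pi> f = \<pi> (a \<odot>\<^bsub>F\<^esub> f)"
proof -
  interpret I: ideal S H by (rule idealS)
  note Q = quotient_module_module[OF moduleH submoduleSH]
  show "carrier T = \<pi> ` carrier F" by (simp add: T_def' Q(4) \<pi>_def[abs_def] H_simps)
  show "\<zero>\<^bsub>T\<^esub> = \<pi> \<zero>\<^bsub>F\<^esub>"
    using Q(5)[of "\<zero>\<^bsub>F\<^esub>"] submodule_zero[OF submoduleS] F.zero_closed by (simp add: T_def' \<pi>_def H_simps)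
  show "\<one>\<^bsub>T\<^esub> = \<pi> \<one>\<^bsub>H\<^esub>" by (simp add: T_def' \<pi>_def quotient_module_def)
  show "\<pi> f \<oplus>\<^bsub>T\<^esub> \<pi> g = \<pi> (f \<oplus>\<^bsub>F\<^esub> g)" if "f \<in> carrier F" "g \<in> carrier F"
    using Q(3)[of f g] that by (simp add: T_def' \<pi>_def H_simps)
  show "\<pi> f \<otimes>\<^bsub>T\<^esub> \<pi> g = \<pi> (f \<otimes>\<^bsub>H\<^esub> g)" if "f \<in> carrier F" "g \<in> carrier F"
    using I.rcoset_mult_add[of f g] that by (simp add: T_def' \<pi>_def quotient_module_def H_simps)
  show "a \<odot>\<^bsub>T\<^esub> \<pi> f = \<pi> (a \<odot>\<^bsub>F\<^esub> f)" if "f \<in> carrier F" "a \<in> carrier A"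
    using Q(2)[of f a] that by (simp add: T_def' \<pi>_def H_simps)
qed

lemma moduleT: "Module.module A T"
  unfolding T_def' by (rule quotient_module_module(1)[OF moduleH submoduleSH])

sublocale TM: Module.module A T by (rule moduleT)

lemma \<pi>_closed: "f \<in> carrier F \<Longrightarrow> \<pi> f \<in> carrier T"
  by (simp add: \<pi>_simps)

lemma \<pi>_linear: "module_linear A F T \<pi>"
  by (simp add: module_linear_def \<pi>_simps)

lemma \<pi>_eq_zero: assumes "f \<in> carrier F" shows "\<pi> f = \<zero>\<^bsub>T\<^esub> \<longleftrightarrow> f \<in> S"
  using quotient_module_module(5)[OF moduleH submoduleSH, of f] assms
    by (simp add: T_def' \<pi>_def H_simps)

lemma cringT: "cring T"
proof (rule cringI)
  have one: "\<one>\<^bsub>H\<^esub> \<in> carrier F" using H.one_closed by (simp add: H_simps)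
  show "Group.comm_monoid T"
  proof (rule comm_monoidI)
    fix x y assume "x \<in> carrier T" "y \<in> carrier T"
    then obtain f g where fg: "x = \<pi> f" "y = \<pi> g" "f \<in> carrier F" "g \<in> carrier F"
      by (auto simp: \<pi>_simps(1))
    then show "x \<otimes>\<^bsub>T\<^esub> y \<in> carrier T" by (simp add: \<pi>_simps(1,5) H_mult_closed)
    show "x \<otimes>\<^bsub>T\<^esub> y = y \<otimes>\<^bsub>T\<^esub> x" using fg H_mult_comm[OF fg(3,4)] by (simp add: \<pi>_simps(5))
  next
    show "\<one>\<^bsub>T\<^esub> \<in> carrier T" using one by (simp add: \<pi>_simps)
  next
    fix x y z assume "x \<in> carrier T" "y \<in> carrier T" "z \<in> carrier T"
    then show "x \<otimes>\<^bsub>T\<^esub> y \<otimes>\<^bsub>T\<^esub> z = x \<otimes>\<^bsub>T\<^esub> (y \<otimes>\<^bsub>T\<^esub> z)"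
      using MA.mult_assoc[unfolded carrier_DirProd] by (auto simp: \<pi>_simps(1,5) H_mult_closed)
  next
    fix x assume "x \<in> carrier T"
    then show "\<one>\<^bsub>T\<^esub> \<otimes>\<^bsub>T\<^esub> x = x"
      using MA.mult_one[unfolded carrier_DirProd] one by (auto simp: \<pi>_simps(1,3,5))
  qed
  fix x y z assume "x \<in> carrier T" "y \<in> carrier T" "z \<in> carrier T"
  then show "(x \<oplus>\<^bsub>T\<^esub> y) \<otimes>\<^bsub>T\<^esub> z = x \<otimes>\<^bsub>T\<^esub> z \<oplus>\<^bsub>T\<^esub> y \<otimes>\<^bsub>T\<^esub> z"
    using module_linearD(2)[OF H_mult_linear_left] by (auto simp: \<pi>_simps(1,4,5) H_mult_closed)
qed (rule TM.abelian_group_axioms)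

sublocale T: cring T by (rule cringT)

definition tens where "tens x y = \<pi> (t x y)"

lemma tens_closed [simp]: "x \<in> carrier C \<Longrightarrow> y \<in> carrier C \<Longrightarrow> tens x y \<in> carrier T"
  by (simp add: tens_def \<pi>_closed t_closed)

lemma \<pi>_eq_if_rel:
  assumes "f \<ominus>\<^bsub>F\<^esub> g \<in> rels" "f \<in> carrier F" "g \<in> carrier F"
  shows "\<pi> f = \<pi> g"
proof -
  have "f \<ominus>\<^bsub>F\<^esub> g \<in> S" unfolding S_def by (rule subsetD[OF submodule_generated_superset assms(1)])
  then have "\<pi> (f \<ominus>\<^bsub>F\<^esub> g) = \<zero>\<^bsub>T\<^esub>" using assms by (subst \<pi>_eq_zero) auto
  then have "\<pi> f \<ominus>\<^bsub>T\<^esub> \<pi> g = \<zero>\<^bsub>T\<^esub>"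
    using module_linearD'(3)[OF moduleF moduleT \<pi>_linear assms(2,3)] by simp
  then show ?thesis by (rule TM.eq_if_minus_eq_zero) (use assms \<pi>_closed in auto)
qed

lemma tens_add_left:
  assumes "x \<in> carrier C" "x' \<in> carrier C" "y \<in> carrier C"
  shows "tens (x \<oplus>\<^bsub>C\<^esub> x') y = tens x y \<oplus>\<^bsub>T\<^esub> tens x' y"
  using \<pi>_eq_if_rel[OF rels_intros(1)[OF assms]] assms by (simp add: tens_def \<pi>_simps t_closed)

lemma tens_add_right:
  assumes "x \<in> carrier C" "y \<in> carrier C" "y' \<in> carrier C"
  shows "tens x (y \<oplus>\<^bsub>C\<^esub> y') = tens x y \<oplus>\<^bsub>T\<^esub> tens x y'"
  using \<pi>_eq_if_rel[OF rels_intros(2)[OF assms]] assms by (simp add: tens_def \<pi>_simps t_closed)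

lemma tens_smult_left:
  assumes "a \<in> carrier A" "x \<in> carrier C" "y \<in> carrier C"
  shows "tens (a \<odot>\<^bsub>C\<^esub> x) y = a \<odot>\<^bsub>T\<^esub> tens x y"
  using \<pi>_eq_if_rel[OF rels_intros(3)[OF assms]] assms by (simp add: tens_def \<pi>_simps t_closed)

lemma tens_smult_right:
  assumes "a \<in> carrier A" "x \<in> carrier C" "y \<in> carrier C"
  shows "tens x (a \<odot>\<^bsub>C\<^esub> y) = a \<odot>\<^bsub>T\<^esub> tens x y"
  using \<pi>_eq_if_rel[OF rels_intros(4)[OF assms]] assms by (simp add: tens_def \<pi>_simps t_closed)

lemma tens_mult:
  assumes "x \<in> carrier C" "y \<in> carrier C" "x' \<in> carrier C" "y' \<in> carrier C"
  shows "tens x y \<otimes>\<^bsub>T\<^esub> tens x' y' = tens (x \<otimes>\<^bsub>C\<^esub> x') (y \<otimes>\<^bsub>C\<^esub> y')"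
  using assms by (simp add: tens_def \<pi>_simps t_closed t_mult)

lemma tens_one: "\<one>\<^bsub>T\<^esub> = tens \<one>\<^bsub>C\<^esub> \<one>\<^bsub>C\<^esub>"
proof -
  have "\<one>\<^bsub>C \<times>\<times> C\<^esub> = (\<one>\<^bsub>C\<^esub>, \<one>\<^bsub>C\<^esub>)" by (simp add: DirProd_def)
  then show ?thesis by (simp add: tens_def \<pi>_simps H_simps)
qed

text \<open>Sums of pure tensors include zero and scalar multiples, because 0 = 0 \<otimes> 0 and a
  (x \<otimes> y) = (a x) \<otimes> y.\<close>

lemma T_induct [consumes 1, case_names add tens]:
  assumes z: "z \<in> carrier T"
    and add: "\<And>u v. u \<in> carrier T \<Longrightarrow> v \<in> carrier T \<Longrightarrow> P u \<Longrightarrow> P v \<Longrightarrow> P (u \<oplus>\<^bsub>T\<^esub> v)"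
    and tens: "\<And>x y. x \<in> carrier C \<Longrightarrow> y \<in> carrier C \<Longrightarrow> P (tens x y)"
  shows "P z"
proof -
  obtain f where f: "f \<in> carrier F" "z = \<pi> f" using z by (auto simp: \<pi>_simps)
  from cringA f(1) have "P (\<pi> f)"
  proof (induction rule: free_module_induct)
    case zero
    have "tens \<zero>\<^bsub>C\<^esub> \<zero>\<^bsub>C\<^esub> = \<zero>\<^bsub>A\<^esub> \<odot>\<^bsub>T\<^esub> tens \<zero>\<^bsub>C\<^esub> \<zero>\<^bsub>C\<^esub>"
      using tens_smult_left[of "\<zero>\<^bsub>A\<^esub>" "\<zero>\<^bsub>C\<^esub>" "\<zero>\<^bsub>C\<^esub>"] by (simp add: CM.smult_l_null)
    then have "tens \<zero>\<^bsub>C\<^esub> \<zero>\<^bsub>C\<^esub> = \<zero>\<^bsub>T\<^esub>" by (simp add: TM.smult_l_null)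
    then show ?case using tens[of "\<zero>\<^bsub>C\<^esub>" "\<zero>\<^bsub>C\<^esub>"] by (simp add: \<pi>_simps)
  next
    case (add f g)
    then show ?case using assms(2)[of "\<pi> f" "\<pi> g"] by (simp add: \<pi>_closed \<pi>_simps)
  next
    case (gen a y)
    then obtain p q where pq: "y = (p, q)" "p \<in> carrier C" "q \<in> carrier C" by auto
    then have "\<pi> (a \<odot>\<^bsub>F\<^esub> free_gen A y) = tens (a \<odot>\<^bsub>C\<^esub> p) q"
      using gen by (simp add: tens_smult_left) (simp add: tens_def \<pi>_simps t_closed)
    then show ?case using tens gen pq by simp
  qed
  then show ?thesis using f by simp
qed

text \<open>The form of \<open>multiplication_map\<close>, so that \<mu> becomes an instance;
  \<open>the_elem\<close> extracts the common value on a coset.\<close>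

definition tensor_lift :: "('a, 'n) module \<Rightarrow> ('b \<times> 'b \<Rightarrow> 'n) \<Rightarrow> ('b \<times> 'b \<Rightarrow> 'a) set \<Rightarrow> 'n" where
  "tensor_lift N \<phi> z = the_elem (free_lift A N \<phi> ` z)"

text \<open>The universal property: for bilinear \<phi> the lift to the free module vanishes on the
  relations, hence on S, and is constant on cosets.\<close>

lemma tensor_lift:
  fixes N :: "('a, 'n) module"
  assumes N: "Module.module A N"
    and cl: "\<And>x y. x \<in> carrier C \<Longrightarrow> y \<in> carrier C \<Longrightarrow> \<phi> (x, y) \<in> carrier N"
    and addl: "\<And>x x' y. x \<in> carrier C \<Longrightarrow> x' \<in> carrier C \<Longrightarrow> y \<in> carrier C \<Longrightarrow> \<phi> (x \<oplus>\<^bsub>C\<^esub> x', y)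
      = \<phi> (x, y) \<oplus>\<^bsub>N\<^esub> \<phi> (x', y)"
    and addr: "\<And>x y y'. x \<in> carrier C \<Longrightarrow> y \<in> carrier C \<Longrightarrow> y' \<in> carrier C \<Longrightarrow> \<phi> (x, y \<oplus>\<^bsub>C\<^esub> y')
      = \<phi> (x, y) \<oplus>\<^bsub>N\<^esub> \<phi> (x, y')"
    and sml: "\<And>a x y. a \<in> carrier A \<Longrightarrow> x \<in> carrier C \<Longrightarrow> y \<in> carrier C \<Longrightarrow> \<phi> (a \<odot>\<^bsub>C\<^esub> x, y) = a \<odot>\<^bsub>N\<^esub> \<phi> (x, y)"
    and smr: "\<And>a x y. a \<in> carrier A \<Longrightarrow> x \<in> carrier C \<Longrightarrow> y \<in> carrier C \<Longrightarrow> \<phi> (x, a \<odot>\<^bsub>C\<^esub> y) = a \<odot>\<^bsub>N\<^esub> \<phi> (x, y)"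
  shows "module_linear A T N (tensor_lift N \<phi>)"
    and "x \<in> carrier C \<Longrightarrow> y \<in> carrier C \<Longrightarrow> tensor_lift N \<phi> (tens x y) = \<phi> (x, y)"
proof -
  interpret N: Module.module A N by fact
  let ?l = "free_lift A N \<phi>"
  have l: "module_linear A F N ?l" by (rule free_lift_module_linear[OF N]) (use cl in auto)
  have lt: "?l (t x y) = \<phi> (x, y)" if "x \<in> carrier C" "y \<in> carrier C" for x y
    using that by (intro free_lift_free_gen[OF N] cl)
  note D = module_linearD'(3)[OF moduleF N l] module_linearD(2,3)[OF l]
  have "rels \<subseteq> a_kernel F N ?l"
  proof
    fix r assume r: "r \<in> rels"
    then have "?l r = \<zero>\<^bsub>N\<^esub>"
      by (rule rels_induct)
         (simp_all add: D t_closed lt cl addl addr sml smr, simp_all add: a_minus_def N.r_neg cl)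
    then show "r \<in> a_kernel F N ?l" using r rels_closed by (auto simp: a_kernel_def')
  qed
  then have S: "S \<subseteq> a_kernel F N ?l"
    by (rule S_least[OF kernel_submodule_linear[OF moduleF N l]])
  have lift: "tensor_lift N \<phi> (\<pi> f) = ?l f" if f: "f \<in> carrier F" for f
  proof -
    have "?l g = ?l f" if g: "g \<in> \<pi> f" for g
    proof -
      obtain s where s: "s \<in> S" "g = s \<oplus>\<^bsub>F\<^esub> f" using g unfolding \<pi>_def a_r_coset_def' H_simps by blast
      then have "s \<in> carrier F" "?l s = \<zero>\<^bsub>N\<^esub>" using S by (auto simp: a_kernel_def')
      then show ?thesis using s(2) f module_linearD(1)[OF l f] by (simp add: D)
    qed
    moreover have "f \<in> \<pi> f"
      using submodule_zero[OF submoduleS] f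
        by (force simp: \<pi>_def a_r_coset_def' H_simps intro!: bexI[of _ "\<zero>\<^bsub>F\<^esub>"])
    ultimately have "?l ` \<pi> f = {?l f}" by blast
    then show ?thesis by (simp add: tensor_lift_def)
  qed
  show "tensor_lift N \<phi> (tens x y) = \<phi> (x, y)" if "x \<in> carrier C" "y \<in> carrier C"
    using that by (simp add: tens_def lift t_closed lt)
  show "module_linear A T N (tensor_lift N \<phi>)"
    unfolding module_linear_def by (auto simp: \<pi>_simps(1,4,6) lift D module_linearD(1)[OF l])
qed

definition \<mu> where "\<mu> = multiplication_map A C"

lemma \<mu>_eq: "\<mu> = tensor_lift C (\<lambda>p. fst p \<otimes>\<^bsub>C\<^esub> snd p)"
  by (simp add: \<mu>_def multiplication_map_def tensor_lift_def fun_eq_iff)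

lemma \<mu>_linear: "module_linear A T C \<mu>"
  and \<mu>_tens [simp]: "x \<in> carrier C \<Longrightarrow> y \<in> carrier C \<Longrightarrow> \<mu> (tens x y) = x \<otimes>\<^bsub>C\<^esub> y"
proof -
  note l = tensor_lift[where \<phi> = "\<lambda>p. fst p \<otimes>\<^bsub>C\<^esub> snd p", OF moduleC]
  show "module_linear A T C \<mu>"
    unfolding \<mu>_eq by (rule l(1)) (simp_all add: C.l_distr C.r_distr smult_mult mult_smult)
  show "\<mu> (tens x y) = x \<otimes>\<^bsub>C\<^esub> y" if "x \<in> carrier C" "y \<in> carrier C"
    unfolding \<mu>_eq using l(2)[of x y] that by (simp add: C.l_distr C.r_distr smult_mult mult_smult)
qed

lemma \<mu>_closed [simp]: "z \<in> carrier T \<Longrightarrow> \<mu> z \<in> carrier C"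
  by (rule module_linearD(1)[OF \<mu>_linear])

lemma \<mu>_add: "z \<in> carrier T \<Longrightarrow> z' \<in> carrier T \<Longrightarrow> \<mu> (z \<oplus>\<^bsub>T\<^esub> z') = \<mu> z \<oplus>\<^bsub>C\<^esub> \<mu> z'"
  by (rule module_linearD(2)[OF \<mu>_linear])

lemma \<mu>_mult:
  assumes z: "z \<in> carrier T" and z': "z' \<in> carrier T"
  shows "\<mu> (z \<otimes>\<^bsub>T\<^esub> z') = \<mu> z \<otimes>\<^bsub>C\<^esub> \<mu> z'"
  using z
proof (induction rule: T_induct)
  case (add u v)
  then show ?case using z' by (simp add: T.l_distr \<mu>_add C.l_distr)
next
  case (tens x y)
  from z' show ?case
  proof (induction rule: T_induct)
    case (add u v)
    then show ?case using tens by (simp add: T.r_distr \<mu>_add C.r_distr)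
  next
    case (tens x' y')
    then show ?case using \<open>x \<in> carrier C\<close> \<open>y \<in> carrier C\<close> by (simp add: tens_mult C.m_ac)
  qed
qed

end

section \<open>Differentials and the diagonal\<close>

lemma linear_finsum:
  assumes M: "Module.module A M" and N: "Module.module A N" and h: "module_linear A M N h"
    and g: "\<And>s. s \<in> S \<Longrightarrow> g s \<in> carrier M"
  shows "h (\<Oplus>\<^bsub>M\<^esub>s\<in>S. g s) = (\<Oplus>\<^bsub>N\<^esub>s\<in>S. h (g s))"
proof -
  interpret M: Module.module A M by fact
  interpret N: Module.module A N by fact
  show ?thesis
    using g
  proof (induction S rule: infinite_finite_induct)
    case (insert s S)
    have "(\<lambda>s. h (g s)) \<in> S \<rightarrow> carrier N" "h (g s) \<in> carrier N"
      using insert.prems module_linearD(1)[OF h] by auto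
    moreover have "g \<in> S \<rightarrow> carrier M" "g s \<in> carrier M" using insert.prems by auto
    ultimately show ?case using insert by (simp add: module_linearD(2)[OF h])
  qed (simp_all add: module_linearD'(1)[OF M N h])
qed

text \<open>A substitute for the determinant trick that eliminates one generator at a time.\<close>

lemma (in ring_hom_cring) kill_generators:
  assumes x: "\<And>i. i < n \<Longrightarrow> x i \<in> carrier R" and \<eta>: "\<eta> \<in> carrier R"
    and rel: "\<And>i. i < n \<Longrightarrow> \<exists>c. (\<forall>j<n. c j \<in> carrier R \<and> h (c j) = \<zero>\<^bsub>S\<^esub>) \<and>
      \<eta> \<otimes>\<^bsub>R\<^esub> x i = (\<Oplus>\<^bsub>R\<^esub>j\<in>{..<n}. c j \<otimes>\<^bsub>R\<^esub> x j)"
  shows "\<exists>\<delta>\<in>carrier R. h \<delta> = h \<eta> [^]\<^bsub>S\<^esub> (2 ^ n - 1 :: nat) \<and> (\<forall>i<n. \<delta> \<otimes>\<^bsub>R\<^esub> x i = \<zero>\<^bsub>R\<^esub>)"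
  using x \<eta> rel
proof (induction n arbitrary: \<eta>)
  case 0
  show ?case by (rule bexI[of _ "\<one>\<^bsub>R\<^esub>"]) simp_all
next
  case (Suc n)
  note x = Suc.prems(1) and \<eta> = Suc.prems(2)
  define P where "P i c \<longleftrightarrow> (\<forall>j<Suc n. c j \<in> carrier R \<and> h (c j) = \<zero>\<^bsub>S\<^esub>) \<and>
      \<eta> \<otimes>\<^bsub>R\<^esub> x i = (\<Oplus>\<^bsub>R\<^esub>j\<in>{..<Suc n}. c j \<otimes>\<^bsub>R\<^esub> x j)" for i c
  have "\<forall>i\<in>{..<Suc n}. \<exists>c. P i c" using Suc.prems(3) unfolding P_def by blast
  from bchoice[OF this] obtain c where "\<forall>i\<in>{..<Suc n}. P i (c i)" by blast
  then have c: "\<And>i j. i < Suc n \<Longrightarrow> j < Suc n \<Longrightarrow> c i j \<in> carrier R"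
    "\<And>i j. i < Suc n \<Longrightarrow> j < Suc n \<Longrightarrow> h (c i j) = \<zero>\<^bsub>S\<^esub>"
    "\<And>i. i < Suc n \<Longrightarrow> \<eta> \<otimes>\<^bsub>R\<^esub> x i = (\<Oplus>\<^bsub>R\<^esub>j\<in>{..<Suc n}. c i j \<otimes>\<^bsub>R\<^esub> x j)"
    unfolding P_def by blast+
  have cl: "(\<lambda>j. c i j \<otimes>\<^bsub>R\<^esub> x j) \<in> {..<n} \<rightarrow> carrier R" if "i < Suc n" for i
    using c(1) x that by auto
  define s where "s i = (\<Oplus>\<^bsub>R\<^esub>j\<in>{..<n}. c i j \<otimes>\<^bsub>R\<^esub> x j)" for i
  have s: "s i \<in> carrier R" if "i < Suc n" for i unfolding s_def using cl[OF that]
    by (rule R.finsum_closed)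
  have row: "\<eta> \<otimes>\<^bsub>R\<^esub> x i = c i n \<otimes>\<^bsub>R\<^esub> x n \<oplus>\<^bsub>R\<^esub> s i" if "i < Suc n" for i
    unfolding c(3)[OF that] s_def lessThan_Suc
    by (rule R.finsum_insert) (use cl[OF that] c(1) x that in auto)
  \<comment> \<open>The multiplier u agrees with \<eta> under h, and it expresses \<open>x n\<close>
    times u by the other elements.\<close>
  define u where "u = \<eta> \<ominus>\<^bsub>R\<^esub> c n n"
  have u: "u \<in> carrier R" "h u = h \<eta>" using \<eta> c(1,2)[of n n] by (simp_all add: u_def a_minus_def)
  have ux: "u \<otimes>\<^bsub>R\<^esub> x n = s n"
  proof -
    have "u \<otimes>\<^bsub>R\<^esub> x n = \<eta> \<otimes>\<^bsub>R\<^esub> x n \<ominus>\<^bsub>R\<^esub> c n n \<otimes>\<^bsub>R\<^esub> x n"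
      using \<eta> c(1)[of n n] x[of n] by (simp add: u_def a_minus_def R.l_distr R.l_minus)
    also have "\<dots> = s n"
      using row[of n] c(1)[of n n] x[of n] s[of n] by (simp add: a_minus_def R.a_ac R.r_neg)
    finally show ?thesis .
  qed
  \<comment> \<open>Multiplying row i by u replaces u times \<open>x n\<close> by
    \<open>s n\<close>. The first n elements then satisfy relations with multiplier u \<eta>, whose
    coefficients still lie in the kernel of h.\<close>
  have "\<exists>\<delta>\<in>carrier R. h \<delta> = h (u \<otimes>\<^bsub>R\<^esub> \<eta>) [^]\<^bsub>S\<^esub> (2 ^ n - 1 :: nat) \<and> (\<forall>i<n. \<delta> \<otimes>\<^bsub>R\<^esub> x i = \<zero>\<^bsub>R\<^esub>)"
  proof (rule Suc.IH)
    fix i assume i: "i < n"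
    have "(u \<otimes>\<^bsub>R\<^esub> \<eta>) \<otimes>\<^bsub>R\<^esub> x i = u \<otimes>\<^bsub>R\<^esub> (c i n \<otimes>\<^bsub>R\<^esub> x n \<oplus>\<^bsub>R\<^esub> s i)"
      using i u \<eta> x row[of i] by (simp add: R.m_assoc)
    also have "\<dots> = c i n \<otimes>\<^bsub>R\<^esub> s n \<oplus>\<^bsub>R\<^esub> u \<otimes>\<^bsub>R\<^esub> s i"
      using i u c(1)[of i n] x s R.m_lcomm[of u "c i n" "x n"] by (simp add: R.r_distr ux)
    also have "\<dots> = (\<Oplus>\<^bsub>R\<^esub>j\<in>{..<n}. c i n \<otimes>\<^bsub>R\<^esub> (c n j \<otimes>\<^bsub>R\<^esub> x j)) \<oplus>\<^bsub>R\<^esub> (\<Oplus>\<^bsub>R\<^esub>j\<in>{..<n}. u \<otimes>\<^bsub>R\<^esub> (c i j \<otimes>\<^bsub>R\<^esub> x j))"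
      unfolding s_def using i cl c(1) u by (simp add: R.finsum_rdistr)
    also have "\<dots> = (\<Oplus>\<^bsub>R\<^esub>j\<in>{..<n}. c i n \<otimes>\<^bsub>R\<^esub> (c n j \<otimes>\<^bsub>R\<^esub> x j) \<oplus>\<^bsub>R\<^esub> u \<otimes>\<^bsub>R\<^esub> (c i j \<otimes>\<^bsub>R\<^esub> x j))"
      by (rule R.finsum_addf[symmetric]) (use i c(1) x u in auto)
    also have "\<dots> = (\<Oplus>\<^bsub>R\<^esub>j\<in>{..<n}. (c i n \<otimes>\<^bsub>R\<^esub> c n j \<oplus>\<^bsub>R\<^esub> u \<otimes>\<^bsub>R\<^esub> c i j) \<otimes>\<^bsub>R\<^esub> x j)"
      by (rule R.finsum_cong') (use i c(1) x u in \<open>auto simp: R.l_distr R.m_assoc\<close>)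
    finally have "(u \<otimes>\<^bsub>R\<^esub> \<eta>) \<otimes>\<^bsub>R\<^esub> x i = (\<Oplus>\<^bsub>R\<^esub>j\<in>{..<n}. (c i n \<otimes>\<^bsub>R\<^esub> c n j \<oplus>\<^bsub>R\<^esub> u \<otimes>\<^bsub>R\<^esub> c i j) \<otimes>\<^bsub>R\<^esub> x j)" .
    moreover have "\<forall>j<n. c i n \<otimes>\<^bsub>R\<^esub> c n j \<oplus>\<^bsub>R\<^esub> u \<otimes>\<^bsub>R\<^esub> c i j \<in> carrier R \<and>
        h (c i n \<otimes>\<^bsub>R\<^esub> c n j \<oplus>\<^bsub>R\<^esub> u \<otimes>\<^bsub>R\<^esub> c i j) = \<zero>\<^bsub>S\<^esub>"
      using i c(1,2) u hom_closed[OF \<eta>] by simp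
    ultimately show "\<exists>c. (\<forall>j<n. c j \<in> carrier R \<and> h (c j) = \<zero>\<^bsub>S\<^esub>) \<and>
        (u \<otimes>\<^bsub>R\<^esub> \<eta>) \<otimes>\<^bsub>R\<^esub> x i = (\<Oplus>\<^bsub>R\<^esub>j\<in>{..<n}. c j \<otimes>\<^bsub>R\<^esub> x j)"
      by (intro exI[of _ "\<lambda>j. c i n \<otimes>\<^bsub>R\<^esub> c n j \<oplus>\<^bsub>R\<^esub> u \<otimes>\<^bsub>R\<^esub> c i j"] conjI)
  qed (use u \<eta> x in auto)
  then obtain \<delta> where \<delta>: "\<delta> \<in> carrier R" "h \<delta> = h (u \<otimes>\<^bsub>R\<^esub> \<eta>) [^]\<^bsub>S\<^esub> (2 ^ n - 1 :: nat)"
    "\<And>i. i < n \<Longrightarrow> \<delta> \<otimes>\<^bsub>R\<^esub> x i = \<zero>\<^bsub>R\<^esub>" by blast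
  \<comment> \<open>The image of u \<eta> is the square of that of \<eta>, and one further u is
    needed to annihilate \<open>x n\<close>. This gives the exponent 2 (2^n - 1) + 1.\<close>
  have "h (\<delta> \<otimes>\<^bsub>R\<^esub> u) = h \<eta> [^]\<^bsub>S\<^esub> (2 * (2 ^ n - 1) + 1 :: nat)"
    using \<delta>(1,2) u \<eta> by (simp add: S.nat_pow_distrib S.nat_pow_mult mult_2)
  also have "2 * (2 ^ n - 1) + 1 = (2 ^ Suc n - 1 :: nat)"
  proof -
    have "1 \<le> (2 :: nat) ^ n" by simp
    then show ?thesis unfolding power_Suc by linarith
  qed
  finally have "h (\<delta> \<otimes>\<^bsub>R\<^esub> u) = h \<eta> [^]\<^bsub>S\<^esub> (2 ^ Suc n - 1 :: nat)" .
  moreover have "\<delta> \<otimes>\<^bsub>R\<^esub> u \<otimes>\<^bsub>R\<^esub> x i = \<zero>\<^bsub>R\<^esub>" if "i < Suc n" for i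
  proof (cases "i = n")
    case True
    have "\<delta> \<otimes>\<^bsub>R\<^esub> s n = (\<Oplus>\<^bsub>R\<^esub>j\<in>{..<n}. \<delta> \<otimes>\<^bsub>R\<^esub> (c n j \<otimes>\<^bsub>R\<^esub> x j))"
      unfolding s_def using cl \<delta>(1) by (simp add: R.finsum_rdistr)
    also have "\<dots> = (\<Oplus>\<^bsub>R\<^esub>j\<in>{..<n}. \<zero>\<^bsub>R\<^esub>)"
    proof (rule R.finsum_cong')
      fix j assume "j \<in> {..<n}"
      then show "\<delta> \<otimes>\<^bsub>R\<^esub> (c n j \<otimes>\<^bsub>R\<^esub> x j) = \<zero>\<^bsub>R\<^esub>"
        using R.m_lcomm[of \<delta> "c n j" "x j"] \<delta>(1,3) c(1) x by simp
    qed auto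
    finally show ?thesis using True \<delta>(1) u x by (simp add: R.m_assoc ux)
  next
    case False
    then have "\<delta> \<otimes>\<^bsub>R\<^esub> u \<otimes>\<^bsub>R\<^esub> x i = u \<otimes>\<^bsub>R\<^esub> (\<delta> \<otimes>\<^bsub>R\<^esub> x i)"
      using \<delta>(1) u x that by (simp add: R.m_ac)
    then show ?thesis using False that \<delta>(3) u by simp
  qed
  ultimately show ?case using \<delta>(1) u(1) by (intro bexI[of _ "\<delta> \<otimes>\<^bsub>R\<^esub> u"]) auto
qed

section \<open>The algebra B over A and the diagonal\<close>

locale ring_tensor =
  fixes A :: "('a, 'c) ring_scheme" and B :: "('b, 'd) ring_scheme" and f :: "'a \<Rightarrow> 'b"
  assumes hom: "ring_hom_cring A B f"
begin

sublocale f: ring_hom_cring A B f by (rule hom)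

abbreviation "C \<equiv> restrict_scalars f (self_algebra B)"

lemma C_simps [simp]:
  "carrier C = carrier B" "\<zero>\<^bsub>C\<^esub> = \<zero>\<^bsub>B\<^esub>" "\<one>\<^bsub>C\<^esub> = \<one>\<^bsub>B\<^esub>" "x \<oplus>\<^bsub>C\<^esub> y = x \<oplus>\<^bsub>B\<^esub> y" "x \<otimes>\<^bsub>C\<^esub> y = x \<otimes>\<^bsub>B\<^esub> y"
  "a \<odot>\<^bsub>C\<^esub> x = f a \<otimes>\<^bsub>B\<^esub> x"
  by (simp_all add: restrict_scalars_def self_algebra_def)

lemma module_C: "Module.module A C"
  by (rule restrict_scalars_module[OF hom self_algebra_module[OF f.S.cring_axioms]])

lemma cring_C: "cring C"
proof (rule cringI)
  interpret Module.module A C by (rule module_C)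
  show "abelian_group C" by (rule abelian_group_axioms)
  show "Group.comm_monoid C" by (rule comm_monoidI) (auto simp: f.S.m_ac)
qed (simp add: f.S.l_distr)

sublocale algebra_tensor A C
  by (rule algebra_tensor.intro[OF f.R.cring_axioms module_C cring_C]) (simp add: f.S.m_assoc)

end

lemma self_algebra_simps:
  "carrier (self_algebra R) = carrier R" "\<zero>\<^bsub>self_algebra R\<^esub> = \<zero>\<^bsub>R\<^esub>"
  "x \<oplus>\<^bsub>self_algebra R\<^esub> y = x \<oplus>\<^bsub>R\<^esub> y" "a \<odot>\<^bsub>self_algebra R\<^esub> x = a \<otimes>\<^bsub>R\<^esub> x"
  by (simp_all add: self_algebra_def)

context ring_tensor
begin

abbreviation "TB \<equiv> restrict_scalars \<mu> (self_algebra B)"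

lemma TB_simps [simp]:
  "carrier TB = carrier B" "\<zero>\<^bsub>TB\<^esub> = \<zero>\<^bsub>B\<^esub>" "x \<oplus>\<^bsub>TB\<^esub> y = x \<oplus>\<^bsub>B\<^esub> y" "z \<odot>\<^bsub>TB\<^esub> x = \<mu> z \<otimes>\<^bsub>B\<^esub> x"
  by (simp_all add: restrict_scalars_def self_algebra_def)

lemma \<mu>_hom_B: "ring_hom_cring T B \<mu>"
  by (rule ring_hom_cring.intro[OF cringT f.S.cring_axioms], unfold ring_hom_cring_axioms_def, rule ring_hom_memI)
     (use \<mu>_closed in \<open>simp_all add: \<mu>_mult \<mu>_add tens_one\<close>)

sublocale \<mu>: ring_hom_cring T B \<mu> by (rule \<mu>_hom_B)

lemma module_TB: "Module.module T TB"
  by (rule restrict_scalars_module[OF \<mu>_hom_B self_algebra_module[OF f.S.cring_axioms]])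

lemma smult_T:
  assumes "a \<in> carrier A" "z \<in> carrier T"
  shows "a \<odot>\<^bsub>T\<^esub> z = tens (f a) \<one>\<^bsub>B\<^esub> \<otimes>\<^bsub>T\<^esub> z"
  using assms(2)
proof (induction rule: T_induct)
  case (add u v)
  then show ?case using assms(1) by (simp add: TM.smult_r_distr T.r_distr)
next
  case (tens x y)
  then show ?case using assms(1) tens_smult_left[of a x y] by (simp add: tens_mult)
qed

lemma tens_f: "a \<in> carrier A \<Longrightarrow> tens \<one>\<^bsub>B\<^esub> (f a) = tens (f a) \<one>\<^bsub>B\<^esub>"
  using tens_smult_left[of a "\<one>\<^bsub>B\<^esub>" "\<one>\<^bsub>B\<^esub>"] tens_smult_right[of a "\<one>\<^bsub>B\<^esub>" "\<one>\<^bsub>B\<^esub>"] by simp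

lemma smult_T_one: "a \<in> carrier A \<Longrightarrow> a \<odot>\<^bsub>T\<^esub> \<one>\<^bsub>T\<^esub> = tens (f a) \<one>\<^bsub>B\<^esub>"
  by (simp add: smult_T)

lemma \<mu>_smult: "a \<in> carrier A \<Longrightarrow> z \<in> carrier T \<Longrightarrow> \<mu> (a \<odot>\<^bsub>T\<^esub> z) = f a \<otimes>\<^bsub>B\<^esub> \<mu> z"
  by (simp add: smult_T)

text \<open>Almost projectivity of \<open>B\<close> over \<open>B \<otimes> B\<close> amounts to the existence of elements that play the
  role of \<open>\<epsilon>\<close> times the idempotent of the diagonal.\<close>

lemma almost_projective_diagonal_iff:
  assumes I: "I \<subseteq> carrier A"
  shows "almost_projective I (\<lambda>r. id r \<odot>\<^bsub>T\<^esub> \<one>\<^bsub>T\<^esub>) T TB \<longleftrightarrow>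
    (\<forall>\<epsilon>\<in>I. \<exists>e\<in>carrier T. \<mu> e = f \<epsilon> \<and> (\<forall>x\<in>carrier B. tens x \<one>\<^bsub>B\<^esub> \<otimes>\<^bsub>T\<^esub> e = tens \<one>\<^bsub>B\<^esub> x \<otimes>\<^bsub>T\<^esub> e))" (is "_ \<longleftrightarrow> ?R")
proof
  let ?F = "free_module T (carrier B)" and ?TT = "self_algebra T"
  have u: "(\<lambda>r. id r \<odot>\<^bsub>T\<^esub> \<one>\<^bsub>T\<^esub>) ` I \<subseteq> carrier T" using I by auto
  have TT: "Module.module T ?TT" by (rule self_algebra_module[OF cringT])
  note iff = almost_projective_iff[OF module_TB u]
  {
    assume "almost_projective I (\<lambda>r. id r \<odot>\<^bsub>T\<^esub> \<one>\<^bsub>T\<^esub>) T TB"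
    then have R: "\<forall>\<epsilon>\<in>I. \<exists>s. module_linear T TB (free_cover T TB) s \<and>
        (\<forall>x\<in>carrier B. free_lift T TB (\<lambda>x. x) (s x) = \<mu> (id \<epsilon> \<odot>\<^bsub>T\<^esub> \<one>\<^bsub>T\<^esub>) \<otimes>\<^bsub>B\<^esub> x)" unfolding iff by simp
    show ?R
    proof
      fix \<epsilon> assume e: "\<epsilon> \<in> I"
      then have eA: "\<epsilon> \<in> carrier A" using I by auto
      obtain s where s: "module_linear T TB ?F s"
        and ps: "\<And>x. x \<in> carrier B \<Longrightarrow> free_lift T TB (\<lambda>x. x) (s x) = f \<epsilon> \<otimes>\<^bsub>B\<^esub> x"
        using R e eA by (auto simp: free_cover_def smult_T_one)
      \<comment> \<open>The generator b of the free cover is sent to b \<otimes> 1, which \<mu> maps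
        back to b. Composed with s, this gives a T-linear h from B to T. The element e is h(1),
        because z h(1) = h(\<mu> z) depends on \<mu> z alone.\<close>
      let ?\<phi> = "\<lambda>b. tens b \<one>\<^bsub>B\<^esub>"
      have cl: "?\<phi> b \<in> carrier ?TT" if "b \<in> carrier B" for b using that
        by (simp add: self_algebra_simps)
      have l: "module_linear T ?F ?TT (free_lift T ?TT ?\<phi>)" by (rule free_lift_module_linear[OF TT cl])
      define h where "h x = free_lift T ?TT ?\<phi> (s x)" for x
      have h: "module_linear T TB ?TT h" unfolding h_def by (rule module_linear_comp[OF s l])
      have \<mu>l: "module_linear T ?TT TB \<mu>" by (simp add: module_linear_def self_algebra_simps)
      have h1: "h \<one>\<^bsub>B\<^esub> \<in> carrier T" using module_linearD(1)[OF h, of "\<one>\<^bsub>B\<^esub>"]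
        by (simp add: self_algebra_simps)
      have hz: "h (\<mu> z) = z \<otimes>\<^bsub>T\<^esub> h \<one>\<^bsub>B\<^esub>" if "z \<in> carrier T" for z
        using module_linearD(3)[OF h that, of "\<one>\<^bsub>B\<^esub>"] that by (simp add: self_algebra_simps)
      have "\<mu> (free_lift T ?TT ?\<phi> g) = free_lift T TB (\<lambda>x. x) g" if "g \<in> carrier ?F" for g
      proof (rule linear_free_ext[OF module_TB _ _ _ that])
        show "module_linear T ?F TB (\<lambda>g. \<mu> (free_lift T ?TT ?\<phi> g))"
          by (rule module_linear_comp[OF l \<mu>l])
        show "module_linear T ?F TB (free_lift T TB (\<lambda>x. x))"
          by (rule free_lift_module_linear[OF module_TB]) simp
        show "\<mu> (free_lift T ?TT ?\<phi> (free_gen T y)) = free_lift T TB (\<lambda>x. x) (free_gen T y)"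
          if "y \<in> carrier B" for y
          using that cl[OF that]
            by (simp add: free_lift_free_gen[OF TT] free_lift_free_gen[OF module_TB])
      qed
      moreover have "s \<one>\<^bsub>B\<^esub> \<in> carrier ?F" using module_linearD(1)[OF s] by simp
      ultimately have "\<mu> (h \<one>\<^bsub>B\<^esub>) = f \<epsilon>" using ps[of "\<one>\<^bsub>B\<^esub>"] eA by (simp add: h_def)
      moreover have "tens x \<one>\<^bsub>B\<^esub> \<otimes>\<^bsub>T\<^esub> h \<one>\<^bsub>B\<^esub> = tens \<one>\<^bsub>B\<^esub> x \<otimes>\<^bsub>T\<^esub> h \<one>\<^bsub>B\<^esub>" if "x \<in> carrier B" for x
        using hz[of "tens x \<one>\<^bsub>B\<^esub>"] hz[of "tens \<one>\<^bsub>B\<^esub> x"] that by simp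
      ultimately show "\<exists>e\<in>carrier T. \<mu> e = f \<epsilon> \<and> (\<forall>x\<in>carrier B. tens x \<one>\<^bsub>B\<^esub> \<otimes>\<^bsub>T\<^esub> e = tens \<one>\<^bsub>B\<^esub> x \<otimes>\<^bsub>T\<^esub> e)"
        using h1 by blast
    qed
  next
    assume R: ?R
    show "almost_projective I (\<lambda>r. id r \<odot>\<^bsub>T\<^esub> \<one>\<^bsub>T\<^esub>) T TB"
    proof (rule almost_projectiveI[OF module_TB u])
      fix \<epsilon> assume e: "\<epsilon> \<in> I"
      then have eA: "\<epsilon> \<in> carrier A" using I by auto
      obtain e where e: "e \<in> carrier T" "\<mu> e = f \<epsilon>"
        and diag: "\<And>x. x \<in> carrier B \<Longrightarrow> tens x \<one>\<^bsub>B\<^esub> \<otimes>\<^bsub>T\<^esub> e = tens \<one>\<^bsub>B\<^esub> x \<otimes>\<^bsub>T\<^esub> e"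
        using R e by blast
      \<comment> \<open>T acts on e through \<mu>. Hence sending b to (b \<otimes> 1) e is T-linear,
        and with the single generator 1 it is a dual basis of B up to \<epsilon>.\<close>
      have ze: "tens (\<mu> z) \<one>\<^bsub>B\<^esub> \<otimes>\<^bsub>T\<^esub> e = z \<otimes>\<^bsub>T\<^esub> e" if "z \<in> carrier T" for z
        using that
      proof (induction rule: T_induct)
        case (add u v)
        then show ?case using e(1) tens_add_left[of "\<mu> u" "\<mu> v" "\<one>\<^bsub>B\<^esub>"] by (simp add: T.l_distr)
      next
        case (tens x y)
        have "tens (x \<otimes>\<^bsub>B\<^esub> y) \<one>\<^bsub>B\<^esub> = tens x \<one>\<^bsub>B\<^esub> \<otimes>\<^bsub>T\<^esub> tens y \<one>\<^bsub>B\<^esub>" "tens x y = tens x \<one>\<^bsub>B\<^esub> \<otimes>\<^bsub>T\<^esub> tens \<one>\<^bsub>B\<^esub> y"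
          using tens by (simp_all add: tens_mult)
        then show ?case using tens e(1) diag[of y] by (simp add: T.m_assoc)
      qed
      have "module_linear T TB ?TT (\<lambda>b. tens b \<one>\<^bsub>B\<^esub> \<otimes>\<^bsub>T\<^esub> e)"
        unfolding module_linear_def
      proof (intro conjI ballI)
        fix x y assume "x \<in> carrier TB" "y \<in> carrier TB"
        then show "tens (x \<oplus>\<^bsub>TB\<^esub> y) \<one>\<^bsub>B\<^esub> \<otimes>\<^bsub>T\<^esub> e = tens x \<one>\<^bsub>B\<^esub> \<otimes>\<^bsub>T\<^esub> e \<oplus>\<^bsub>?TT\<^esub> tens y \<one>\<^bsub>B\<^esub> \<otimes>\<^bsub>T\<^esub> e"
          using e(1) tens_add_left[of x y "\<one>\<^bsub>B\<^esub>"] by (simp add: T.l_distr self_algebra_simps)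
      next
        fix z x assume z: "z \<in> carrier T" and "x \<in> carrier TB"
        then have x: "x \<in> carrier B" by simp
        have "tens (\<mu> z \<otimes>\<^bsub>B\<^esub> x) \<one>\<^bsub>B\<^esub> \<otimes>\<^bsub>T\<^esub> e = (z \<otimes>\<^bsub>T\<^esub> tens x \<one>\<^bsub>B\<^esub>) \<otimes>\<^bsub>T\<^esub> e"
          using ze[of "z \<otimes>\<^bsub>T\<^esub> tens x \<one>\<^bsub>B\<^esub>"] z x by simp
        then show "tens (z \<odot>\<^bsub>TB\<^esub> x) \<one>\<^bsub>B\<^esub> \<otimes>\<^bsub>T\<^esub> e = z \<odot>\<^bsub>?TT\<^esub> (tens x \<one>\<^bsub>B\<^esub> \<otimes>\<^bsub>T\<^esub> e)"
          using z x e(1) by (simp add: self_algebra_simps T.m_assoc)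
      qed (use e(1) in \<open>simp add: self_algebra_simps\<close>)
      moreover have "(\<Oplus>\<^bsub>TB\<^esub>j\<in>{..<1::nat}. (tens x \<one>\<^bsub>B\<^esub> \<otimes>\<^bsub>T\<^esub> e) \<odot>\<^bsub>TB\<^esub> \<one>\<^bsub>B\<^esub>) = id \<epsilon> \<odot>\<^bsub>T\<^esub> \<one>\<^bsub>T\<^esub> \<odot>\<^bsub>TB\<^esub> x"
        if x: "x \<in> carrier TB" for x
      proof -
        interpret TBm: Module.module T TB by (rule module_TB)
        have "(\<Oplus>\<^bsub>TB\<^esub>j\<in>{..<1::nat}. (tens x \<one>\<^bsub>B\<^esub> \<otimes>\<^bsub>T\<^esub> e) \<odot>\<^bsub>TB\<^esub> \<one>\<^bsub>B\<^esub>) = (tens x \<one>\<^bsub>B\<^esub> \<otimes>\<^bsub>T\<^esub> e) \<odot>\<^bsub>TB\<^esub> \<one>\<^bsub>B\<^esub>"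
          using TBm.finsum_insert[of "{}" "0::nat" "\<lambda>_. (tens x \<one>\<^bsub>B\<^esub> \<otimes>\<^bsub>T\<^esub> e) \<odot>\<^bsub>TB\<^esub> \<one>\<^bsub>B\<^esub>"] x e(1)
          by (simp add: lessThan_Suc)
        also have "\<dots> = id \<epsilon> \<odot>\<^bsub>T\<^esub> \<one>\<^bsub>T\<^esub> \<odot>\<^bsub>TB\<^esub> x"
          using x e eA by (simp add: smult_T_one f.S.m_comm)
        finally show ?thesis .
      qed
      ultimately show "\<exists>(n::nat) y h. (\<forall>j<n. y j \<in> carrier TB \<and> module_linear T TB ?TT (h j)) \<and>
          (\<forall>x\<in>carrier TB. (\<Oplus>\<^bsub>TB\<^esub>j\<in>{..<n}. h j x \<odot>\<^bsub>TB\<^esub> y j) = id \<epsilon> \<odot>\<^bsub>T\<^esub> \<one>\<^bsub>T\<^esub> \<odot>\<^bsub>TB\<^esub> x)"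
        by (intro exI[of _ 1] exI[of _ "\<lambda>_. \<one>\<^bsub>B\<^esub>"] exI[of _ "\<lambda>_ b. tens b \<one>\<^bsub>B\<^esub> \<otimes>\<^bsub>T\<^esub> e"]) auto
    qed
  }
qed

section \<open>Kaehler differentials of B over A\<close>

abbreviation "FB \<equiv> free_module B (carrier B)"
abbreviation "krels \<equiv> kaehler_relations A B f"

definition "SK = submodule_generated B FB krels"

definition "\<Omega> = kaehler_differentials A B f"

lemma module_FB: "Module.module B FB" by (rule free_module_module[OF f.S.cring_axioms])

sublocale FB: Module.module B FB by (rule module_FB)

lemma gen_FB: "x \<in> carrier B \<Longrightarrow> free_gen B x \<in> carrier FB"
  by (rule free_gen_closed[OF f.S.cring_axioms])

lemma krels_closed: "krels \<subseteq> carrier FB"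
  unfolding kaehler_relations_def Let_def
  by (auto intro!: FB.minus_closed FB.add.m_closed FB.smult_closed gen_FB)

lemma krels_intros:
  "x \<in> carrier B \<Longrightarrow> y \<in> carrier B \<Longrightarrow>
     free_gen B (x \<oplus>\<^bsub>B\<^esub> y) \<ominus>\<^bsub>FB\<^esub> (free_gen B x \<oplus>\<^bsub>FB\<^esub> free_gen B y) \<in> krels"
  "x \<in> carrier B \<Longrightarrow> y \<in> carrier B \<Longrightarrow>
     free_gen B (x \<otimes>\<^bsub>B\<^esub> y) \<ominus>\<^bsub>FB\<^esub> (x \<odot>\<^bsub>FB\<^esub> free_gen B y \<oplus>\<^bsub>FB\<^esub> y \<odot>\<^bsub>FB\<^esub> free_gen B x) \<in> krels"
  "a \<in> carrier A \<Longrightarrow> free_gen B (f a) \<in> krels"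
  unfolding kaehler_relations_def Let_def by blast+

lemma submodule_SK: "submodule SK B FB"
  unfolding SK_def by (rule submodule_generated_submodule[OF module_FB krels_closed])

lemma \<Omega>_def': "\<Omega> = quotient_module FB SK"
  by (simp add: \<Omega>_def kaehler_differentials_def SK_def)

definition "d x = SK +>\<^bsub>FB\<^esub> free_gen B x"

lemmas \<Omega>_quotient = quotient_module_module[OF module_FB submodule_SK, folded \<Omega>_def']

lemma module_\<Omega>: "Module.module B \<Omega>" by (rule \<Omega>_quotient(1))

sublocale \<Omega>: Module.module B \<Omega> by (rule module_\<Omega>)

lemma quotient_linear: "module_linear B FB \<Omega> (\<lambda>g. SK +>\<^bsub>FB\<^esub> g)"
  by (simp add: module_linear_def \<Omega>_quotient)

lemma quotient_eq_if_rel: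
  assumes "g \<ominus>\<^bsub>FB\<^esub> g' \<in> krels" "g \<in> carrier FB" "g' \<in> carrier FB"
  shows "SK +>\<^bsub>FB\<^esub> g = SK +>\<^bsub>FB\<^esub> g'"
proof -
  have "g \<ominus>\<^bsub>FB\<^esub> g' \<in> SK" unfolding SK_def by (rule subsetD[OF submodule_generated_superset assms(1)])
  then have "SK +>\<^bsub>FB\<^esub> (g \<ominus>\<^bsub>FB\<^esub> g') = \<zero>\<^bsub>\<Omega>\<^esub>" using assms(2,3) by (subst \<Omega>_quotient(5)) auto
  then have "(SK +>\<^bsub>FB\<^esub> g) \<ominus>\<^bsub>\<Omega>\<^esub> (SK +>\<^bsub>FB\<^esub> g') = \<zero>\<^bsub>\<Omega>\<^esub>"
    using module_linearD'(3)[OF module_FB module_\<Omega> quotient_linear assms(2,3)] by simp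
  then show ?thesis
    by (rule \<Omega>.eq_if_minus_eq_zero) (use assms module_linearD(1)[OF quotient_linear] in auto)
qed

lemma d_closed [simp]: "x \<in> carrier B \<Longrightarrow> d x \<in> carrier \<Omega>"
  using module_linearD(1)[OF quotient_linear] by (simp add: d_def gen_FB)

lemma d_add: "x \<in> carrier B \<Longrightarrow> y \<in> carrier B \<Longrightarrow> d (x \<oplus>\<^bsub>B\<^esub> y) = d x \<oplus>\<^bsub>\<Omega>\<^esub> d y"
  using quotient_eq_if_rel[OF krels_intros(1)] by (simp add: d_def gen_FB \<Omega>_quotient(3))

lemma d_mult: "x \<in> carrier B \<Longrightarrow> y \<in> carrier B \<Longrightarrow> d (x \<otimes>\<^bsub>B\<^esub> y) = x \<odot>\<^bsub>\<Omega>\<^esub> d y \<oplus>\<^bsub>\<Omega>\<^esub> y \<odot>\<^bsub>\<Omega>\<^esub> d x"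
  using quotient_eq_if_rel[OF krels_intros(2)] by (simp add: d_def gen_FB \<Omega>_quotient(2,3))

lemma d_f: assumes "a \<in> carrier A" shows "d (f a) = \<zero>\<^bsub>\<Omega>\<^esub>"
proof -
  have "free_gen B (f a) \<in> SK"
    unfolding SK_def by (rule subsetD[OF submodule_generated_superset krels_intros(3)[OF assms]])
  then show ?thesis using assms by (simp add: d_def gen_FB \<Omega>_quotient(5))
qed

text \<open>The d x generate the module over B, and scalars commute, so annihilation extends from
  them to all elements.\<close>

lemma kaehler_almost_zero_iff:
  assumes I: "I \<subseteq> carrier A"
  shows "almost_zero I (restrict_scalars f \<Omega>) \<longleftrightarrow> (\<forall>\<epsilon>\<in>I. \<forall>x\<in>carrier B. f \<epsilon> \<odot>\<^bsub>\<Omega>\<^esub> d x = \<zero>\<^bsub>\<Omega>\<^esub>)"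
proof -
  have "annihilated_by \<epsilon> (restrict_scalars f \<Omega>) \<longleftrightarrow> (\<forall>x\<in>carrier B. f \<epsilon> \<odot>\<^bsub>\<Omega>\<^esub> d x = \<zero>\<^bsub>\<Omega>\<^esub>)" if "\<epsilon> \<in> I" for \<epsilon>
  proof
    have e: "f \<epsilon> \<in> carrier B" using that I by auto
    show "\<forall>x\<in>carrier B. f \<epsilon> \<odot>\<^bsub>\<Omega>\<^esub> d x = \<zero>\<^bsub>\<Omega>\<^esub>" if "annihilated_by \<epsilon> (restrict_scalars f \<Omega>)"
      using that by (simp add: annihilated_by_def restrict_scalars_def)
    assume x: "\<forall>x\<in>carrier B. f \<epsilon> \<odot>\<^bsub>\<Omega>\<^esub> d x = \<zero>\<^bsub>\<Omega>\<^esub>"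
    have "f \<epsilon> \<odot>\<^bsub>\<Omega>\<^esub> (SK +>\<^bsub>FB\<^esub> g) = \<zero>\<^bsub>\<Omega>\<^esub>" if "g \<in> carrier FB" for g
      using f.S.cring_axioms that
    proof (induction rule: free_module_induct)
      case zero
      have "SK +>\<^bsub>FB\<^esub> \<zero>\<^bsub>FB\<^esub> = \<zero>\<^bsub>\<Omega>\<^esub>" by (rule module_linearD'(1)[OF module_FB module_\<Omega> quotient_linear])
      then show ?case using e by simp
    next
      case (add g g')
      then show ?case
        using e module_linearD(1)[OF quotient_linear]
        by (simp add: module_linearD(2)[OF quotient_linear] \<Omega>.smult_r_distr)
    next
      case (gen b y)
      have "f \<epsilon> \<odot>\<^bsub>\<Omega>\<^esub> (b \<odot>\<^bsub>\<Omega>\<^esub> d y) = b \<odot>\<^bsub>\<Omega>\<^esub> (f \<epsilon> \<odot>\<^bsub>\<Omega>\<^esub> d y)"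
        using gen e by (simp flip: \<Omega>.smult_assoc1 add: f.S.m_comm)
      then show ?case using gen x by (simp add: module_linearD(3)[OF quotient_linear] gen_FB d_def)
    qed
    then show "annihilated_by \<epsilon> (restrict_scalars f \<Omega>)"
      by (auto simp: annihilated_by_def restrict_scalars_def \<Omega>_quotient(4))
  qed
  then show ?thesis by (simp add: almost_zero_def)
qed

text \<open>The map \<open>x \<otimes> y \<mapsto> x dy\<close> sends \<open>(1 \<otimes> b) z\<close> and \<open>(b \<otimes> 1) z\<close> to elements that differ by
  \<open>\<mu>(z) db\<close>.\<close>

lemma kills_differentials:
  assumes e: "e \<in> carrier T" and diag: "\<And>x. x \<in> carrier B \<Longrightarrow> tens x \<one>\<^bsub>B\<^esub> \<otimes>\<^bsub>T\<^esub> e = tens \<one>\<^bsub>B\<^esub> x \<otimes>\<^bsub>T\<^esub> e"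
    and b: "b \<in> carrier B"
  shows "\<mu> e \<odot>\<^bsub>\<Omega>\<^esub> d b = \<zero>\<^bsub>\<Omega>\<^esub>"
proof -
  let ?N = "restrict_scalars f \<Omega>" and ?\<phi> = "\<lambda>p. fst p \<odot>\<^bsub>\<Omega>\<^esub> d (snd p)"
  have N: "Module.module A ?N" by (rule restrict_scalars_module[OF hom module_\<Omega>])
  have N_simps: "carrier ?N = carrier \<Omega>" "u \<oplus>\<^bsub>?N\<^esub> v = u \<oplus>\<^bsub>\<Omega>\<^esub> v" "a \<odot>\<^bsub>?N\<^esub> u = f a \<odot>\<^bsub>\<Omega>\<^esub> u" for u v a
    by (simp_all add: restrict_scalars_def)
  have "module_linear A T ?N (tensor_lift ?N ?\<phi>) \<and>
      (\<forall>x\<in>carrier B. \<forall>y\<in>carrier B. tensor_lift ?N ?\<phi> (tens x y) = x \<odot>\<^bsub>\<Omega>\<^esub> d y)"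
  proof -
    have c1: "x \<odot>\<^bsub>\<Omega>\<^esub> (f a \<odot>\<^bsub>\<Omega>\<^esub> d y) = f a \<odot>\<^bsub>\<Omega>\<^esub> (x \<odot>\<^bsub>\<Omega>\<^esub> d y)"
      if "a \<in> carrier A" "x \<in> carrier B" "y \<in> carrier B" for a x y
      using that by (simp flip: \<Omega>.smult_assoc1 add: f.S.m_comm)
    note l = tensor_lift[where \<phi> = ?\<phi>, OF N]
    have "module_linear A T ?N (tensor_lift ?N ?\<phi>)"
      by (rule l(1)) (simp_all add: N_simps d_add d_mult d_f c1 \<Omega>.smult_l_distr \<Omega>.smult_r_distr \<Omega>.smult_assoc1)
    moreover have "tensor_lift ?N ?\<phi> (tens x y) = x \<odot>\<^bsub>\<Omega>\<^esub> d y" if "x \<in> carrier B" "y \<in> carrier B" for x y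
      using l(2)[of x y] that
      by (simp add: N_simps d_add d_mult d_f c1 \<Omega>.smult_l_distr \<Omega>.smult_r_distr \<Omega>.smult_assoc1)
    ultimately show ?thesis by blast
  qed
  then obtain D where D: "module_linear A T ?N D"
    "\<And>x y. x \<in> carrier B \<Longrightarrow> y \<in> carrier B \<Longrightarrow> D (tens x y) = x \<odot>\<^bsub>\<Omega>\<^esub> d y" by blast
  note DD = module_linearD[OF D(1), unfolded N_simps]
  have "D (tens \<one>\<^bsub>B\<^esub> b \<otimes>\<^bsub>T\<^esub> z) = D (tens b \<one>\<^bsub>B\<^esub> \<otimes>\<^bsub>T\<^esub> z) \<oplus>\<^bsub>\<Omega>\<^esub> \<mu> z \<odot>\<^bsub>\<Omega>\<^esub> d b" if "z \<in> carrier T" for z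
    using that
  proof (induction rule: T_induct)
    case (add u v)
    then show ?case using b by (simp add: T.r_distr DD \<Omega>.smult_l_distr \<Omega>.a_ac)
  next
    case (tens x y)
    then show ?case
      using b by (simp add: tens_mult D(2) d_mult \<Omega>.smult_r_distr f.S.m_comm flip: \<Omega>.smult_assoc1)
  qed
  from this[OF e] have "D (tens b \<one>\<^bsub>B\<^esub> \<otimes>\<^bsub>T\<^esub> e) = D (tens b \<one>\<^bsub>B\<^esub> \<otimes>\<^bsub>T\<^esub> e) \<oplus>\<^bsub>\<Omega>\<^esub> \<mu> e \<odot>\<^bsub>\<Omega>\<^esub> d b"
    using diag[OF b] by simp
  then show ?thesis using DD(1)[of "tens b \<one>\<^bsub>B\<^esub> \<otimes>\<^bsub>T\<^esub> e"] b e by simp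
qed

end

text \<open>Taken at p = x \<otimes> 1, q = y \<otimes> 1, p' = 1 \<otimes> x and q' = 1 \<otimes>
  y, this says that b \<mapsto> 1 \<otimes> b - b \<otimes> 1 obeys the Leibniz rule up to a product
  of two elements of J.\<close>

lemma (in cring) leibniz_defect:
  assumes "p \<in> carrier R" "q \<in> carrier R" "p' \<in> carrier R" "q' \<in> carrier R"
  shows "(p' \<otimes> q' \<ominus> p \<otimes> q) \<ominus> (p \<otimes> (q' \<ominus> q) \<oplus> q \<otimes> (p' \<ominus> p)) = (p' \<ominus> p) \<otimes> (q' \<ominus> q)"
  using assms by algebra

context ring_tensor
begin

section \<open>The elements 1 \<otimes> b - b \<otimes> 1 and the almost idempotent of the
  diagonal\<close>

definition "\<delta> b = tens \<one>\<^bsub>B\<^esub> b \<ominus>\<^bsub>T\<^esub> tens b \<one>\<^bsub>B\<^esub>"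

lemma \<delta>_closed [simp]: "b \<in> carrier B \<Longrightarrow> \<delta> b \<in> carrier T"
  by (simp add: \<delta>_def)

lemma \<mu>_\<delta> [simp]: "b \<in> carrier B \<Longrightarrow> \<mu> (\<delta> b) = \<zero>\<^bsub>B\<^esub>"
  by (simp add: \<delta>_def a_minus_def f.S.r_neg)

lemma \<delta>_linear: "module_linear A C T \<delta>"
  unfolding module_linear_def
proof (intro conjI ballI)
  fix x y assume "x \<in> carrier C" "y \<in> carrier C"
  then show "\<delta> (x \<oplus>\<^bsub>C\<^esub> y) = \<delta> x \<oplus>\<^bsub>T\<^esub> \<delta> y"
    using tens_add_left[of x y "\<one>\<^bsub>B\<^esub>"] tens_add_right[of "\<one>\<^bsub>B\<^esub>" x y]
    by (simp add: \<delta>_def a_minus_def TM.minus_add TM.a_ac)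
next
  fix a x assume "a \<in> carrier A" "x \<in> carrier C"
  then show "\<delta> (a \<odot>\<^bsub>C\<^esub> x) = a \<odot>\<^bsub>T\<^esub> \<delta> x"
    using tens_smult_left[of a x "\<one>\<^bsub>B\<^esub>"] tens_smult_right[of a "\<one>\<^bsub>B\<^esub>" x]
    by (simp add: \<delta>_def a_minus_def TM.smult_r_distr TM.smult_r_minus)
qed simp

lemma \<delta>_f: "a \<in> carrier A \<Longrightarrow> \<delta> (f a) = \<zero>\<^bsub>T\<^esub>"
  by (simp add: \<delta>_def tens_f a_minus_def TM.r_neg)

lemma \<delta>_mult:
  assumes x: "x \<in> carrier B" and y: "y \<in> carrier B"
  shows "\<delta> (x \<otimes>\<^bsub>B\<^esub> y) \<ominus>\<^bsub>T\<^esub> (tens x \<one>\<^bsub>B\<^esub> \<otimes>\<^bsub>T\<^esub> \<delta> y \<oplus>\<^bsub>T\<^esub> tens y \<one>\<^bsub>B\<^esub> \<otimes>\<^bsub>T\<^esub> \<delta> x) = \<delta> x \<otimes>\<^bsub>T\<^esub> \<delta> y"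
proof -
  have "\<delta> (x \<otimes>\<^bsub>B\<^esub> y) = tens \<one>\<^bsub>B\<^esub> x \<otimes>\<^bsub>T\<^esub> tens \<one>\<^bsub>B\<^esub> y \<ominus>\<^bsub>T\<^esub> tens x \<one>\<^bsub>B\<^esub> \<otimes>\<^bsub>T\<^esub> tens y \<one>\<^bsub>B\<^esub>"
    using x y by (simp add: \<delta>_def tens_mult)
  then show ?thesis
    using T.leibniz_defect[of "tens x \<one>\<^bsub>B\<^esub>" "tens y \<one>\<^bsub>B\<^esub>" "tens \<one>\<^bsub>B\<^esub> x" "tens \<one>\<^bsub>B\<^esub> y"] x y
    by (simp add: \<delta>_def)
qed

text \<open>The left factor makes T a B-module; for this structure \<delta> is compared with the
  universal derivation d.\<close>

lemma left_hom: "ring_hom_cring B T (\<lambda>b. tens b \<one>\<^bsub>B\<^esub>)"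
proof (rule ring_hom_cring.intro[OF f.S.cring_axioms cringT], unfold ring_hom_cring_axioms_def, rule ring_hom_memI)
  fix x y assume "x \<in> carrier B" "y \<in> carrier B"
  then show "tens (x \<otimes>\<^bsub>B\<^esub> y) \<one>\<^bsub>B\<^esub> = tens x \<one>\<^bsub>B\<^esub> \<otimes>\<^bsub>T\<^esub> tens y \<one>\<^bsub>B\<^esub>"
    "tens (x \<oplus>\<^bsub>B\<^esub> y) \<one>\<^bsub>B\<^esub> = tens x \<one>\<^bsub>B\<^esub> \<oplus>\<^bsub>T\<^esub> tens y \<one>\<^bsub>B\<^esub>"
    using tens_add_left[of x y "\<one>\<^bsub>B\<^esub>"] by (simp_all add: tens_mult)
qed (simp_all add: tens_one)

text \<open>Let \<open>J\<close> be the kernel of \<open>\<mu>\<close>, which is almost generated by the \<open>\<delta> (x j)\<close>.  Since \<open>\<Omega>\<close> is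
  \<open>J / J\<^sup>2\<close>, its vanishing up to \<open>\<epsilon>\<close> expresses \<open>\<epsilon>\<^sup>2 \<delta> (x i)\<close> as a combination of the \<open>\<delta> (x j)\<close> with
  coefficients in \<open>J\<close>.\<close>

lemma exists_almost_diagonal:
  fixes n :: nat
  assumes \<epsilon>: "\<epsilon> \<in> carrier A" and x: "\<And>j. j < n \<Longrightarrow> x j \<in> carrier B"
    and rep: "\<And>b. b \<in> carrier B \<Longrightarrow> \<exists>a. (\<forall>j<n. a j \<in> carrier A) \<and> f \<epsilon> \<otimes>\<^bsub>B\<^esub> b = (\<Oplus>\<^bsub>C\<^esub>j\<in>{..<n}. a j \<odot>\<^bsub>C\<^esub> x j)"
    and \<Omega>: "\<And>b. b \<in> carrier B \<Longrightarrow> f \<epsilon> \<odot>\<^bsub>\<Omega>\<^esub> d b = \<zero>\<^bsub>\<Omega>\<^esub>"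
  shows "\<exists>e\<in>carrier T. \<mu> e = f \<epsilon> [^]\<^bsub>B\<^esub> (2 * (2 ^ n - 1) + 1 :: nat) \<and>
      (\<forall>b\<in>carrier B. tens b \<one>\<^bsub>B\<^esub> \<otimes>\<^bsub>T\<^esub> e = tens \<one>\<^bsub>B\<^esub> b \<otimes>\<^bsub>T\<^esub> e)"
proof -
  define E where "E = tens (f \<epsilon>) \<one>\<^bsub>B\<^esub>"
  have E: "E \<in> carrier T" "\<mu> E = f \<epsilon>" using \<epsilon> by (simp_all add: E_def)
  have E_smult: "E \<otimes>\<^bsub>T\<^esub> z = \<epsilon> \<odot>\<^bsub>T\<^esub> z" if "z \<in> carrier T" for z using smult_T[OF \<epsilon> that] by (simp add: E_def)
  \<comment> \<open>Since \<delta> is A-linear, the almost generation of B by the \<open>x j\<close>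
    carries over to the elements \<delta> b.\<close>
  have E\<delta>: "\<exists>a. (\<forall>j<n. a j \<in> carrier A) \<and> E \<otimes>\<^bsub>T\<^esub> \<delta> b = (\<Oplus>\<^bsub>T\<^esub>j\<in>{..<n}. a j \<odot>\<^bsub>T\<^esub> \<delta> (x j))"
    if b: "b \<in> carrier B" for b
  proof -
    obtain a where a: "\<And>j. j < n \<Longrightarrow> a j \<in> carrier A" "f \<epsilon> \<otimes>\<^bsub>B\<^esub> b = (\<Oplus>\<^bsub>C\<^esub>j\<in>{..<n}. a j \<odot>\<^bsub>C\<^esub> x j)"
      using rep[OF b] by blast
    have "E \<otimes>\<^bsub>T\<^esub> \<delta> b = \<delta> (f \<epsilon> \<otimes>\<^bsub>B\<^esub> b)"
      using module_linearD(3)[OF \<delta>_linear \<epsilon>, of b] b by (simp add: E_smult)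
    also have "\<dots> = (\<Oplus>\<^bsub>T\<^esub>j\<in>{..<n}. \<delta> (a j \<odot>\<^bsub>C\<^esub> x j))"
      unfolding a(2) by (rule linear_finsum[OF module_C moduleT \<delta>_linear]) (use a(1) x in simp)
    also have "\<dots> = (\<Oplus>\<^bsub>T\<^esub>j\<in>{..<n}. a j \<odot>\<^bsub>T\<^esub> \<delta> (x j))"
      by (rule TM.finsum_cong')
         (use a(1) x module_linearD(3)[OF \<delta>_linear] in \<open>auto simp del: C_simps simp: C_simps(1)\<close>)
    finally show ?thesis using a(1) by blast
  qed
  define comb where "comb c = (\<Oplus>\<^bsub>T\<^esub>j\<in>{..<n}. c j \<otimes>\<^bsub>T\<^esub> \<delta> (x j))" for c
  \<comment> \<open>In this proof J collects coefficient tuples with entries in the kernel of \<mu>.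
    Their combinations W of the \<open>\<delta> (x j)\<close> take the place of the square of that
    kernel.\<close>
  define J where "J = {c. \<forall>j<n. c j \<in> carrier T \<and> \<mu> (c j) = \<zero>\<^bsub>B\<^esub>}"
  define W where "W = comb ` J"
  have cl: "(\<lambda>j. c j \<otimes>\<^bsub>T\<^esub> \<delta> (x j)) \<in> {..<n} \<rightarrow> carrier T" if "c \<in> J" for c using that x
    by (auto simp: J_def)
  have W_closed: "W \<subseteq> carrier T" unfolding W_def comb_def using cl by (auto intro: TM.finsum_closed)
  have W_mult: "z \<otimes>\<^bsub>T\<^esub> w \<in> W" if z: "z \<in> carrier T" and w: "w \<in> W" for z w
  proof -
    obtain c where c: "c \<in> J" "w = comb c" using w by (auto simp: W_def)
    have "z \<otimes>\<^bsub>T\<^esub> w = (\<Oplus>\<^bsub>T\<^esub>j\<in>{..<n}. z \<otimes>\<^bsub>T\<^esub> (c j \<otimes>\<^bsub>T\<^esub> \<delta> (x j)))"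
      unfolding c(2) comb_def using cl[OF c(1)] z by (simp add: T.finsum_rdistr)
    also have "\<dots> = comb (\<lambda>j. z \<otimes>\<^bsub>T\<^esub> c j)"
      unfolding comb_def by (rule TM.finsum_cong') (use c(1) x z in \<open>auto simp: J_def T.m_assoc\<close>)
    finally show ?thesis using c(1) z by (auto simp: W_def J_def)
  qed
  have W_add: "w \<oplus>\<^bsub>T\<^esub> w' \<in> W" if w: "w \<in> W" and w': "w' \<in> W" for w w'
  proof -
    obtain c c' where c: "c \<in> J" "w = comb c" and c': "c' \<in> J" "w' = comb c'" using w w'
      by (auto simp: W_def)
    have "w \<oplus>\<^bsub>T\<^esub> w' = (\<Oplus>\<^bsub>T\<^esub>j\<in>{..<n}. c j \<otimes>\<^bsub>T\<^esub> \<delta> (x j) \<oplus>\<^bsub>T\<^esub> c' j \<otimes>\<^bsub>T\<^esub> \<delta> (x j))"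
      unfolding c(2) c'(2) comb_def by (rule TM.finsum_addf[symmetric, OF cl[OF c(1)] cl[OF c'(1)]])
    also have "\<dots> = comb (\<lambda>j. c j \<oplus>\<^bsub>T\<^esub> c' j)"
      unfolding comb_def by (rule TM.finsum_cong') (use c(1) c'(1) x in \<open>auto simp: J_def T.l_distr\<close>)
    finally show ?thesis using c(1) c'(1) by (auto simp: W_def J_def)
  qed
  have W_zero: "\<zero>\<^bsub>T\<^esub> \<in> W"
  proof -
    have "comb (\<lambda>_. \<zero>\<^bsub>T\<^esub>) = (\<Oplus>\<^bsub>T\<^esub>j\<in>{..<n}. \<zero>\<^bsub>T\<^esub>)"
      unfolding comb_def by (rule TM.finsum_cong') (use x in auto)
    then show ?thesis by (auto simp: W_def J_def intro!: image_eqI[of _ _ "\<lambda>_. \<zero>\<^bsub>T\<^esub>"])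
  qed
  \<comment> \<open>Q is the ideal of the elements that E moves into W. It contains the products
    \<delta> b \<delta> b', because E expresses \<delta> b by the \<open>\<delta> (x j)\<close>
    while \<delta> b' lies in the kernel of \<mu>.\<close>
  define Q where "Q = {z \<in> carrier T. E \<otimes>\<^bsub>T\<^esub> z \<in> W}"
  have Q_mult: "z \<otimes>\<^bsub>T\<^esub> q \<in> Q" if "z \<in> carrier T" "q \<in> Q" for z q
    using that W_mult[of z "E \<otimes>\<^bsub>T\<^esub> q"] E(1) by (simp add: Q_def T.m_lcomm)
  have Q_add: "q \<oplus>\<^bsub>T\<^esub> q' \<in> Q" if "q \<in> Q" "q' \<in> Q" for q q'
    using that W_add E(1) by (simp add: Q_def T.r_distr)
  have Q_zero: "\<zero>\<^bsub>T\<^esub> \<in> Q" using W_zero E(1) by (simp add: Q_def)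
  have Q_closed: "Q \<subseteq> carrier T" by (auto simp: Q_def)
  have \<delta>\<delta>: "\<delta> b \<otimes>\<^bsub>T\<^esub> \<delta> b' \<in> Q" if b: "b \<in> carrier B" and b': "b' \<in> carrier B" for b b'
  proof -
    obtain a where a: "\<And>j. j < n \<Longrightarrow> a j \<in> carrier A" "E \<otimes>\<^bsub>T\<^esub> \<delta> b = (\<Oplus>\<^bsub>T\<^esub>j\<in>{..<n}. a j \<odot>\<^bsub>T\<^esub> \<delta> (x j))"
      using E\<delta>[OF b] by blast
    have "E \<otimes>\<^bsub>T\<^esub> (\<delta> b \<otimes>\<^bsub>T\<^esub> \<delta> b') = (\<Oplus>\<^bsub>T\<^esub>j\<in>{..<n}. a j \<odot>\<^bsub>T\<^esub> \<delta> (x j)) \<otimes>\<^bsub>T\<^esub> \<delta> b'"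
      using E(1) b b' by (simp flip: a(2) T.m_assoc)
    also have "\<dots> = (\<Oplus>\<^bsub>T\<^esub>j\<in>{..<n}. (a j \<odot>\<^bsub>T\<^esub> \<delta> (x j)) \<otimes>\<^bsub>T\<^esub> \<delta> b')"
      by (rule T.finsum_ldistr) (use a(1) x b' in auto)
    also have "\<dots> = comb (\<lambda>j. a j \<odot>\<^bsub>T\<^esub> \<delta> b')"
      unfolding comb_def
    proof (rule TM.finsum_cong')
      fix j assume "j \<in> {..<n}"
      then show "(a j \<odot>\<^bsub>T\<^esub> \<delta> (x j)) \<otimes>\<^bsub>T\<^esub> \<delta> b' = (a j \<odot>\<^bsub>T\<^esub> \<delta> b') \<otimes>\<^bsub>T\<^esub> \<delta> (x j)"
        using a(1) x b' by (simp add: smult_T T.m_ac)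
    qed (use a(1) x b' in auto)
    finally have "E \<otimes>\<^bsub>T\<^esub> (\<delta> b \<otimes>\<^bsub>T\<^esub> \<delta> b') = comb (\<lambda>j. a j \<odot>\<^bsub>T\<^esub> \<delta> b')" .
    moreover have "(\<lambda>j. a j \<odot>\<^bsub>T\<^esub> \<delta> b') \<in> J" using a(1) b' by (simp add: J_def \<mu>_smult)
    ultimately show ?thesis using b b' by (auto simp: Q_def W_def)
  qed
  let ?L = "restrict_scalars (\<lambda>b. tens b \<one>\<^bsub>B\<^esub>) (self_algebra T)"
  have L: "Module.module B ?L"
    by (rule restrict_scalars_module[OF left_hom self_algebra_module[OF cringT]])
  interpret L: Module.module B ?L by (rule L)
  have L_simps: "carrier ?L = carrier T" "\<zero>\<^bsub>?L\<^esub> = \<zero>\<^bsub>T\<^esub>" "u \<oplus>\<^bsub>?L\<^esub> v = u \<oplus>\<^bsub>T\<^esub> v" "b \<odot>\<^bsub>?L\<^esub> u = tens b \<one>\<^bsub>B\<^esub> \<otimes>\<^bsub>T\<^esub> u"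
    for u v b
    by (simp_all add: restrict_scalars_def self_algebra_def)
  have L_neg: "\<ominus>\<^bsub>?L\<^esub> u = \<ominus>\<^bsub>T\<^esub> u" if "u \<in> carrier T" for u
  proof (rule L.minus_equality)
    show "\<ominus>\<^bsub>T\<^esub> u \<oplus>\<^bsub>?L\<^esub> u = \<zero>\<^bsub>?L\<^esub>" using that by (simp add: L_simps TM.l_neg)
  qed (use that in \<open>simp_all add: L_simps\<close>)
  \<comment> \<open>The generator that represents d b is sent to \<delta> b. Modulo Q, \<delta> is a
    derivation that vanishes on A, so \<Phi> maps all relations between differentials into
    Q.\<close>
  define \<Phi> where "\<Phi> = free_lift B ?L \<delta>"
  have \<Phi>: "module_linear B FB ?L \<Phi>" unfolding \<Phi>_def
    by (rule free_lift_module_linear[OF L]) (simp add: L_simps)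
  have \<Phi>_gen: "\<Phi> (free_gen B b) = \<delta> b" if "b \<in> carrier B" for b
    unfolding \<Phi>_def by (rule free_lift_free_gen[OF L]) (simp add: L_simps that)
  note \<Phi>D = module_linearD[OF \<Phi>, unfolded L_simps]
  have \<Phi>_minus: "\<Phi> (g \<ominus>\<^bsub>FB\<^esub> g') = \<Phi> g \<ominus>\<^bsub>T\<^esub> \<Phi> g'" if "g \<in> carrier FB" "g' \<in> carrier FB" for g g'
    using module_linearD'(3)[OF module_FB L \<Phi> that] \<Phi>D(1) that by (simp add: a_minus_def L_simps L_neg)
  have sub: "submodule {g \<in> carrier FB. \<Phi> g \<in> Q} B FB"
  proof (rule FB.submoduleI)
    show "\<zero>\<^bsub>FB\<^esub> \<in> {g \<in> carrier FB. \<Phi> g \<in> Q}"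
      using module_linearD'(1)[OF module_FB L \<Phi>] Q_zero by (simp add: L_simps)
    show "\<ominus>\<^bsub>FB\<^esub> g \<in> {g \<in> carrier FB. \<Phi> g \<in> Q}" if "g \<in> {g \<in> carrier FB. \<Phi> g \<in> Q}" for g
    proof -
      have "\<ominus>\<^bsub>T\<^esub> \<Phi> g = (\<ominus>\<^bsub>T\<^esub> \<one>\<^bsub>T\<^esub>) \<otimes>\<^bsub>T\<^esub> \<Phi> g" using that Q_closed by (simp add: T.l_minus subset_iff)
      then have "\<ominus>\<^bsub>T\<^esub> \<Phi> g \<in> Q" using that Q_mult by simp
      then show ?thesis using that module_linearD'(2)[OF module_FB L \<Phi>] \<Phi>D(1) by (simp add: L_neg)
    qed
  qed (auto simp: \<Phi>D Q_add Q_mult)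
  have gen_rels: "krels \<subseteq> {g \<in> carrier FB. \<Phi> g \<in> Q}"
  proof
    fix r assume r: "r \<in> krels"
    then have "\<Phi> r \<in> Q"
      unfolding kaehler_relations_def Let_def
    proof (elim UnE CollectE exE conjE)
      fix y z assume eq: "r
        = free_gen B (y \<oplus>\<^bsub>B\<^esub> z) \<ominus>\<^bsub>FB\<^esub> (free_gen B y \<oplus>\<^bsub>FB\<^esub> free_gen B z)" and yz: "y \<in> carrier B"
        "z \<in> carrier B"
      have "\<Phi> r = \<delta> (y \<oplus>\<^bsub>B\<^esub> z) \<ominus>\<^bsub>T\<^esub> (\<delta> y \<oplus>\<^bsub>T\<^esub> \<delta> z)"
        unfolding eq using yz by (subst \<Phi>_minus) (simp_all add: gen_FB \<Phi>D \<Phi>_gen)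
      then show ?thesis
        using module_linearD(2)[OF \<delta>_linear, of y z] yz Q_zero by (simp add: a_minus_def TM.r_neg)
    next
      fix y z assume eq: "r = free_gen B (y \<otimes>\<^bsub>B\<^esub> z) \<ominus>\<^bsub>FB\<^esub> (y \<odot>\<^bsub>FB\<^esub> free_gen B z \<oplus>\<^bsub>FB\<^esub> z \<odot>\<^bsub>FB\<^esub> free_gen B y)"
        and yz: "y \<in> carrier B" "z \<in> carrier B"
      have "\<Phi> r = \<delta> (y \<otimes>\<^bsub>B\<^esub> z) \<ominus>\<^bsub>T\<^esub> (tens y \<one>\<^bsub>B\<^esub> \<otimes>\<^bsub>T\<^esub> \<delta> z \<oplus>\<^bsub>T\<^esub> tens z \<one>\<^bsub>B\<^esub> \<otimes>\<^bsub>T\<^esub> \<delta> y)"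
        unfolding eq using yz by (subst \<Phi>_minus) (simp_all add: gen_FB \<Phi>D \<Phi>_gen)
      then show ?thesis using \<delta>_mult[OF yz] \<delta>\<delta>[OF yz] by simp
    next
      fix a assume "r = free_gen B (f a)" "a \<in> carrier A"
      then show ?thesis using Q_zero by (simp add: \<Phi>_gen \<delta>_f)
    qed
    then show "r \<in> {g \<in> carrier FB. \<Phi> g \<in> Q}" using r krels_closed by auto
  qed
  have SK: "SK \<subseteq> {g \<in> carrier FB. \<Phi> g \<in> Q}" unfolding SK_def
    by (rule submodule_generated_least[OF sub gen_rels])
  \<comment> \<open>One factor E makes d b vanish, which puts E \<delta> b into Q; the other leads
    from Q into W.\<close>
  have EE: "(E \<otimes>\<^bsub>T\<^esub> E) \<otimes>\<^bsub>T\<^esub> \<delta> b \<in> W" if b: "b \<in> carrier B" for b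
  proof -
    have "SK +>\<^bsub>FB\<^esub> (f \<epsilon> \<odot>\<^bsub>FB\<^esub> free_gen B b) = \<zero>\<^bsub>\<Omega>\<^esub>"
      using \<Omega>[OF b] \<epsilon> b by (simp add: d_def gen_FB \<Omega>_quotient(2))
    then have "f \<epsilon> \<odot>\<^bsub>FB\<^esub> free_gen B b \<in> SK" using \<epsilon> b
      by (subst (asm) \<Omega>_quotient(5)) (simp_all add: gen_FB)
    then have "\<Phi> (f \<epsilon> \<odot>\<^bsub>FB\<^esub> free_gen B b) \<in> Q" using SK by auto
    then have "E \<otimes>\<^bsub>T\<^esub> \<delta> b \<in> Q" using \<epsilon> b by (simp add: \<Phi>D gen_FB \<Phi>_gen E_def)
    then show ?thesis using E(1) b by (simp add: Q_def T.m_assoc)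
  qed
  have "\<exists>\<Delta>\<in>carrier T. \<mu> \<Delta> = \<mu> (E \<otimes>\<^bsub>T\<^esub> E) [^]\<^bsub>B\<^esub> (2 ^ n - 1 :: nat) \<and> (\<forall>i<n. \<Delta> \<otimes>\<^bsub>T\<^esub> \<delta> (x i) = \<zero>\<^bsub>T\<^esub>)"
  proof (rule \<mu>.kill_generators)
    fix i assume "i < n"
    then obtain c where "c \<in> J" "(E \<otimes>\<^bsub>T\<^esub> E) \<otimes>\<^bsub>T\<^esub> \<delta> (x i) = comb c" using EE[OF x] by (auto simp: W_def)
    then show "\<exists>c. (\<forall>j<n. c j \<in> carrier T \<and> \<mu> (c j) = \<zero>\<^bsub>B\<^esub>) \<and>
        E \<otimes>\<^bsub>T\<^esub> E \<otimes>\<^bsub>T\<^esub> \<delta> (x i) = (\<Oplus>\<^bsub>T\<^esub>j\<in>{..<n}. c j \<otimes>\<^bsub>T\<^esub> \<delta> (x j))"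
      unfolding J_def comb_def by blast
  qed (use x E in auto)
  then obtain \<Delta> where \<Delta>: "\<Delta> \<in> carrier T" "\<mu> \<Delta> = \<mu> (E \<otimes>\<^bsub>T\<^esub> E) [^]\<^bsub>B\<^esub> (2 ^ n - 1 :: nat)"
    "\<And>i. i < n \<Longrightarrow> \<Delta> \<otimes>\<^bsub>T\<^esub> \<delta> (x i) = \<zero>\<^bsub>T\<^esub>" by blast
  \<comment> \<open>\<Delta> is only known to annihilate the \<open>\<delta> (x j)\<close>. A
    further E expresses \<delta> b by them, and accounts for the + 1 in the exponent.\<close>
  have "\<Delta> \<otimes>\<^bsub>T\<^esub> E \<otimes>\<^bsub>T\<^esub> \<delta> b = \<zero>\<^bsub>T\<^esub>" if b: "b \<in> carrier B" for b
  proof -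
    obtain a where a: "\<And>j. j < n \<Longrightarrow> a j \<in> carrier A" "E \<otimes>\<^bsub>T\<^esub> \<delta> b = (\<Oplus>\<^bsub>T\<^esub>j\<in>{..<n}. a j \<odot>\<^bsub>T\<^esub> \<delta> (x j))"
      using E\<delta>[OF b] by blast
    have "\<Delta> \<otimes>\<^bsub>T\<^esub> E \<otimes>\<^bsub>T\<^esub> \<delta> b = \<Delta> \<otimes>\<^bsub>T\<^esub> (\<Oplus>\<^bsub>T\<^esub>j\<in>{..<n}. a j \<odot>\<^bsub>T\<^esub> \<delta> (x j))"
      using \<Delta>(1) E(1) b by (simp add: T.m_assoc a(2))
    also have "\<dots> = (\<Oplus>\<^bsub>T\<^esub>j\<in>{..<n}. \<Delta> \<otimes>\<^bsub>T\<^esub> (a j \<odot>\<^bsub>T\<^esub> \<delta> (x j)))"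
      by (rule T.finsum_rdistr) (use \<Delta>(1) a(1) x in auto)
    also have "\<dots> = (\<Oplus>\<^bsub>T\<^esub>j\<in>{..<n}. \<zero>\<^bsub>T\<^esub>)"
    proof (rule TM.finsum_cong')
      fix j assume "j \<in> {..<n}"
      then have j: "j < n" by simp
      have "\<Delta> \<otimes>\<^bsub>T\<^esub> (a j \<odot>\<^bsub>T\<^esub> \<delta> (x j)) = tens (f (a j)) \<one>\<^bsub>B\<^esub> \<otimes>\<^bsub>T\<^esub> (\<Delta> \<otimes>\<^bsub>T\<^esub> \<delta> (x j))"
        using \<Delta>(1) a(1)[OF j] x[OF j] by (simp add: smult_T T.m_lcomm)
      then show "\<Delta> \<otimes>\<^bsub>T\<^esub> (a j \<odot>\<^bsub>T\<^esub> \<delta> (x j)) = \<zero>\<^bsub>T\<^esub>" using \<Delta>(3)[OF j] a(1)[OF j] by simp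
    qed auto
    finally show ?thesis by simp
  qed
  then have diag: "tens b \<one>\<^bsub>B\<^esub> \<otimes>\<^bsub>T\<^esub> (\<Delta> \<otimes>\<^bsub>T\<^esub> E) = tens \<one>\<^bsub>B\<^esub> b \<otimes>\<^bsub>T\<^esub> (\<Delta> \<otimes>\<^bsub>T\<^esub> E)" if b: "b \<in> carrier B" for b
  proof -
    have "tens \<one>\<^bsub>B\<^esub> b \<otimes>\<^bsub>T\<^esub> (\<Delta> \<otimes>\<^bsub>T\<^esub> E) \<ominus>\<^bsub>T\<^esub> tens b \<one>\<^bsub>B\<^esub> \<otimes>\<^bsub>T\<^esub> (\<Delta> \<otimes>\<^bsub>T\<^esub> E) = \<Delta> \<otimes>\<^bsub>T\<^esub> E \<otimes>\<^bsub>T\<^esub> \<delta> b"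
      using \<Delta>(1) E(1) b by (simp add: \<delta>_def a_minus_def T.r_distr T.r_minus T.m_comm)
    then have "tens \<one>\<^bsub>B\<^esub> b \<otimes>\<^bsub>T\<^esub> (\<Delta> \<otimes>\<^bsub>T\<^esub> E) \<ominus>\<^bsub>T\<^esub> tens b \<one>\<^bsub>B\<^esub> \<otimes>\<^bsub>T\<^esub> (\<Delta> \<otimes>\<^bsub>T\<^esub> E) = \<zero>\<^bsub>T\<^esub>"
      using \<open>\<And>b. b \<in> carrier B \<Longrightarrow> \<Delta> \<otimes>\<^bsub>T\<^esub> E \<otimes>\<^bsub>T\<^esub> \<delta> b = \<zero>\<^bsub>T\<^esub>\<close>[OF b] by simp
    then have "tens \<one>\<^bsub>B\<^esub> b \<otimes>\<^bsub>T\<^esub> (\<Delta> \<otimes>\<^bsub>T\<^esub> E) = tens b \<one>\<^bsub>B\<^esub> \<otimes>\<^bsub>T\<^esub> (\<Delta> \<otimes>\<^bsub>T\<^esub> E)"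
      by (rule TM.eq_if_minus_eq_zero) (use \<Delta>(1) E(1) b in auto)
    then show ?thesis by simp
  qed
  have "\<mu> (\<Delta> \<otimes>\<^bsub>T\<^esub> E) = f \<epsilon> [^]\<^bsub>B\<^esub> (2 * (2 ^ n - 1) + 1 :: nat)"
    using \<Delta>(1,2) E \<epsilon> by (simp add: f.S.nat_pow_distrib f.S.nat_pow_mult mult_2)
  then show ?thesis using diag \<Delta>(1) E(1) by (intro bexI[of _ "\<Delta> \<otimes>\<^bsub>T\<^esub> E"]) auto
qed

end

section \<open>Almost finite presentation and the criterion for rings with almost bases\<close>

lemma free_lift_lessThan:
  assumes M: "Module.module A M" and \<phi>: "\<And>j. j < n \<Longrightarrow> \<phi> j \<in> carrier M"
    and g: "g \<in> carrier (free_module A {..<n::nat})"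
  shows "free_lift A M \<phi> g = (\<Oplus>\<^bsub>M\<^esub>j\<in>{..<n}. g j \<odot>\<^bsub>M\<^esub> \<phi> j)"
proof -
  interpret M: Module.module A M by fact
  have gD: "g j \<in> carrier A" "j \<notin> {..<n} \<Longrightarrow> g j = \<zero>\<^bsub>A\<^esub>" for j using g by (auto simp: free_module_simps)
  show ?thesis
    unfolding free_lift_def
  proof (rule M.add.finprod_mono_neutral_cong_left)
    show "{x. g x \<noteq> \<zero>\<^bsub>A\<^esub>} \<subseteq> {..<n}" using gD(2) by blast
  qed (use \<phi> gD(1) in \<open>auto simp: M.smult_l_null\<close>)
qed

lemma submodule_generated_empty:
  assumes M: "Module.module A M"
  shows "submodule_generated A M {} = {\<zero>\<^bsub>M\<^esub>}"
proof
  interpret M: Module.module A M by fact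
  have "submodule {\<zero>\<^bsub>M\<^esub>} A M" by (rule M.submoduleI) auto
  then show "submodule_generated A M {} \<subseteq> {\<zero>\<^bsub>M\<^esub>}" by (rule submodule_generated_least) simp
  show "{\<zero>\<^bsub>M\<^esub>} \<subseteq> submodule_generated A M {}"
    using submodule_zero[OF submodule_generated_submodule[OF M empty_subsetI]] by simp
qed

lemma finitely_presented_free:
  assumes "cring A"
  shows "finitely_presented A (free_module A {..<n::nat})"
proof -
  let ?P = "free_module A {..<n}"
  have P: "Module.module A ?P" by (rule free_module_module[OF assms])
  interpret P: Module.module A ?P by (rule P)
  have "restrict (\<lambda>x. x) (carrier ?P) \<in> module_hom A ?P ?P"
    by (rule restrict_module_hom[OF P]) (simp add: module_linear_def)
  moreover have "a_kernel ?P ?P (restrict (\<lambda>x. x) (carrier ?P)) = submodule_generated A ?P {}"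
    unfolding submodule_generated_empty[OF P] by (auto simp: a_kernel_def')
  ultimately show ?thesis unfolding finitely_presented_def
    by (intro exI[of _ n] bexI[of _ "restrict (\<lambda>x. x) (carrier ?P)"] conjI exI[of _ "{}"]) auto
qed

text \<open>The free module on an almost basis is the required approximation: by independence its
  map to M has zero kernel, and by almost generation \<epsilon> annihilates the cokernel.\<close>

lemma almost_finitely_presented_if_almost_basis:
  fixes M :: "('a, 'm) module"
  assumes M: "Module.module A M" and u: "u ` I \<subseteq> carrier A"
    and basis: "\<And>\<epsilon>. \<epsilon> \<in> I \<Longrightarrow> \<exists>(n::nat) y. (\<forall>j<n. y j \<in> carrier M) \<and>
        (\<forall>b\<in>carrier M. \<exists>a. (\<forall>j<n. a j \<in> carrier A) \<and> u \<epsilon> \<odot>\<^bsub>M\<^esub> b = (\<Oplus>\<^bsub>M\<^esub>j\<in>{..<n}. a j \<odot>\<^bsub>M\<^esub> y j)) \<and>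
        (\<forall>a. (\<forall>j<n. a j \<in> carrier A) \<longrightarrow> (\<Oplus>\<^bsub>M\<^esub>j\<in>{..<n}. a j \<odot>\<^bsub>M\<^esub> y j) = \<zero>\<^bsub>M\<^esub> \<longrightarrow> (\<forall>j<n. a j = \<zero>\<^bsub>A\<^esub>))"
  shows "almost_finitely_presented I u A M"
proof (rule almost_finitely_presentedI[OF M u])
  fix \<epsilon> assume e: "\<epsilon> \<in> I"
  interpret M: Module.module A M by fact
  have ue: "u \<epsilon> \<in> carrier A" using u e by auto
  obtain n :: nat and y where y: "\<And>j. j < n \<Longrightarrow> y j \<in> carrier M"
    and span: "\<And>b. b \<in> carrier M \<Longrightarrow> \<exists>a. (\<forall>j<n. a j \<in> carrier A) \<and> u \<epsilon> \<odot>\<^bsub>M\<^esub> b = (\<Oplus>\<^bsub>M\<^esub>j\<in>{..<n}. a j \<odot>\<^bsub>M\<^esub> y j)"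
    and indep: "\<And>a. (\<And>j. j < n \<Longrightarrow> a j \<in> carrier A) \<Longrightarrow> (\<Oplus>\<^bsub>M\<^esub>j\<in>{..<n}. a j \<odot>\<^bsub>M\<^esub> y j) = \<zero>\<^bsub>M\<^esub> \<Longrightarrow> \<forall>j<n. a j = \<zero>\<^bsub>A\<^esub>"
    using basis[OF e] by blast
  let ?P = "free_module A {..<n}" and ?l = "free_lift A M y"
  let ?h = "restrict ?l (carrier ?P)"
  have P: "Module.module A ?P" by (rule free_module_module[OF M.R.cring_axioms])
  interpret P: Module.module A ?P by (rule P)
  have l: "module_linear A ?P M ?l" by (rule free_lift_module_linear[OF M]) (use y in auto)
  have h: "?h \<in> module_hom A ?P M" by (rule restrict_module_hom[OF P l])
  have eq: "?l g = (\<Oplus>\<^bsub>M\<^esub>j\<in>{..<n}. g j \<odot>\<^bsub>M\<^esub> y j)" if "g \<in> carrier ?P" for g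
    by (rule free_lift_lessThan[OF M y that])
  have ker: "g = \<zero>\<^bsub>?P\<^esub>" if g: "g \<in> carrier ?P" "?l g = \<zero>\<^bsub>M\<^esub>" for g
  proof
    fix j
    have "\<forall>j<n. g j = \<zero>\<^bsub>A\<^esub>" by (rule indep) (use g eq[OF g(1)] in \<open>auto simp: free_module_simps\<close>)
    then show "g j = \<zero>\<^bsub>?P\<^esub> j" using g(1) by (cases "j < n") (auto simp: free_module_simps)
  qed
  have "annihilated_by (u \<epsilon>) (?P\<lparr>carrier := a_kernel ?P M ?h\<rparr>)"
    unfolding annihilated_by_def
  proof
    fix g assume "g \<in> carrier (?P\<lparr>carrier := a_kernel ?P M ?h\<rparr>)"
    then have "g = \<zero>\<^bsub>?P\<^esub>" by (intro ker) (auto simp: a_kernel_def')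
    then show "u \<epsilon> \<odot>\<^bsub>?P\<lparr>carrier := a_kernel ?P M ?h\<rparr>\<^esub> g = \<zero>\<^bsub>?P\<lparr>carrier := a_kernel ?P M ?h\<rparr>\<^esub>"
      using ue by simp
  qed
  moreover have "annihilated_by (u \<epsilon>) (quotient_module M (?h ` carrier ?P))"
    unfolding annihilated_by_quotient_iff[OF M module_hom_image_submodule[OF P M h] ue]
  proof
    fix b assume b: "b \<in> carrier M"
    obtain a where a: "\<And>j. j < n \<Longrightarrow> a j \<in> carrier A" "u \<epsilon> \<odot>\<^bsub>M\<^esub> b = (\<Oplus>\<^bsub>M\<^esub>j\<in>{..<n}. a j \<odot>\<^bsub>M\<^esub> y j)"
      using span[OF b] by blast
    let ?g = "\<lambda>j. if j < n then a j else \<zero>\<^bsub>A\<^esub>"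
    have "finite {j. ?g j \<noteq> \<zero>\<^bsub>A\<^esub>}" by (rule finite_subset[of _ "{..<n}"]) auto
    then have g: "?g \<in> carrier ?P" using a(1) by (auto simp: free_module_simps)
    have "?l ?g = u \<epsilon> \<odot>\<^bsub>M\<^esub> b"
      unfolding eq[OF g] a(2) by (rule M.finsum_cong') (use a(1) y in auto)
    then show "u \<epsilon> \<odot>\<^bsub>M\<^esub> b \<in> ?h ` carrier ?P" using g by (intro image_eqI[of _ _ ?g]) auto
  qed
  ultimately show "\<exists>(P :: ('a, nat \<Rightarrow> 'a) module) h.
        Module.module A P \<and> finitely_presented A P \<and> h \<in> module_hom A P M \<and>
        annihilated_by (u \<epsilon>) (P\<lparr>carrier := a_kernel P M h\<rparr>) \<and>
        annihilated_by (u \<epsilon>) (quotient_module M (h ` carrier P))"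
    using P finitely_presented_free[OF M.R.cring_axioms, of n] h
      by (intro exI[of _ ?P] exI[of _ ?h]) auto
qed

context ring_tensor
begin

text \<open>The length n is fixed before \<epsilon>. It determines the exponent with which \<eta> is
  chosen, and only then is the almost basis for \<eta> taken; a length varying with \<eta> would
  make this choice circular.\<close>

lemma almost_finite_etale_iff_kaehler:
  fixes n :: nat
  assumes I: "I \<subseteq> carrier A"
    and basis: "\<And>\<epsilon>. \<epsilon> \<in> I \<Longrightarrow> \<exists>x h. (\<forall>j<n. x j \<in> carrier B \<and> module_linear A C (self_algebra A) (h j)) \<and>
        (\<forall>b\<in>carrier B. (\<Oplus>\<^bsub>C\<^esub>j\<in>{..<n}. h j b \<odot>\<^bsub>C\<^esub> x j) = f \<epsilon> \<otimes>\<^bsub>B\<^esub> b) \<and>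
        (\<forall>a. (\<forall>j<n. a j \<in> carrier A) \<longrightarrow> (\<Oplus>\<^bsub>C\<^esub>j\<in>{..<n}. a j \<odot>\<^bsub>C\<^esub> x j) = \<zero>\<^bsub>B\<^esub> \<longrightarrow> (\<forall>j<n. a j = \<zero>\<^bsub>A\<^esub>))"
    and root: "\<And>\<epsilon> N. \<epsilon> \<in> I \<Longrightarrow> 0 < N \<Longrightarrow> \<exists>\<eta>\<in>I. \<exists>c\<in>carrier A. \<epsilon> = c \<otimes>\<^bsub>A\<^esub> \<eta> [^]\<^bsub>A\<^esub> (N :: nat)"
  shows "almost_finite_etale I id A B f \<longleftrightarrow>
    almost_zero I (restrict_scalars f (kaehler_differentials A B f))"
proof -
  have idI: "id ` I \<subseteq> carrier A" using I by simp
  have "almost_finitely_presented I id A C"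
  proof (rule almost_finitely_presented_if_almost_basis[OF module_C idI])
    fix \<epsilon> assume e: "\<epsilon> \<in> I"
    obtain x h where xh': "\<forall>j<n. x j \<in> carrier B \<and> module_linear A C (self_algebra A) (h j)"
      "\<forall>b\<in>carrier B. (\<Oplus>\<^bsub>C\<^esub>j\<in>{..<n}. h j b \<odot>\<^bsub>C\<^esub> x j) = f \<epsilon> \<otimes>\<^bsub>B\<^esub> b"
      and indep: "\<forall>a. (\<forall>j<n. a j \<in> carrier A) \<longrightarrow> (\<Oplus>\<^bsub>C\<^esub>j\<in>{..<n}. a j \<odot>\<^bsub>C\<^esub> x j) = \<zero>\<^bsub>B\<^esub> \<longrightarrow> (\<forall>j<n. a j = \<zero>\<^bsub>A\<^esub>)"
      using basis[OF e] by (elim exE conjE) (rule that)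
    have xh: "\<And>j. j < n \<Longrightarrow> x j \<in> carrier B" "\<And>j. j < n \<Longrightarrow> module_linear A C (self_algebra A) (h j)"
      "\<And>b. b \<in> carrier B \<Longrightarrow> (\<Oplus>\<^bsub>C\<^esub>j\<in>{..<n}. h j b \<odot>\<^bsub>C\<^esub> x j) = f \<epsilon> \<otimes>\<^bsub>B\<^esub> b"
      using xh' by simp_all
    have hA: "h j b \<in> carrier A" if "j < n" "b \<in> carrier B" for j b
      using module_linearD(1)[OF xh(2)[OF that(1)], of b] that(2) by (simp add: self_algebra_simps)
    have "\<exists>a. (\<forall>j<n. a j \<in> carrier A) \<and> id \<epsilon> \<odot>\<^bsub>C\<^esub> b = (\<Oplus>\<^bsub>C\<^esub>j\<in>{..<n}. a j \<odot>\<^bsub>C\<^esub> x j)" if "b \<in> carrier C" for b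
      using xh(3)[of b] hA that by (intro exI[of _ "\<lambda>j. h j b"]) simp
    then show "\<exists>(n::nat) y. (\<forall>j<n. y j \<in> carrier C) \<and>
        (\<forall>b\<in>carrier C. \<exists>a. (\<forall>j<n. a j \<in> carrier A) \<and> id \<epsilon> \<odot>\<^bsub>C\<^esub> b = (\<Oplus>\<^bsub>C\<^esub>j\<in>{..<n}. a j \<odot>\<^bsub>C\<^esub> y j)) \<and>
        (\<forall>a. (\<forall>j<n. a j \<in> carrier A) \<longrightarrow> (\<Oplus>\<^bsub>C\<^esub>j\<in>{..<n}. a j \<odot>\<^bsub>C\<^esub> y j) = \<zero>\<^bsub>C\<^esub> \<longrightarrow> (\<forall>j<n. a j = \<zero>\<^bsub>A\<^esub>))"
      using xh(1) indep by (intro exI[of _ n] exI[of _ x] conjI) auto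
  qed
  moreover have "almost_projective I id A C"
  proof (rule almost_projectiveI[OF module_C idI])
    fix \<epsilon> assume "\<epsilon> \<in> I"
    from basis[OF this] obtain x h where xh: "\<forall>j<n. x j \<in> carrier B \<and>
      module_linear A C (self_algebra A) (h j)"
      "\<forall>b\<in>carrier B. (\<Oplus>\<^bsub>C\<^esub>j\<in>{..<n}. h j b \<odot>\<^bsub>C\<^esub> x j) = f \<epsilon> \<otimes>\<^bsub>B\<^esub> b"
      by (elim exE conjE) (rule that)
    then show "\<exists>(n::nat) y h. (\<forall>j<n. y j \<in> carrier C \<and> module_linear A C (self_algebra A) (h j)) \<and>
        (\<forall>x\<in>carrier C. (\<Oplus>\<^bsub>C\<^esub>j\<in>{..<n}. h j x \<odot>\<^bsub>C\<^esub> y j) = id \<epsilon> \<odot>\<^bsub>C\<^esub> x)"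
      by (intro exI[of _ n] exI[of _ x] exI[of _ h]) simp
  qed
  ultimately have "almost_finite_etale I id A B f \<longleftrightarrow> almost_projective I (\<lambda>r. id r \<odot>\<^bsub>T\<^esub> \<one>\<^bsub>T\<^esub>) T TB"
    by (simp add: almost_finite_etale_def Let_def T_def \<mu>_def)
  also have "\<dots> \<longleftrightarrow> almost_zero I (restrict_scalars f \<Omega>)"
    unfolding almost_projective_diagonal_iff[OF I] kaehler_almost_zero_iff[OF I]
  proof (intro iffI ballI)
    fix \<epsilon> b assume R: "\<forall>\<epsilon>\<in>I. \<exists>e\<in>carrier T. \<mu> e = f \<epsilon> \<and> (\<forall>x\<in>carrier B. tens x \<one>\<^bsub>B\<^esub> \<otimes>\<^bsub>T\<^esub> e = tens \<one>\<^bsub>B\<^esub> x \<otimes>\<^bsub>T\<^esub> e)"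
      and e: "\<epsilon> \<in> I" and b: "b \<in> carrier B"
    then obtain e where e: "e \<in> carrier T" "\<mu> e = f \<epsilon>"
      "\<And>x. x \<in> carrier B \<Longrightarrow> tens x \<one>\<^bsub>B\<^esub> \<otimes>\<^bsub>T\<^esub> e = tens \<one>\<^bsub>B\<^esub> x \<otimes>\<^bsub>T\<^esub> e" by blast
    show "f \<epsilon> \<odot>\<^bsub>\<Omega>\<^esub> d b = \<zero>\<^bsub>\<Omega>\<^esub>" using kills_differentials[OF e(1,3) b] e(2) by simp
  next
    fix \<epsilon> assume R: "\<forall>\<epsilon>\<in>I. \<forall>x\<in>carrier B. f \<epsilon> \<odot>\<^bsub>\<Omega>\<^esub> d x = \<zero>\<^bsub>\<Omega>\<^esub>" and e: "\<epsilon> \<in> I"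
    let ?N = "2 * (2 ^ n - 1) + 1 :: nat"
    obtain \<eta> c where \<eta>: "\<eta> \<in> I" and c: "c \<in> carrier A" "\<epsilon> = c \<otimes>\<^bsub>A\<^esub> \<eta> [^]\<^bsub>A\<^esub> ?N" using root[OF e, of ?N]
      by auto
    have \<eta>A: "\<eta> \<in> carrier A" using \<eta> I by auto
    obtain x h where xh': "\<forall>j<n. x j \<in> carrier B \<and> module_linear A C (self_algebra A) (h j)"
      "\<forall>b\<in>carrier B. (\<Oplus>\<^bsub>C\<^esub>j\<in>{..<n}. h j b \<odot>\<^bsub>C\<^esub> x j) = f \<eta> \<otimes>\<^bsub>B\<^esub> b"
      using basis[OF \<eta>] by (elim exE conjE) (rule that)
    have xh: "\<And>j. j < n \<Longrightarrow> x j \<in> carrier B" "\<And>j. j < n \<Longrightarrow> module_linear A C (self_algebra A) (h j)"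
      "\<And>b. b \<in> carrier B \<Longrightarrow> (\<Oplus>\<^bsub>C\<^esub>j\<in>{..<n}. h j b \<odot>\<^bsub>C\<^esub> x j) = f \<eta> \<otimes>\<^bsub>B\<^esub> b"
      using xh' by simp_all
    have hA: "h j b \<in> carrier A" if "j < n" "b \<in> carrier B" for j b
      using module_linearD(1)[OF xh(2)[OF that(1)], of b] that(2) by (simp add: self_algebra_simps)
    have "\<exists>e\<in>carrier T. \<mu> e = f \<eta> [^]\<^bsub>B\<^esub> ?N \<and> (\<forall>b\<in>carrier B. tens b \<one>\<^bsub>B\<^esub> \<otimes>\<^bsub>T\<^esub> e = tens \<one>\<^bsub>B\<^esub> b \<otimes>\<^bsub>T\<^esub> e)"
    proof (rule exists_almost_diagonal[OF \<eta>A xh(1)])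
      fix b assume "b \<in> carrier B"
      then show "\<exists>a. (\<forall>j<n. a j \<in> carrier A) \<and> f \<eta> \<otimes>\<^bsub>B\<^esub> b = (\<Oplus>\<^bsub>C\<^esub>j\<in>{..<n}. a j \<odot>\<^bsub>C\<^esub> x j)"
        using xh(3)[of b] hA by (intro exI[of _ "\<lambda>j. h j b"]) simp
    qed (use R \<eta> in auto)
    then obtain e where e: "e \<in> carrier T" "\<mu> e = f \<eta> [^]\<^bsub>B\<^esub> ?N"
      and diag: "\<And>b. b \<in> carrier B \<Longrightarrow> tens b \<one>\<^bsub>B\<^esub> \<otimes>\<^bsub>T\<^esub> e = tens \<one>\<^bsub>B\<^esub> b \<otimes>\<^bsub>T\<^esub> e" by blast
    \<comment> \<open>The power of \<eta> divides \<epsilon> but need not equal it; the cofactor c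
      is supplied through the left factor.\<close>
    let ?e = "tens (f c) \<one>\<^bsub>B\<^esub> \<otimes>\<^bsub>T\<^esub> e"
    have "\<mu> ?e = f \<epsilon>" using e c \<eta>A f.ring.hom_nat_pow[OF \<eta>A, of ?N] by (simp del: One_nat_def)
    moreover have "tens b \<one>\<^bsub>B\<^esub> \<otimes>\<^bsub>T\<^esub> ?e = tens \<one>\<^bsub>B\<^esub> b \<otimes>\<^bsub>T\<^esub> ?e" if "b \<in> carrier B" for b
      using e(1) c(1) that diag[OF that]
        T.m_lcomm[of "tens b \<one>\<^bsub>B\<^esub>" "tens (f c) \<one>\<^bsub>B\<^esub>" e] T.m_lcomm[of "tens \<one>\<^bsub>B\<^esub> b" "tens (f c) \<one>\<^bsub>B\<^esub>" e] by simp
    ultimately show "\<exists>e\<in>carrier T. \<mu> e = f \<epsilon> \<and> (\<forall>x\<in>carrier B. tens x \<one>\<^bsub>B\<^esub> \<otimes>\<^bsub>T\<^esub> e = tens \<one>\<^bsub>B\<^esub> x \<otimes>\<^bsub>T\<^esub> e)"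
      using e(1) c(1) by (intro bexI[of _ ?e]) auto
  qed
  finally show ?thesis by (simp add: \<Omega>_def)
qed

end

section \<open>Extensions of valuation rings\<close>

lemma ring_of_integers_simps [simp]:
  "carrier (ring_of_integers v) = valuation_ring v" "\<zero>\<^bsub>ring_of_integers v\<^esub> = 0" "\<one>\<^bsub>ring_of_integers v\<^esub> = 1"
  "ring.add (ring_of_integers v) = (+)" "monoid.mult (ring_of_integers v) = (*)"
  by (simp_all add: ring_of_integers_def ring_of_type_algebra_def)

lemma cring_ring_of_integers:
  assumes v: "valuation v"
  shows "cring (ring_of_integers v)"
proof -
  interpret R: ring "ring_of_type_algebra :: 'a ring" ..
  have neg: "\<ominus>\<^bsub>ring_of_type_algebra\<^esub> x = - x" for x :: 'a
    by (rule R.minus_equality) (auto simp: ring_of_type_algebra_def)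
  have sub: "subring (valuation_ring v) (ring_of_type_algebra :: 'a ring)"
    using valuation_subring_valuation_ring[OF v] by (simp add: valuation_subring_def)
  note E = subringE[OF sub, unfolded neg]
  have cl: "0 \<in> valuation_ring v" "1 \<in> valuation_ring v"
    "\<And>x. x \<in> valuation_ring v \<Longrightarrow> - x \<in> valuation_ring v"
    "\<And>x y. x \<in> valuation_ring v \<Longrightarrow> y \<in> valuation_ring v \<Longrightarrow> x + y \<in> valuation_ring v"
    "\<And>x y. x \<in> valuation_ring v \<Longrightarrow> y \<in> valuation_ring v \<Longrightarrow> x * y \<in> valuation_ring v"
    using E(2,3,5,6,7) by (simp_all add: ring_of_type_algebra_def)
  show ?thesis
  proof (rule cringI)
    show "abelian_group (ring_of_integers v)"
      by (rule abelian_groupI) (auto simp: cl algebra_simps intro: bexI[of _ "- _"])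
    show "Group.comm_monoid (ring_of_integers v)"
      by (rule comm_monoidI) (auto simp: cl algebra_simps)
  qed (simp add: algebra_simps)
qed

lemma finsum_eq_sum:
  assumes "abelian_monoid R" "ring.add R = (+)" "\<zero>\<^bsub>R\<^esub> = 0" "\<And>s. s \<in> S \<Longrightarrow> g s \<in> carrier R"
  shows "finsum R g S = sum g S"
proof -
  interpret abelian_monoid R by fact
  show ?thesis
    using assms(4)
    by (induction S rule: infinite_finite_induct) (simp_all add: assms(2,3) Pi_iff)
qed

theorem theorem1p4:
  fixes i :: "'k::field \<Rightarrow> 'l::field"
    and v :: "'l \<Rightarrow> 'g::linordered_ab_group_add"
  assumes "field_extension i"
    and "finite_extension i"
    and "separable_extension i"
    and "valuation v"
    and "unibranched i v"
    and "rank_one v"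
    and "nondiscrete v"
  shows "almost_finite_etale (maximal_ideal_of (v \<circ> i)) id
           (ring_of_integers (v \<circ> i)) (ring_of_integers v) i
         \<longleftrightarrow>
         almost_zero (maximal_ideal_of (v \<circ> i))
           (restrict_scalars i
             (kaehler_differentials (ring_of_integers (v \<circ> i)) (ring_of_integers v) i))"
proof -
  obtain h :: "'g \<Rightarrow> real" where mono: "strict_mono_on (value_group v) h"
    and add: "\<And>a b. a \<in> value_group v \<Longrightarrow> b \<in> value_group v \<Longrightarrow> h (a + b) = h a + h b"
    using assms(6) unfolding rank_one_def by blast
  \<comment> \<open>The map h is known to be monotone and additive on the value group only, so each
    comparison below is restricted to values of nonzero elements.\<close>
  define w where "w x = h (v x)" for x
  have mem: "v x \<in> value_group v" if "x \<noteq> 0" for x using that by (auto simp: value_group_def)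
  have v_mult: "v (x * y) = v x + v y" if "x \<noteq> 0" "y \<noteq> 0" for x y
    using assms(4) that unfolding valuation_def by blast
  have w_le: "w x \<le> w y \<longleftrightarrow> v x \<le> v y" if "x \<noteq> 0" "y \<noteq> 0" for x y
    unfolding w_def by (rule strict_mono_on_less_eq[OF mono mem[OF that(1)] mem[OF that(2)]])
  have i: "i (a + b) = i a + i b" "i (a * b) = i a * i b" "i 1 = 1" for a b
    using assms(1) by (auto simp: field_extension_def ring_hom_def ring_of_type_algebra_def)
  interpret E: real_valued_extension i w
  proof
    fix x y :: 'l assume xy: "x \<noteq> 0" "y \<noteq> 0"
    show "w (x * y) = w x + w y" using xy by (simp add: w_def v_mult add mem)
    assume "x + y \<noteq> 0"
    then have "min (v x) (v y) \<le> v (x + y)" using assms(4) xy unfolding valuation_def by blast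
    then have "v x \<le> v (x + y) \<or> v y \<le> v (x + y)" by (simp add: min_le_iff_disj)
    then have "w x \<le> w (x + y) \<or> w y \<le> w (x + y)" using xy \<open>x + y \<noteq> 0\<close> by (simp add: w_le)
    then show "min (w x) (w y) \<le> w (x + y)" by (simp add: min_le_iff_disj)
  qed (rule i)+
  have w_nonneg: "0 \<le> w x \<longleftrightarrow> 0 \<le> v x" if "x \<noteq> 0" for x
    using w_le[of 1 x] that valuation_one[OF assms(4)] by simp
  have w_pos: "0 < w x \<longleftrightarrow> 0 < v x" if "x \<noteq> 0" for x
    using w_le[of x 1] that valuation_one[OF assms(4)] by (simp add: not_le[symmetric])
  have O: "E.\<O> = valuation_ring v" unfolding E.\<O>_def valuation_ring_def using w_nonneg by blast
  have A: "E.A = valuation_ring (v \<circ> i)"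
    by (simp add: E.A_def O valuation_ring_def)
  have m: "E.\<mm> = maximal_ideal_of (v \<circ> i)"
    unfolding E.\<mm>_def maximal_ideal_of_def comp_def using w_pos E.i_eq_0 by blast
  obtain S where S: "finite S" "Modules.module.span (\<lambda>c x. i c * x) S = UNIV"
    using assms(2) unfolding finite_extension_def by blast
  \<comment> \<open>Nondiscreteness is assumed for the values of L, whereas the elements of I lie in
    K; small values therefore have to be carried down to K.\<close>
  have dense: "\<exists>a. a \<noteq> 0 \<and> 0 < w (i a) \<and> w (i a) < r" if "r > 0" for r
  proof (rule E.dense_base_values[OF S _ that])
    fix r :: real assume "r > 0"
    then show "\<exists>y. y \<noteq> 0 \<and> 0 < w y \<and> w y < r"
      unfolding w_def using assms(6)
        by (intro dense_values[OF assms(4) _ assms(7) mono add]) (simp_all add: rank_one_def)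
  qed
  obtain p where p: "p \<in> E.\<mm>" "p \<noteq> 0" using dense[of 1] by (auto simp: E.\<mm>_def)
  obtain n e g where e: "E.dual_basis n e g" using E.dual_basis_exists[OF S] by blast
  have lattice: "E.lattice E.\<O>"
  proof (rule E.lattice_O[OF e _ _ E.scale_into_O[OF p] p])
    show "E.separable_element x" for x
      using assms(3) E.separable_elementI unfolding separable_extension_def by blast
    show "E.integral_element x" if "x \<in> E.\<O>" for x
      using assms(5) that by (intro E.integral_if_unibranched) (auto simp: unibranched_def O A)
  qed
  let ?A = "ring_of_integers (v \<circ> i)" and ?B = "ring_of_integers v"
  have "valuation (v \<circ> i)"
    unfolding valuation_def
  proof (intro conjI allI impI)
    fix a b :: 'k assume ab: "a \<noteq> 0" "b \<noteq> 0"
    then show "(v \<circ> i) (a * b) = (v \<circ> i) a + (v \<circ> i) b" by (simp add: v_mult)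
    assume "a + b \<noteq> 0"
    then have "i a + i b \<noteq> 0" using E.i_eq_0[of "a + b"] by (simp del: E.i_eq_0)
    then show "min ((v \<circ> i) a) ((v \<circ> i) b) \<le> (v \<circ> i) (a + b)"
      using assms(4) ab unfolding valuation_def by simp
  qed
  then have A_cring: "cring ?A" by (rule cring_ring_of_integers)
  interpret R: ring_tensor ?A ?B i
    by (rule ring_tensor.intro, rule ring_hom_cring.intro[OF A_cring cring_ring_of_integers[OF assms(4)]],
        unfold ring_hom_cring_axioms_def, rule ring_hom_memI)
       (auto simp: valuation_ring_def)
  have monC: "abelian_monoid R.C"
    by (rule abelian_group.axioms(1)[OF Module.module.axioms(2)[OF R.module_C]])
  have sum: "(\<Oplus>\<^bsub>R.C\<^esub>j\<in>{..<n}. a j \<odot>\<^bsub>R.C\<^esub> x j) = (\<Sum>j<n. i (a j) * x j)"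
    if "\<forall>j<n. a j \<in> E.A" "\<forall>j<n. x j \<in> E.\<O>" for a x
  proof -
    have "finsum R.C (\<lambda>j. i (a j) * x j) {..<n} = (\<Sum>j<n. i (a j) * x j)"
      by (rule finsum_eq_sum[OF monC])
         (use that in \<open>auto intro: E.O_mult simp: O[symmetric] E.A_def restrict_scalars_def self_algebra_def\<close>)
    then show ?thesis by simp
  qed
  show ?thesis
  proof (rule R.almost_finite_etale_iff_kaehler[where n = n])
    show "maximal_ideal_of (v \<circ> i) \<subseteq> carrier ?A" using E.m_subset_A by (simp add: A m)
  next
    fix \<epsilon> assume "\<epsilon> \<in> maximal_ideal_of (v \<circ> i)"
    then have \<epsilon>: "\<epsilon> \<in> E.\<mm>" by (simp add: m)
    obtain x g where xg: "E.dual_basis n x g" "\<forall>k<n. x k \<in> E.\<O>" "\<forall>k<n. \<forall>b\<in>E.\<O>. \<epsilon> * g k b \<in> E.A"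
      using E.almost_dual_basis[OF dense e lattice \<epsilon>] by blast
    have lin: "E.klinear (g k)" if "k < n" for k using xg(1) that by (auto simp: E.dual_basis_def)
    have rep: "(\<Sum>k<n. i (g k b) * x k) = b" for b
      using xg(1) unfolding E.dual_basis_def by (metis (no_types, lifting))
    \<comment> \<open>The coordinate functionals take \<O> into A only after multiplication by
      \<epsilon>, so the multiples \<open>\<epsilon> * g j b\<close> serve as the functionals of the
      dual basis.\<close>
    have "x j \<in> carrier ?B \<and> module_linear ?A R.C (self_algebra ?A) (\<lambda>b. \<epsilon> * g j b)" if j: "j < n" for j
      using xg(2,3) j E.klinearD(1,2)[OF lin[OF j]]
      by (simp add: module_linear_def self_algebra_simps O A algebra_simps)
    moreover have "(\<Oplus>\<^bsub>R.C\<^esub>j\<in>{..<n}. (\<epsilon> * g j b) \<odot>\<^bsub>R.C\<^esub> x j) = i \<epsilon> \<otimes>\<^bsub>?B\<^esub> b" if "b \<in> carrier ?B" for b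
    proof -
      have "(\<Sum>j<n. i (\<epsilon> * g j b) * x j) = i \<epsilon> * (\<Sum>j<n. i (g j b) * x j)"
        by (simp add: sum_distrib_left mult.assoc)
      then show ?thesis using xg(2,3) that sum[of "\<lambda>j. \<epsilon> * g j b" x] by (simp add: rep O)
    qed
    moreover have "\<forall>j<n. a j = \<zero>\<^bsub>?A\<^esub>"
      if a: "\<forall>j<n. a j \<in> carrier ?A" and zero: "(\<Oplus>\<^bsub>R.C\<^esub>j\<in>{..<n}. a j \<odot>\<^bsub>R.C\<^esub> x j) = \<zero>\<^bsub>?B\<^esub>" for a
    proof (intro allI impI)
      fix k assume k: "k < n"
      \<comment> \<open>The unscaled coordinate functional, evaluated in L, isolates the coefficient
        \<open>a k\<close>.\<close>
      have "0 = g k (\<Sum>j<n. i (a j) * x j)"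
        using sum[of a x] xg(2) a zero E.klinearD(3)[OF lin[OF k]] by (simp add: A)
      also have "\<dots> = (\<Sum>j<n. a j * (if k = j then 1 else 0))"
        unfolding E.klinearD(6)[OF lin[OF k]] E.klinearD(2)[OF lin[OF k]]
        using xg(1) k by (intro sum.cong) (auto simp: E.dual_basis_def)
      also have "\<dots> = a k" using k by (simp add: if_distrib cong: if_cong)
      finally show "a k = \<zero>\<^bsub>?A\<^esub>" by simp
    qed
    ultimately show "\<exists>x h. (\<forall>j<n. x j \<in> carrier ?B \<and> module_linear ?A R.C (self_algebra ?A) (h j)) \<and>
        (\<forall>b\<in>carrier ?B. (\<Oplus>\<^bsub>R.C\<^esub>j\<in>{..<n}. h j b \<odot>\<^bsub>R.C\<^esub> x j) = i \<epsilon> \<otimes>\<^bsub>?B\<^esub> b) \<and>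
        (\<forall>a. (\<forall>j<n. a j \<in> carrier ?A) \<longrightarrow> (\<Oplus>\<^bsub>R.C\<^esub>j\<in>{..<n}. a j \<odot>\<^bsub>R.C\<^esub> x j) = \<zero>\<^bsub>?B\<^esub> \<longrightarrow> (\<forall>j<n. a j = \<zero>\<^bsub>?A\<^esub>))"
      by (intro exI[of _ x] exI[of _ "\<lambda>j b. \<epsilon> * g j b"]) blast
  next
    fix \<epsilon> and N :: nat assume \<epsilon>: "\<epsilon> \<in> maximal_ideal_of (v \<circ> i)" and N: "0 < N"
    have pow: "a [^]\<^bsub>?A\<^esub> k = a ^ k" for a and k :: nat
      by (induction k) (simp_all add: nat_pow_def mult.commute)
    show "\<exists>\<eta>\<in>maximal_ideal_of (v \<circ> i). \<exists>c\<in>carrier ?A. \<epsilon> = c \<otimes>\<^bsub>?A\<^esub> \<eta> [^]\<^bsub>?A\<^esub> N"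
      using E.almost_root[OF dense _ N, of \<epsilon>] \<epsilon> by (auto simp: m A pow)
  qed
qed

end
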